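(* Let $G$ be a compact Lie group and let $S$ be a closed non-orientable surface. Then $$\sum_{\lambda\in\hat G_1}(\dim\lambda)^{\chi(S)}+\sum_{\lambda\in\hat G_4}(-\dim\lambda)^{\chi(S)}=|G|^{\chi(S)-1}\,|\mathrm{Hom}(\pi_1(S),G)|$$ if the sum on the left-hand side is absolutely convergent.
   Context: $\hat G$ is the (countable) set of isomorphism classes of complex irreducible representations of $G$, $\dim\lambda$ the complex dimension of $\lambda$, $\chi_\lambda$ its character. Fix a (not necessarily normalized) bi-invariant Haar measure $dx$ on $G$ and put $|G|=\int_G dx$; powers of $G$ carry product measures. The set $\hat G$ is the disjoint union of $\hat G_1,\hat G_2,\hat G_4$, where $\lambda$ lies in $\hat G_1$, $\hat G_2$, $\hat G_4$ according to whether the Frobenius-Schur indicator $\frac1{|G|}\int_G\chi_\lambda(w^2)\,dw$ equals $1$, $0$, $-1$, respectively. A closed non-orientable surface $S$ has a cross-cap genus $k\ge1$, with Euler characteristic $\chi(S)=2-k$ and $\pi_1(S)=\langle a_1,\dots,a_k\mid a_1^2\cdots a_k^2\rangle$. Volume of the representation variety: the presentation map is $r_k:G^k\to G$, $r_k(x_1,\dots,x_k)=x_1^2\cdots x_k^2$, so $\mathrm{Hom}(\pi_1(S),G)=r_k^{-1}(1)$. The volume distribution $h_k$ is the distribution on $G$ (continuous linear functional on $C^\infty(G)$) given by the push-forward measure, $$\int_G h_k(w)g(w)\,dw=\int_{G^k}g(x_1^2\cdots x_k^2)\,dx_1\cdots dx_k,\qquad g\in C^\infty(G).$$ A distribution is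 called regular at $w$ if its restriction to some open neighborhood of $w$ is a $C^\infty$ function, so that its value at $w$ is well-defined. The volume is $|\mathrm{Hom}(\pi_1(S),G)|:=h_k(1)$, defined when $h_k$ is regular at $1$.
   Formalization: Absolute convergence does not make h_k smooth at 1 (e.g. SU(2), k=4), so the volume may be undefined; the equation is stated when h_k is regular at 1, and always with the volume replaced by the value at 1 of a continuous function representing h_k near 1. *)

theory Defs
  imports "HOL-Analysis.Analysis" "Jordan_Normal_Form.Matrix"
begin

section \<open>Compact Lie groups\<close>

text \<open>
  Not necessarily commutative groups in multiplicative notation; the multiplicative
  counterpart of the class \<^class>\<open>group_add\<close>.
\<close>

class group_mult = monoid_mult + inverse +
  assumes group_left_inverse: "inverse x * x = 1"
    and group_divide_inverse: "x / y = x * inverse y"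

text \<open>
  \<open>C\<^sup>m\<close> and \<open>C\<^sup>\<infinity>\<close> maps on an open subset \<open>U\<close> of a finite-dimensional space: all iterated
  directional derivatives up to order \<open>m\<close> exist and are continuous.
\<close>

primrec Ck_on :: "nat \<Rightarrow> 'e::real_normed_vector set \<Rightarrow> ('e \<Rightarrow> 'f::real_normed_vector) \<Rightarrow> bool" where
  "Ck_on 0 U f \<longleftrightarrow> continuous_on U f"
| "Ck_on (Suc m) U f \<longleftrightarrow> (\<forall>x\<in>U. f differentiable (at x)) \<and>
     (\<forall>v. Ck_on m U (\<lambda>x. frechet_derivative f (at x) v))"

definition smooth_on :: "'e::real_normed_vector set \<Rightarrow> ('e \<Rightarrow> 'f::real_normed_vector) \<Rightarrow> bool" where
  "smooth_on U f \<longleftrightarrow> (\<forall>m. Ck_on m U f)"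

text \<open>
  A chart is a pair \<open>(U, \<phi>)\<close> with \<open>\<phi>\<close> a homeomorphism from the open set \<open>U\<close> onto an open subset
  of the model space \<open>'e\<close>. The model space is a finite-dimensional real inner product space;
  the class \<^class>\<open>euclidean_space\<close> is not used because it excludes dimension \<open>0\<close>,
  that is, finite (discrete) groups. The underlying set of the manifold is the whole type \<open>'a\<close>.
\<close>

type_synonym ('a, 'e) atlas = "('a set \<times> ('a \<Rightarrow> 'e)) set"

definition smooth_atlas :: "('a::topological_space, 'e::real_inner) atlas \<Rightarrow> bool" where
  "smooth_atlas A \<longleftrightarrow>
     (\<exists>B::'e set. finite B \<and> span B = UNIV) \<and>
     (\<forall>(U, \<phi>)\<in>A. open U \<and> open (\<phi> ` U) \<and> inj_on \<phi> U \<and>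
        continuous_on U \<phi> \<and> continuous_on (\<phi> ` U) (inv_into U \<phi>)) \<and>
     (\<Union>(U, \<phi>)\<in>A. U) = UNIV \<and>
     (\<forall>(U, \<phi>)\<in>A. \<forall>(V, \<psi>)\<in>A. smooth_on (\<phi> ` (U \<inter> V)) (\<psi> \<circ> inv_into U \<phi>))"

definition prod_atlas :: "('a, 'e) atlas \<Rightarrow> ('b, 'f) atlas \<Rightarrow> ('a \<times> 'b, 'e \<times> 'f) atlas" where
  "prod_atlas A B = {(U \<times> V, map_prod \<phi> \<psi>) | U \<phi> V \<psi>. (U, \<phi>) \<in> A \<and> (V, \<psi>) \<in> B}"

definition smooth_map ::
  "('a::topological_space, 'e::real_normed_vector) atlas \<Rightarrow>
   ('b::topological_space, 'f::real_normed_vector) atlas \<Rightarrow> ('a \<Rightarrow> 'b) \<Rightarrow> bool" where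
  "smooth_map A B F \<longleftrightarrow> continuous_on UNIV F \<and>
     (\<forall>(U, \<phi>)\<in>A. \<forall>(V, \<psi>)\<in>B. smooth_on (\<phi> ` (U \<inter> F -` V)) (\<psi> \<circ> F \<circ> inv_into U \<phi>))"

text \<open>Complex-valued \<open>C\<^sup>\<infinity>\<close> functions on an open subset \<open>W\<close> of the manifold.\<close>

definition smooth_fun ::
  "('a, 'e::real_normed_vector) atlas \<Rightarrow> 'a set \<Rightarrow> ('a \<Rightarrow> complex) \<Rightarrow> bool" where
  "smooth_fun A W f \<longleftrightarrow> (\<forall>(U, \<phi>)\<in>A. smooth_on (\<phi> ` (U \<inter> W)) (f \<circ> inv_into U \<phi>))"

locale compact_lie_group =
  fixes A :: "('a::{group_mult, t2_space, second_countable_topology}, 'e::real_inner) atlas"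
  assumes compact: "compact (UNIV :: 'a set)"
    and atlas: "smooth_atlas A"
    and smooth_mult: "smooth_map (prod_atlas A A) A (\<lambda>(x, y). x * y)"
    and smooth_inverse: "smooth_map A A inverse"

text \<open>On a compact group finiteness on compact sets means finite total mass.\<close>

definition bi_invariant_haar :: "'a::{group_mult, topological_space} measure \<Rightarrow> bool" where
  "bi_invariant_haar \<mu> \<longleftrightarrow> sets \<mu> = sets borel \<and>
     emeasure \<mu> UNIV \<noteq> 0 \<and> emeasure \<mu> UNIV \<noteq> \<infinity> \<and>
     (\<forall>a. distr \<mu> borel (\<lambda>x. a * x) = \<mu>) \<and> (\<forall>a. distr \<mu> borel (\<lambda>x. x * a) = \<mu>)"


section \<open>Complex irreducible representations\<close>

text \<open>
  Finite-dimensional continuous representations, in matrix form; the dimension is a value, so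
  that representations of all dimensions live in one type.
\<close>

definition rep_dim :: "('a::one \<Rightarrow> complex mat) \<Rightarrow> nat" where
  "rep_dim \<rho> = dim_row (\<rho> 1)"

definition representation :: "('a::{group_mult, topological_space} \<Rightarrow> complex mat) \<Rightarrow> bool" where
  "representation \<rho> \<longleftrightarrow>
     (\<forall>x. \<rho> x \<in> carrier_mat (rep_dim \<rho>) (rep_dim \<rho>)) \<and>
     \<rho> 1 = 1\<^sub>m (rep_dim \<rho>) \<and>
     (\<forall>x y. \<rho> (x * y) = \<rho> x * \<rho> y) \<and>
     (\<forall>i<rep_dim \<rho>. \<forall>j<rep_dim \<rho>. continuous_on UNIV (\<lambda>x. \<rho> x $$ (i, j)))"

definition invariant_subspace :: "('a::one \<Rightarrow> complex mat) \<Rightarrow> complex vec set \<Rightarrow> bool" where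
  "invariant_subspace \<rho> W \<longleftrightarrow>
     W \<subseteq> carrier_vec (rep_dim \<rho>) \<and> 0\<^sub>v (rep_dim \<rho>) \<in> W \<and>
     (\<forall>v\<in>W. \<forall>w\<in>W. v + w \<in> W) \<and> (\<forall>c. \<forall>v\<in>W. c \<cdot>\<^sub>v v \<in> W) \<and>
     (\<forall>x. \<forall>v\<in>W. \<rho> x *\<^sub>v v \<in> W)"

definition irreducible_rep :: "('a::{group_mult, topological_space} \<Rightarrow> complex mat) \<Rightarrow> bool" where
  "irreducible_rep \<rho> \<longleftrightarrow> representation \<rho> \<and> rep_dim \<rho> > 0 \<and>
     (\<forall>W. invariant_subspace \<rho> W \<longrightarrow> W = {0\<^sub>v (rep_dim \<rho>)} \<or> W = carrier_vec (rep_dim \<rho>))"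

definition rep_iso :: "('a::one \<Rightarrow> complex mat) \<Rightarrow> ('a \<Rightarrow> complex mat) \<Rightarrow> bool" where
  "rep_iso \<rho> \<sigma> \<longleftrightarrow> rep_dim \<rho> = rep_dim \<sigma> \<and>
     (\<exists>P\<in>carrier_mat (rep_dim \<rho>) (rep_dim \<rho>). invertible_mat P \<and> (\<forall>x. P * \<rho> x = \<sigma> x * P))"

text \<open>The set \<open>\<hat>G\<close> of isomorphism classes.\<close>

definition irrep_classes :: "('a::{group_mult, topological_space} \<Rightarrow> complex mat) set set" where
  "irrep_classes = {\<rho>. irreducible_rep \<rho>} //
     {(\<rho>, \<sigma>). irreducible_rep \<rho> \<and> irreducible_rep \<sigma> \<and> rep_iso \<rho> \<sigma>}"

text \<open>Dimension and character are constant on isomorphism classes, hence the use of \<^const>\<open>the_elem\<close>.\<close>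

definition class_dim :: "('a::one \<Rightarrow> complex mat) set \<Rightarrow> nat" where
  "class_dim \<Lambda> = the_elem (rep_dim ` \<Lambda>)"

definition character :: "('a::one \<Rightarrow> complex mat) set \<Rightarrow> 'a \<Rightarrow> complex" where
  "character \<Lambda> x = the_elem ((\<lambda>\<rho>. \<Sum>i<rep_dim \<rho>. \<rho> x $$ (i, i)) ` \<Lambda>)"

definition fs_indicator :: "'a::group_mult measure \<Rightarrow> ('a \<Rightarrow> complex mat) set \<Rightarrow> complex" where
  "fs_indicator \<mu> \<Lambda> = (LINT w|\<mu>. character \<Lambda> (w ^ 2)) / complex_of_real (measure \<mu> UNIV)"

definition irrep_classes1 ::
  "'a::{group_mult, topological_space} measure \<Rightarrow> ('a \<Rightarrow> complex mat) set set" where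
  "irrep_classes1 \<mu> = {\<Lambda>\<in>irrep_classes. fs_indicator \<mu> \<Lambda> = 1}"

definition irrep_classes4 ::
  "'a::{group_mult, topological_space} measure \<Rightarrow> ('a \<Rightarrow> complex mat) set set" where
  "irrep_classes4 \<mu> = {\<Lambda>\<in>irrep_classes. fs_indicator \<mu> \<Lambda> = -1}"


section \<open>The volume of the representation variety\<close>

text \<open>
  A closed non-orientable surface enters through its cross-cap genus \<open>k \<ge> 1\<close>: its
  fundamental group is presented by \<open>a\<^sub>1, \<dots>, a\<^sub>k\<close> and the relator \<open>a\<^sub>1\<^sup>2 \<cdots> a\<^sub>k\<^sup>2\<close>.
\<close>

definition crosscap_euler_char :: "nat \<Rightarrow> int" where
  "crosscap_euler_char k = 2 - int k"

definition presentation_map :: "nat \<Rightarrow> (nat \<Rightarrow> 'a::monoid_mult) \<Rightarrow> 'a" where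
  "presentation_map k x = (\<Prod>i\<leftarrow>[0..<k]. (x i) ^ 2)"

text \<open>Distributions are functionals on the \<open>C\<^sup>\<infinity>\<close> functions; this is \<open>h\<^sub>k\<close>.\<close>

definition volume_distribution ::
  "'a::monoid_mult measure \<Rightarrow> nat \<Rightarrow> ('a \<Rightarrow> complex) \<Rightarrow> complex" where
  "volume_distribution \<mu> k g = (LINT x|(Pi\<^sub>M {..<k} (\<lambda>_. \<mu>)). g (presentation_map k x))"

text \<open>
  The restriction of the distribution \<open>D\<close> to the open set \<open>W\<close>, i.e. to the test functions with
  (compact) support in \<open>W\<close>, is the function \<open>f\<close>. The values of \<open>f\<close> outside \<open>W\<close> are irrelevant.
\<close>

definition represented_on ::
  "('a::topological_space, 'e::real_normed_vector) atlas \<Rightarrow> 'a measure \<Rightarrow>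
   (('a \<Rightarrow> complex) \<Rightarrow> complex) \<Rightarrow> 'a set \<Rightarrow> ('a \<Rightarrow> complex) \<Rightarrow> bool" where
  "represented_on A \<mu> D W f \<longleftrightarrow>
     (\<forall>g. smooth_fun A UNIV g \<and> closure {x. g x \<noteq> 0} \<subseteq> W \<longrightarrow> D g = (LINT x|\<mu>. f x * g x))"

definition regular_at ::
  "('a::topological_space, 'e::real_normed_vector) atlas \<Rightarrow> 'a measure \<Rightarrow>
   (('a \<Rightarrow> complex) \<Rightarrow> complex) \<Rightarrow> 'a \<Rightarrow> bool" where
  "regular_at A \<mu> D w \<longleftrightarrow>
     (\<exists>W f. open W \<and> w \<in> W \<and> smooth_fun A W f \<and> represented_on A \<mu> D W f)"

definition distribution_value ::
  "('a::topological_space, 'e::real_normed_vector) atlas \<Rightarrow> 'a measure \<Rightarrow>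
   (('a \<Rightarrow> complex) \<Rightarrow> complex) \<Rightarrow> 'a \<Rightarrow> complex" where
  "distribution_value A \<mu> D w =
     (THE v. \<exists>W f. open W \<and> w \<in> W \<and> smooth_fun A W f \<and> represented_on A \<mu> D W f \<and> f w = v)"

text \<open>Meaningful only if the volume distribution is regular at \<open>1\<close>.\<close>

definition hom_volume ::
  "('a::{group_mult, topological_space}, 'e::real_normed_vector) atlas \<Rightarrow> 'a measure \<Rightarrow> nat \<Rightarrow> complex" where
  "hom_volume A \<mu> k = distribution_value A \<mu> (volume_distribution \<mu> k) 1"

end

theory Submission
  imports Defs "HOL-Computational_Algebra.Polynomial"
    "Jordan_Normal_Form.Spectral_Radius" "Jordan_Normal_Form.Schur_Decomposition"
begin

text \<open>
  The distribution \<open>h\<^sub>k\<close> is the finite measure obtained by pushing Haar measure on \<open>G\<^sup>k\<close> forward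
  along \<open>x\<^sub>1\<^sup>2 \<cdots> x\<^sub>k\<^sup>2\<close>. For an irreducible \<open>\<rho>\<close> of dimension \<open>d\<close>, Schur's lemma gives
  \<open>\<integral>\<rho>(x\<^sup>2) dx = (|G| \<epsilon> / d) 1\<close> with \<open>\<epsilon>\<close> the Frobenius-Schur indicator, so the Fourier coefficient
  of \<open>h\<^sub>k\<close> at \<open>\<rho>\<close> is \<open>(|G| \<epsilon> / d)\<^sup>k 1\<close>. Since \<open>\<epsilon>\<close> is \<open>0\<close>, \<open>1\<close> or \<open>-1\<close> and characters are bounded by the
  dimension, the convergence hypothesis makes
  \<open>|G|\<^sup>k\<^sup>-\<^sup>1 \<Sum> \<epsilon>\<^sup>k d\<^sup>1\<^sup>-\<^sup>k \<chi>\<close> a uniformly convergent series of continuous functions with the same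
  Fourier coefficients. By the uniqueness part of the Peter-Weyl theorem it is the density of \<open>h\<^sub>k\<close>,
  and its value at \<open>1\<close> is the sum in question. Smooth bump functions show that any other local
  representative of \<open>h\<^sub>k\<close> takes the same value at \<open>1\<close>.

  For Peter-Weyl, a nonzero continuous \<open>F\<close> with vanishing Fourier coefficients yields a nonzero
  hermitian \<open>\<phi>\<close> with vanishing coefficients (the convolution of \<open>F\<^sup>*\<close> and \<open>F\<close>). Convolution with
  \<open>\<phi>\<^sup>2\<close> has a nonzero eigenvalue, whose eigenspace is finite-dimensional by Bessel's inequality and
  invariant under left translations. A minimal invariant subspace of it carries an irreducible
  representation, on which convolution with \<open>\<phi>\<^sup>2\<close> vanishes because its coefficients do.
\<close>


section \<open>Smooth bump functions\<close>

text \<open>Uniqueness of Fourier coefficients is a statement about continuous functions, whereas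
  the volume distribution is only a measure. The difference between this measure and
  \<open>density k\<close> is therefore smeared first: x is sent to the integral of g (x z).
  Coefficients taken at \<open>inverse z\<close> turn the translation into a matrix product, so
  equal coefficients make the smeared difference vanish, and its value at x = 1 compares the two
  integrals of g. The eigenvalue argument works with a convolution square because a hermitian kernel
  may have eigenvalues of both signs, and its rescaled powers could then oscillate; even powers
  cannot. The power of the negative dimension comes from \<open>\<epsilon> ^ k\<close> being equal
  to the power 2 - k of \<epsilon> for \<epsilon> = 1 or -1. The limit of the series is known to be
  continuous, not smooth. Local representatives are therefore compared as continuous functions, but
  tested against smooth functions only; this is the use of the bump functions.\<close>

lemma Ck_on_cong:
  assumes "open U" "\<And>x. x \<in> U \<Longrightarrow> f x = g x"
  shows "Ck_on m U f \<longleftrightarrow> Ck_on m U g"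
  using assms(2)
proof (induction m arbitrary: f g)
  case 0
  then have "continuous_on U f \<longleftrightarrow> continuous_on U g" by (intro continuous_on_cong) auto
  then show ?case by simp
next
  case (Suc m)
  have *: "Ck_on (Suc m) U g" if eq: "\<And>x. x \<in> U \<Longrightarrow> f x = g x" and f: "Ck_on (Suc m) U f"
    for f g :: "'a \<Rightarrow> 'b"
  proof -
    have "g differentiable (at x)" if "x \<in> U" for x
    proof -
      have "f differentiable (at x)" using f that by simp
      then obtain D where "(f has_derivative D) (at x)"
        unfolding differentiable_def by blast
      then have "(g has_derivative D) (at x)"
        by (rule has_derivative_transform_within_open[OF _ assms(1) that]) (rule eq)
      then show ?thesis unfolding differentiable_def by blast
    qed
    moreover have "Ck_on m U (\<lambda>x. frechet_derivative g (at x) v)" for v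
    proof -
      have "frechet_derivative f (at x) v = frechet_derivative g (at x) v" if "x \<in> U" for x
        using frechet_derivative_transform_within_open[OF _ assms(1) that eq] f that by simp
      moreover have "Ck_on m U (\<lambda>x. frechet_derivative f (at x) v)" using f by simp
      ultimately show ?thesis
        using Suc.IH[of "\<lambda>x. frechet_derivative f (at x) v" "\<lambda>x. frechet_derivative g (at x) v"] by simp
    qed
    ultimately show ?thesis by simp
  qed
  show ?case
  proof
    show "Ck_on (Suc m) U g" if "Ck_on (Suc m) U f" by (rule *[OF _ that]) (rule Suc.prems)
    show "Ck_on (Suc m) U f" if "Ck_on (Suc m) U g"
      by (rule *[where f = g]) (use that Suc.prems in auto)
  qed
qed

lemma Ck_on_subset: "Ck_on m U f \<Longrightarrow> V \<subseteq> U \<Longrightarrow> Ck_on m V f"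
  by (induction m arbitrary: f) (auto intro: continuous_on_subset)

text \<open>A bump function has two descriptions, a formula in a chart and the constant 0, valid on
  different open sets. Its smoothness is assembled from these with the help of this lemma.\<close>

lemma Ck_on_local:
  assumes "\<And>x. x \<in> U \<Longrightarrow> \<exists>V. open V \<and> x \<in> V \<and> Ck_on m V f"
  shows "Ck_on m U f"
  using assms
proof (induction m arbitrary: f)
  case 0
  have "isCont f x" if "x \<in> U" for x
    using 0[OF that] continuous_on_eq_continuous_at by auto
  then show ?case by (simp add: continuous_at_imp_continuous_on)
next
  case (Suc m)
  have "Ck_on m U (\<lambda>x. frechet_derivative f (at x) v)" for v
  proof (rule Suc.IH)
    fix x assume "x \<in> U"
    then obtain V where "open V" "x \<in> V" "Ck_on (Suc m) V f" using Suc.prems by blast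
    then show "\<exists>V. open V \<and> x \<in> V \<and> Ck_on m V (\<lambda>x. frechet_derivative f (at x) v)" by auto
  qed
  moreover have "f differentiable (at x)" if "x \<in> U" for x
    using Suc.prems[OF that] by auto
  ultimately show ?case by simp
qed

lemma Ck_on_Suc_D: "Ck_on (Suc m) U f \<Longrightarrow> Ck_on m U f"
proof (induction m arbitrary: f)
  case 0
  then show ?case
    by (auto intro!: continuous_at_imp_continuous_on differentiable_imp_continuous_within)
next
  case (Suc m)
  have "Ck_on m U (\<lambda>x. frechet_derivative f (at x) v)" for v
    using Suc.IH[of "\<lambda>x. frechet_derivative f (at x) v"] Suc.prems by simp
  moreover have "\<forall>x\<in>U. f differentiable (at x)" using Suc.prems by simp
  ultimately show ?case by simp
qed

lemma Ck_on_const [simp]: "Ck_on m U (\<lambda>x. c)"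
  by (induction m arbitrary: c) (auto simp: frechet_derivative_const)

lemma Ck_on_add:
  assumes "open U"
  shows "Ck_on m U f \<Longrightarrow> Ck_on m U g \<Longrightarrow> Ck_on m U (\<lambda>x. f x + g x)"
proof (induction m arbitrary: f g)
  case 0
  then show ?case by (simp add: continuous_on_add)
next
  case (Suc m)
  have d: "((\<lambda>x. f x + g x) has_derivative
      (\<lambda>v. frechet_derivative f (at x) v + frechet_derivative g (at x) v)) (at x)" if "x \<in> U" for x
    by (rule has_derivative_add) (use that Suc.prems in \<open>simp_all add: frechet_derivative_works[symmetric]\<close>)
  then have "frechet_derivative (\<lambda>x. f x + g x) (at x) v =
      frechet_derivative f (at x) v + frechet_derivative g (at x) v" if "x \<in> U" for x v
    using frechet_derivative_at[OF d[OF that]] by metis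
  moreover have "Ck_on m U (\<lambda>x. frechet_derivative f (at x) v + frechet_derivative g (at x) v)" for v
    by (rule Suc.IH) (use Suc.prems in auto)
  ultimately have "Ck_on m U (\<lambda>x. frechet_derivative (\<lambda>x. f x + g x) (at x) v)" for v
    by (subst Ck_on_cong[OF assms]) auto
  then show ?case using Suc.prems by auto
qed

lemma Ck_on_bounded_linear:
  assumes "open U" "bounded_linear L"
  shows "Ck_on m U f \<Longrightarrow> Ck_on m U (\<lambda>x. L (f x))"
proof (induction m arbitrary: f)
  case 0
  then show ?case by (simp add: bounded_linear.continuous_on[OF assms(2)])
next
  case (Suc m)
  have d: "((\<lambda>x. L (f x)) has_derivative (\<lambda>v. L (frechet_derivative f (at x) v))) (at x)"
    if "x \<in> U" for x
    using that Suc.prems by (simp add: bounded_linear.has_derivative[OF assms(2)] frechet_derivative_works[symmetric])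
  then have "frechet_derivative (\<lambda>x. L (f x)) (at x) v = L (frechet_derivative f (at x) v)"
    if "x \<in> U" for x v
    using frechet_derivative_at[OF d[OF that]] by metis
  moreover have "Ck_on m U (\<lambda>x. L (frechet_derivative f (at x) v))" for v
    by (rule Suc.IH) (use Suc.prems in auto)
  ultimately have "Ck_on m U (\<lambda>x. frechet_derivative (\<lambda>x. L (f x)) (at x) v)" for v
    by (subst Ck_on_cong[OF assms(1)]) auto
  then show ?case using d unfolding Ck_on.simps differentiable_def by blast
qed

text \<open>Serves twice: for the squared distance in the model space and, with real values, for the
  product that the chain rule produces in \<open>Ck_on_flat_fun\<close>.\<close>

lemma Ck_on_inner:
  fixes f g :: "'e::real_normed_vector \<Rightarrow> 'f::real_inner"
  assumes "open U"
  shows "Ck_on m U f \<Longrightarrow> Ck_on m U g \<Longrightarrow> Ck_on m U (\<lambda>x. f x \<bullet> g x)"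
proof (induction m arbitrary: f g)
  case 0
  then show ?case by (simp add: continuous_on_inner)
next
  case (Suc m)
  have d: "((\<lambda>x. f x \<bullet> g x) has_derivative
     (\<lambda>v. f x \<bullet> frechet_derivative g (at x) v + frechet_derivative f (at x) v \<bullet> g x)) (at x)"
    if "x \<in> U" for x
    by (rule has_derivative_inner) (use that Suc.prems in \<open>simp_all add: frechet_derivative_works[symmetric]\<close>)
  then have "frechet_derivative (\<lambda>x. f x \<bullet> g x) (at x) v =
     f x \<bullet> frechet_derivative g (at x) v + frechet_derivative f (at x) v \<bullet> g x"
    if "x \<in> U" for x v
    using frechet_derivative_at[OF d[OF that]] by metis
  moreover have "Ck_on m U (\<lambda>x. f x \<bullet> frechet_derivative g (at x) v + frechet_derivative f (at x) v \<bullet> g x)" for v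
    by (intro Ck_on_add[OF assms] Suc.IH) (use Suc.prems in \<open>auto intro: Ck_on_Suc_D\<close>)
  ultimately have "Ck_on m U (\<lambda>x. frechet_derivative (\<lambda>x. f x \<bullet> g x) (at x) v)" for v
    by (subst Ck_on_cong[OF assms(1)]) auto
  then show ?case using d unfolding Ck_on.simps differentiable_def by blast
qed

text \<open>For p = 1 this is the classical flat function exp (-1/s), extended by 0. The polynomial
  in 1/s is a parameter because the resulting family is closed under differentiation, which lets an
  induction on the order of differentiability go through.\<close>

definition flat_fun :: "real poly \<Rightarrow> real \<Rightarrow> real" where
  "flat_fun p s = (if s > 0 then poly p (inverse s) * exp (- inverse s) else 0)"

lemma poly_exp_tendsto_0: "((\<lambda>u. poly p u * exp (- u)) \<longlongrightarrow> 0) at_top" for p :: "real poly"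
proof -
  have "((\<lambda>u. \<Sum>i\<le>degree p. coeff p i * (u ^ i / exp u)) \<longlongrightarrow> (\<Sum>i\<le>degree p. coeff p i * 0)) at_top"
    by (intro tendsto_intros tendsto_power_div_exp_0)
  then show ?thesis
    by (simp add: poly_altdef sum_distrib_right exp_minus field_simps flip: sum_divide_distrib)
qed

lemma flat_fun_tendsto_0: "(flat_fun p \<longlongrightarrow> 0) (at 0)"
proof -
  have "(flat_fun p \<longlongrightarrow> 0) (at_left 0)"
    by (rule Lim_transform_eventually[OF tendsto_const])
       (auto simp: flat_fun_def eventually_at_filter)
  moreover have "(flat_fun p \<longlongrightarrow> 0) (at_right 0)"
  proof (rule Lim_transform_eventually)
    show "((\<lambda>s. poly p (inverse s) * exp (- inverse s)) \<longlongrightarrow> 0) (at_right 0)"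
      using filterlim_compose[OF poly_exp_tendsto_0 filterlim_inverse_at_top_right] .
    show "\<forall>\<^sub>F x in at_right 0. poly p (inverse x) * exp (- inverse x) = flat_fun p x"
      by (auto simp: flat_fun_def eventually_at_filter)
  qed
  ultimately show ?thesis by (simp add: filterlim_split_at)
qed

text \<open>With u = 1/s one has du/ds = - u^2, so p(u) exp(-u) has the derivative u^2 (p(u) -
  p'(u)) exp(-u); the factor \<open>[:0, 0, 1:]\<close> is u^2. At s = 0 the difference quotient is
  again a member of the family, with p multiplied by u, and tends to 0.\<close>

lemma flat_fun_deriv:
  "(flat_fun p has_real_derivative flat_fun ([:0, 0, 1:] * (p - pderiv p)) s) (at s)"
proof -
  consider "s > 0" | "s < 0" | "s = 0" by linarith
  then show ?thesis
  proof cases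
    case 1
    have "((\<lambda>s. poly p (inverse s) * exp (- inverse s)) has_real_derivative
        flat_fun ([:0, 0, 1:] * (p - pderiv p)) s) (at s)"
      using 1 by (auto intro!: derivative_eq_intros DERIV_chain2[OF poly_DERIV] simp: flat_fun_def)
        (simp add: field_simps power2_eq_square)
    then show ?thesis
      by (rule has_field_derivative_transform_within_open[of _ _ _ "{0<..}"])
         (use 1 in \<open>auto simp: flat_fun_def\<close>)
  next
    case 2
    have "((\<lambda>s. 0) has_real_derivative flat_fun ([:0, 0, 1:] * (p - pderiv p)) s) (at s)"
      using 2 by (simp add: flat_fun_def)
    then show ?thesis
      by (rule has_field_derivative_transform_within_open[of _ _ _ "{..<0}"])
         (use 2 in \<open>auto simp: flat_fun_def\<close>)
  next
    case 3
    have "flat_fun p h / h = flat_fun (pCons 0 p) h" if "h \<noteq> 0" for h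
      using that by (auto simp: flat_fun_def field_simps)
    then have "((\<lambda>h. (flat_fun p (0 + h) - flat_fun p 0) / h) \<longlongrightarrow> 0) (at 0)"
      by (intro Lim_transform_eventually[OF flat_fun_tendsto_0[of "pCons 0 p"]])
         (auto simp: eventually_at_filter flat_fun_def[of p 0])
    then show ?thesis using 3 by (simp add: DERIV_def flat_fun_def)
  qed
qed

lemma Ck_on_flat_fun:
  fixes q :: "'e::real_normed_vector \<Rightarrow> real"
  assumes "open U"
  shows "Ck_on m U q \<Longrightarrow> Ck_on m U (\<lambda>x. flat_fun p (q x))"
proof (induction m arbitrary: p)
  case 0
  have "continuous_on UNIV (flat_fun p)"
    using flat_fun_deriv DERIV_isCont continuous_at_imp_continuous_on by blast
  then show ?case using 0 by (auto intro: continuous_on_compose2)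
next
  case (Suc m)
  let ?p' = "[:0, 0, 1:] * (p - pderiv p)"
  have d: "((\<lambda>x. flat_fun p (q x)) has_derivative
      (\<lambda>v. flat_fun ?p' (q x) * frechet_derivative q (at x) v)) (at x)"
    if "x \<in> U" for x
    using has_derivative_compose[of q "frechet_derivative q (at x)" x UNIV "flat_fun p",
        OF _ flat_fun_deriv[of p "q x", unfolded has_field_derivative_def]] that Suc.prems
    by (simp only: frechet_derivative_works[symmetric] Ck_on.simps simp_thms)
  then have "frechet_derivative (\<lambda>x. flat_fun p (q x)) (at x) v =
      flat_fun ?p' (q x) \<bullet> frechet_derivative q (at x) v"
    if "x \<in> U" for x v
    using frechet_derivative_at[OF d[OF that]] by (metis inner_real_def)
  moreover have "Ck_on m U (\<lambda>x. flat_fun ?p' (q x) \<bullet> frechet_derivative q (at x) v)" for v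
    by (intro Ck_on_inner[OF assms] Suc.IH) (use Suc.prems in \<open>auto intro: Ck_on_Suc_D\<close>)
  ultimately have "Ck_on m U (\<lambda>x. frechet_derivative (\<lambda>x. flat_fun p (q x)) (at x) v)" for v
    by (subst Ck_on_cong[OF assms(1)]) auto
  then show ?case using d unfolding Ck_on.simps differentiable_def by blast
qed

text \<open>Each point of the compact complement of U is separated from x. Finitely many of the
  separating open sets cover the complement, and the intersection of the matching neighbourhoods of
  x has a closure that misses this open cover.\<close>

lemma compact_t2_regular:
  fixes U :: "'a::t2_space set"
  assumes "compact (UNIV :: 'a set)" "open U" "x \<in> U"
  obtains N where "open N" "x \<in> N" "closure N \<subseteq> U"
proof -
  have "compact (- U)"
    using compact_diff[OF assms(1,2)] by (simp add: Compl_eq_Diff_UNIV)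
  define \<C> where "\<C> = {V. open V \<and> (\<exists>N. open N \<and> x \<in> N \<and> N \<inter> V = {})}"
  have "- U \<subseteq> \<Union>\<C>"
  proof
    fix y assume "y \<in> - U"
    then have "x \<noteq> y" using assms(3) by auto
    from hausdorff[OF this] show "y \<in> \<Union>\<C>" unfolding \<C>_def by blast
  qed
  then obtain D where D: "D \<subseteq> \<C>" "finite D" "- U \<subseteq> \<Union>D"
    using compactE[OF \<open>compact (- U)\<close>, of \<C>] unfolding \<C>_def by blast
  have "\<forall>V\<in>D. \<exists>N. open N \<and> x \<in> N \<and> N \<inter> V = {}" using D unfolding \<C>_def by auto
  then obtain N where N: "\<And>V. V \<in> D \<Longrightarrow> open (N V) \<and> x \<in> N V \<and> N V \<inter> V = {}" by metis
  let ?N = "\<Inter>V\<in>D. N V"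
  have op: "open ?N" using N D by auto
  have "open (\<Union>D)" using D unfolding \<C>_def by auto
  then have "closure ?N \<inter> \<Union>D = {}"
    using N open_Int_closure_eq_empty[of "\<Union>D" ?N] by blast
  then have "closure ?N \<subseteq> U" using D by blast
  then show thesis using that op N by auto
qed

context compact_lie_group
begin

lemma chart_image_open:
  assumes "(V, \<psi>) \<in> A" "open N"
  shows "open (\<psi> ` (V \<inter> N))"
proof -
  have *: "open (\<psi> ` V)" "inj_on \<psi> V" "continuous_on (\<psi> ` V) (inv_into V \<psi>)"
    using atlas assms(1) unfolding smooth_atlas_def by fast+
  have "\<psi> ` (V \<inter> N) = inv_into V \<psi> -` N \<inter> \<psi> ` V" using *(2) by (auto simp: inv_into_f_f)
  then show ?thesis using * assms(2) by (metis continuous_on_open_vimage)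
qed

text \<open>The flat function is applied to a quadratic polynomial in a chart and the result is
  extended by 0. The extension is smooth because the support stays away from the edge of the
  neighbourhood \<open>N\<close> on which the formula is used.\<close>

lemma smooth_bump:
  assumes "open W" "p \<in> W"
  obtains g :: "'a \<Rightarrow> real" where "smooth_fun A UNIV (\<lambda>x. complex_of_real (g x))"
    "closure {x. g x \<noteq> 0} \<subseteq> W" "\<And>x. g x \<ge> 0" "g p > 0" "continuous_on UNIV g"
proof -
  have "p \<in> (\<Union>(U, \<phi>)\<in>A. U)"
    using atlas unfolding smooth_atlas_def by simp
  then obtain U \<phi> where U: "(U, \<phi>) \<in> A" "p \<in> U" by blast
  have chart: "open U" "inj_on \<phi> U" "continuous_on U \<phi>"
    using atlas U(1) unfolding smooth_atlas_def by fast+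
  obtain N where N: "open N" "p \<in> N" "closure N \<subseteq> U \<inter> W"
    using compact_t2_regular[OF compact, of "U \<inter> W" p] assms U chart by blast
  \<comment> \<open>The boundary of \<open>N\<close>. Its image under the chart is compact and
    misses \<open>\<phi> p\<close>, so some ball around \<open>\<phi> p\<close> misses it as
    well.\<close>
  let ?B = "closure N - N"
  have "compact ?B"
    using compact_Int_closed[OF compact closed_Diff[OF closed_closure N(1)]] by simp
  moreover have "continuous_on ?B \<phi>"
    by (rule continuous_on_subset[OF chart(3)]) (use N in auto)
  ultimately have "closed (\<phi> ` ?B)"
    by (simp add: compact_continuous_image compact_imp_closed)
  moreover have "\<phi> p \<notin> \<phi> ` ?B"
    using N chart(2) U(2) by (auto simp: inj_on_def) 
  ultimately obtain r where r: "r > 0" "ball (\<phi> p) r \<subseteq> - \<phi> ` ?B"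
    by (metis ComplI open_Compl openE)
  \<comment> \<open>Positivity of \<open>q\<close> confines points to radius r/2 instead of r, so
    that the closed condition that survives passage to the closure still excludes the boundary of
    \<open>N\<close>.\<close>
  define q where "q v = r\<^sup>2 / 4 - (v - \<phi> p) \<bullet> (v - \<phi> p)" for v
  define g where "g x = (if x \<in> N then flat_fun 1 (q (\<phi> x)) else 0)" for x
  have q_pos: "dist (\<phi> p) v \<le> r / 2" if "q v > 0" for v
  proof -
    have "(dist (\<phi> p) v)\<^sup>2 < (r / 2)\<^sup>2"
      using that by (simp add: q_def dist_norm norm_minus_commute power2_norm_eq_inner power_divide)
    then show ?thesis using r(1) by (smt (verit) power_mono zero_le_divide_iff)
  qed
  define K where "K = closure {x. g x \<noteq> 0}"
  have "K \<subseteq> {x \<in> closure N. dist (\<phi> p) (\<phi> x) \<le> r / 2}"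
    unfolding K_def
  proof (rule closure_minimal)
    show "{x. g x \<noteq> 0} \<subseteq> {x \<in> closure N. dist (\<phi> p) (\<phi> x) \<le> r / 2}"
      using q_pos closure_subset[of N] by (auto simp: g_def flat_fun_def split: if_splits)
    have "continuous_on (closure N) (\<lambda>x. dist (\<phi> p) (\<phi> x))"
      by (intro continuous_intros continuous_on_subset[OF chart(3)]) (use N in auto)
    then have "closed (closure N \<inter> (\<lambda>x. dist (\<phi> p) (\<phi> x)) -` {..r/2})"
      by (intro continuous_closed_preimage) auto
    moreover have "closure N \<inter> (\<lambda>x. dist (\<phi> p) (\<phi> x)) -` {..r/2} =
      {x \<in> closure N. dist (\<phi> p) (\<phi> x) \<le> r / 2}" by auto
    ultimately show "closed {x \<in> closure N. dist (\<phi> p) (\<phi> x) \<le> r / 2}" by simp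
  qed
  moreover have "x \<in> N" if "x \<in> closure N" "dist (\<phi> p) (\<phi> x) \<le> r / 2" for x
  proof (rule ccontr)
    assume "x \<notin> N"
    then have "\<phi> x \<notin> ball (\<phi> p) r" using r(2) that(1) by blast
    then show False using that(2) r(1) by simp
  qed
  ultimately have KN: "K \<subseteq> N" by blast
  \<comment> \<open>The open sets \<open>N\<close> and \<open>- K\<close> cover the group, since
    \<open>K\<close> lies inside \<open>N\<close>. On the first the chart formula holds, on the
    second the function is 0.\<close>
  have Kc: "open (- K)" by (simp add: K_def open_Compl)
  have g0: "g x = 0" if "x \<notin> K" for x
    using that closure_subset[of "{x. g x \<noteq> 0}"] by (auto simp: K_def)
  have Ck: "Ck_on m (\<psi> ` (V \<inter> UNIV)) ((\<lambda>x. complex_of_real (g x)) \<circ> inv_into V \<psi>)"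
    if V: "(V, \<psi>) \<in> A" for V \<psi> m
  proof (rule Ck_on_local)
    have inj: "inj_on \<psi> V" using atlas V unfolding smooth_atlas_def by fast
    fix y assume "y \<in> \<psi> ` (V \<inter> UNIV)"
    then obtain z where z: "z \<in> V" "y = \<psi> z" by auto
    show "\<exists>Y. open Y \<and> y \<in> Y \<and> Ck_on m Y ((\<lambda>x. complex_of_real (g x)) \<circ> inv_into V \<psi>)"
    proof (cases "z \<in> N")
      case True
      let ?Y = "\<psi> ` (V \<inter> N)"
      have op: "open ?Y" by (rule chart_image_open[OF V N(1)])
      have "smooth_on (\<psi> ` (V \<inter> U)) (\<phi> \<circ> inv_into V \<psi>)"
        using atlas V U(1) unfolding smooth_atlas_def by fast
      then have 1: "Ck_on m ?Y (\<lambda>y. \<phi> (inv_into V \<psi> y))"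
        unfolding smooth_on_def comp_def
        by (rule allE[where x = m], elim Ck_on_subset) (use N closure_subset[of N] in auto)
      have 2: "Ck_on m ?Y (\<lambda>y. \<phi> (inv_into V \<psi> y) - \<phi> p)"
        using Ck_on_add[OF op 1 Ck_on_const[of _ _ "- \<phi> p"]] by simp
      have 3: "Ck_on m ?Y (\<lambda>y. q (\<phi> (inv_into V \<psi> y)))"
        using Ck_on_add[OF op Ck_on_const[of _ _ "r\<^sup>2 / 4"]
            Ck_on_bounded_linear[OF op bounded_linear_minus[OF bounded_linear_ident] Ck_on_inner[OF op 2 2]]]
        by (simp add: q_def)
      have "Ck_on m ?Y (\<lambda>y. complex_of_real (flat_fun 1 (q (\<phi> (inv_into V \<psi> y)))))"
        by (intro Ck_on_bounded_linear[OF op bounded_linear_of_real] Ck_on_flat_fun[OF op] 3)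
      then have "Ck_on m ?Y ((\<lambda>x. complex_of_real (g x)) \<circ> inv_into V \<psi>)"
        by (rule Ck_on_cong[OF op, THEN iffD1, rotated]) (use inj in \<open>auto simp: g_def inv_into_f_f\<close>)
      then show ?thesis using op z True by blast
    next
      case False
      let ?Y = "\<psi> ` (V \<inter> - K)"
      have op: "open ?Y" by (rule chart_image_open[OF V Kc])
      have "Ck_on m ?Y ((\<lambda>x. complex_of_real (g x)) \<circ> inv_into V \<psi>)"
        by (rule Ck_on_cong[OF op, THEN iffD1, rotated, OF Ck_on_const[of _ _ 0]])
           (use inj g0 in \<open>auto simp: inv_into_f_f\<close>)
      then show ?thesis using op z False KN by blast
    qed
  qed
  have smooth: "smooth_fun A UNIV (\<lambda>x. complex_of_real (g x))"
    unfolding smooth_fun_def smooth_on_def using Ck by auto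
  have "continuous_on UNIV g"
  proof -
    have "continuous_on N (\<lambda>x. flat_fun 1 (q (\<phi> x)))"
    proof (rule continuous_on_compose2[of UNIV "flat_fun 1"])
      show "continuous_on UNIV (flat_fun 1)"
        using flat_fun_deriv DERIV_isCont continuous_at_imp_continuous_on by blast
      show "continuous_on N (\<lambda>x. q (\<phi> x))"
        unfolding q_def by (intro continuous_intros continuous_on_subset[OF chart(3)])
          (use N closure_subset[of N] in auto)
    qed auto
    then have "continuous_on N g" by (simp add: g_def cong: continuous_on_cong)
    moreover have "continuous_on (- K) g"
      using g0 continuous_on_cong[of "- K" "- K" g "\<lambda>_. 0"] by simp
    ultimately have "continuous_on (N \<union> - K) g"
      using N(1) Kc by (simp add: continuous_on_open_Un)
    moreover have "N \<union> - K = UNIV" using KN by blast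
    ultimately show ?thesis by metis
  qed
  moreover have "g p > 0" using N(2) r(1) by (simp add: g_def q_def flat_fun_def)
  moreover have "g x \<ge> 0" for x by (simp add: g_def flat_fun_def)
  moreover have "K \<subseteq> W" using KN N(3) closure_subset[of N] by blast
  ultimately show thesis using that[of g] smooth K_def by blast
qed

end

section \<open>Haar integration and convolution\<close>

lemma group_right_inverse: "x * inverse x = 1" for x :: "'a::group_mult"
  by (metis group_left_inverse mult.assoc mult.left_neutral)

lemma group_inverse_cancel_left: "inverse x * (x * y) = y" for x y :: "'a::group_mult"
  by (metis group_left_inverse mult.assoc mult.left_neutral)

lemma group_cancel_inverse_left: "x * (inverse x * y) = y" for x y :: "'a::group_mult"
  by (metis group_right_inverse mult.assoc mult.left_neutral)

lemma group_inverse_unique: "x * y = 1 \<Longrightarrow> inverse x = y" for x y :: "'a::group_mult"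
  by (metis group_inverse_cancel_left mult.right_neutral)

lemma group_inverse_inverse: "inverse (inverse x) = x" for x :: "'a::group_mult"
  by (rule group_inverse_unique) (rule group_left_inverse)

lemma group_inverse_mult: "inverse (x * y) = inverse y * inverse x" for x y :: "'a::group_mult"
  by (rule group_inverse_unique) (metis mult.assoc group_right_inverse mult.right_neutral)

lemma group_inverse_one: "inverse 1 = (1 :: 'a::group_mult)"
  by (rule group_inverse_unique) simp

lemmas group_simps = group_left_inverse group_right_inverse group_inverse_cancel_left
  group_cancel_inverse_left group_inverse_inverse group_inverse_mult group_inverse_one mult.assoc

lemma continuous_comp_UNIV:
  "continuous_on UNIV f \<Longrightarrow> continuous_on S g \<Longrightarrow> continuous_on S (\<lambda>x. f (g x))"
  by (rule continuous_on_compose2) auto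

text \<open>Common ground of the Haar measure and of the push-forward that carries the volume
  distribution; integration of continuous functions is developed for both at once.\<close>

definition finite_borel :: "'a::topological_space measure \<Rightarrow> bool" where
  "finite_borel \<nu> \<longleftrightarrow> sets \<nu> = sets borel \<and> finite_measure \<nu>"

locale haar_group =
  fixes \<mu> :: "'a::{group_mult, t2_space, second_countable_topology} measure"
  assumes compact_UNIV: "compact (UNIV :: 'a set)"
    and cont_mult: "continuous_on UNIV (\<lambda>p :: 'a \<times> 'a. fst p * snd p)"
    and cont_inverse: "continuous_on UNIV (inverse :: 'a \<Rightarrow> 'a)"
    and haar: "bi_invariant_haar \<mu>"
begin

lemma continuous_on_gmult [continuous_intros]:
  fixes f g :: "'b::topological_space \<Rightarrow> 'a"
  assumes "continuous_on S f" "continuous_on S g"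
  shows "continuous_on S (\<lambda>x. f x * g x)"
  using continuous_comp_UNIV[OF cont_mult, of S "\<lambda>x. (f x, g x)"] assms
  by (simp add: continuous_on_Pair)

lemma continuous_on_ginverse [continuous_intros]:
  fixes f :: "'b::topological_space \<Rightarrow> 'a"
  shows "continuous_on S f \<Longrightarrow> continuous_on S (\<lambda>x. inverse (f x))"
  by (rule continuous_comp_UNIV[OF cont_inverse])

lemma finite_borel_haar: "finite_borel \<mu>"
proof -
  have "space \<mu> = UNIV" using haar sets_eq_imp_space_eq[of \<mu> borel] by (simp add: bi_invariant_haar_def)
  then show ?thesis
    using haar by (auto simp: finite_borel_def bi_invariant_haar_def intro!: finite_measureI)
qed

sublocale finite_measure \<mu> using finite_borel_haar by (simp add: finite_borel_def)

lemma sets_haar: "sets \<mu> = sets borel" and space_haar [simp]: "space \<mu> = UNIV"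
  using finite_borel_haar sets_eq_imp_space_eq[of \<mu> borel] by (simp_all add: finite_borel_def)

lemma volume_pos: "measure \<mu> UNIV > 0"
  using haar emeasure_eq_measure[of UNIV]
  by (metis bi_invariant_haar_def ennreal_0 less_eq_real_def measure_nonneg)

lemma continuous_bounded:
  fixes f :: "'a \<Rightarrow> complex"
  assumes "continuous_on UNIV f"
  obtains B where "\<And>x. norm (f x) \<le> B"
  using compact_imp_bounded[OF compact_continuous_image[OF assms compact_UNIV]]
  by (auto simp: bounded_iff)

lemma continuous_bounded2:
  fixes H :: "'a \<Rightarrow> 'a \<Rightarrow> complex"
  assumes "continuous_on UNIV (\<lambda>p. H (fst p) (snd p))"
  obtains B where "\<And>x y. norm (H x y) \<le> B"
proof -
  have "compact (UNIV :: ('a \<times> 'a) set)"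
    using compact_Times[OF compact_UNIV compact_UNIV] by simp
  from compact_imp_bounded[OF compact_continuous_image[OF assms this]]
  show thesis using that by (auto simp: bounded_iff)
qed

lemma measurable_continuous:
  fixes f :: "'a \<Rightarrow> 'b::topological_space"
  shows "finite_borel \<nu> \<Longrightarrow> continuous_on UNIV f \<Longrightarrow> f \<in> borel_measurable \<nu>"
  using borel_measurable_continuous_onI measurable_cong_sets unfolding finite_borel_def by blast

lemma integrable_continuous:
  fixes f :: "'a \<Rightarrow> complex"
  assumes "finite_borel \<nu>" "continuous_on UNIV f"
  shows "integrable \<nu> f"
proof -
  obtain B where "\<And>x. norm (f x) \<le> B" using continuous_bounded[OF assms(2)] by blast
  then show ?thesis
    using assms measurable_continuous[OF assms]
    by (intro finite_measure.integrable_const_bound[where B = B]) (auto simp: finite_borel_def)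
qed

text \<open>Sequences suffice to test continuity by second countability, and the bound of H on the
  compact product dominates the integrands.\<close>

lemma continuous_integral:
  fixes H :: "'a \<Rightarrow> 'a \<Rightarrow> complex"
  assumes \<nu>: "finite_borel \<nu>" and H: "continuous_on UNIV (\<lambda>p. H (fst p) (snd p))"
  shows "continuous_on UNIV (\<lambda>x. LINT y|\<nu>. H x y)"
proof (rule continuous_on_sequentiallyI)
  fix u :: "nat \<Rightarrow> 'a" and a assume u: "u \<longlonglongrightarrow> a"
  obtain B where B: "\<And>x y. norm (H x y) \<le> B" using continuous_bounded2[OF H] by blast
  interpret \<nu>: finite_measure \<nu> using \<nu> by (simp add: finite_borel_def)
  have c: "continuous_on UNIV (H x)" for x
    using continuous_comp_UNIV[OF H, of UNIV "\<lambda>y. (x, y)"] by (simp add: continuous_intros)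
  have d: "continuous_on UNIV (\<lambda>x. H x y)" for y
    using continuous_comp_UNIV[OF H, of UNIV "\<lambda>x. (x, y)"] by (simp add: continuous_intros)
  show "(\<lambda>n. LINT y|\<nu>. H (u n) y) \<longlonglongrightarrow> (LINT y|\<nu>. H a y)"
  proof (rule integral_dominated_convergence[where w = "\<lambda>_. B"])
    show "AE y in \<nu>. (\<lambda>n. H (u n) y) \<longlonglongrightarrow> H a y"
      using d u by (auto intro!: continuous_on_tendsto_compose[of UNIV "\<lambda>x. H x _"])
  qed (use B measurable_continuous[OF \<nu>] c in auto)
qed

text \<open>By second countability the Borel sets of the product are generated by rectangles, so a
  jointly continuous function is measurable for the product measure; compactness bounds it and
  finiteness of the measures makes it integrable.\<close>

lemma Fubini_continuous:
  fixes H :: "'a \<Rightarrow> 'a \<Rightarrow> complex"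
  assumes M: "finite_borel M" and N: "finite_borel N"
    and H: "continuous_on UNIV (\<lambda>p. H (fst p) (snd p))"
  shows "(LINT x|M. LINT y|N. H x y) = (LINT y|N. LINT x|M. H x y)"
proof -
  interpret M: finite_measure M using M by (simp add: finite_borel_def)
  interpret N: finite_measure N using N by (simp add: finite_borel_def)
  interpret pair_sigma_finite M N ..
  obtain B where B: "\<And>x y. norm (H x y) \<le> B" using continuous_bounded2[OF H] by blast
  have "sets (M \<Otimes>\<^sub>M N) = sets (borel :: ('a \<times> 'a) measure)"
    using M N by (simp add: finite_borel_def borel_prod[symmetric] cong: sets_pair_measure_cong)
  then have "(\<lambda>(x, y). H x y) \<in> borel_measurable (M \<Otimes>\<^sub>M N)"
    using borel_measurable_continuous_onI[OF H] by (simp add: case_prod_beta' cong: measurable_cong_sets)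
  moreover have "finite_measure (M \<Otimes>\<^sub>M N)"
    using finite_measure_pair_measure[OF N.finite_measure_axioms M.finite_measure_axioms] by simp
  ultimately have "integrable (M \<Otimes>\<^sub>M N) (\<lambda>(x, y). H x y)"
    using B by (intro finite_measure.integrable_const_bound[where B = B]) auto
  from Fubini_integral[OF this] show ?thesis by simp
qed

lemma
  fixes f :: "'a \<Rightarrow> complex"
  assumes "continuous_on UNIV f"
  shows integral_left_translate: "(LINT x|\<mu>. f (a * x)) = (LINT x|\<mu>. f x)"
    and integral_right_translate: "(LINT x|\<mu>. f (x * a)) = (LINT x|\<mu>. f x)"
proof -
  have f: "f \<in> borel_measurable borel" using assms by (rule borel_measurable_continuous_onI)
  have "(\<lambda>x. a * x) \<in> measurable \<mu> borel" "(\<lambda>x. x * a) \<in> measurable \<mu> borel"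
    by (intro measurable_continuous[OF finite_borel_haar] continuous_intros)+
  from this[THEN integral_distr, OF f] show "(LINT x|\<mu>. f (a * x)) = (LINT x|\<mu>. f x)"
    "(LINT x|\<mu>. f (x * a)) = (LINT x|\<mu>. f x)"
    using haar by (simp_all add: bi_invariant_haar_def)
qed

text \<open>The double integral of f (inverse x * y) is computed in both orders: left invariance in
  y gives the integral of f, left invariance in x that of f (inverse x), each times the volume,
  which is finite and positive.\<close>

lemma integral_inverse:
  fixes f :: "'a \<Rightarrow> complex"
  assumes f: "continuous_on UNIV f"
  shows "(LINT x|\<mu>. f (inverse x)) = (LINT x|\<mu>. f x)"
proof -
  let ?V = "complex_of_real (measure \<mu> UNIV)"
  have "?V * (LINT x|\<mu>. f x) = (LINT x|\<mu>. LINT y|\<mu>. f (inverse x * y))"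
    by (simp add: integral_left_translate[OF f] scaleR_conv_of_real)
  also have "\<dots> = (LINT y|\<mu>. LINT x|\<mu>. f (inverse x * y))"
    by (intro Fubini_continuous finite_borel_haar continuous_comp_UNIV[OF f] continuous_intros)
  also have "\<dots> = (LINT y|\<mu>. LINT x|\<mu>. f (inverse x))"
  proof -
    have "(LINT x|\<mu>. f (inverse x * y)) = (LINT x|\<mu>. f (inverse x))" for y
      using integral_left_translate[of "\<lambda>x. f (inverse x * y)" y]
      by (simp add: group_simps continuous_comp_UNIV[OF f] continuous_intros)
    then show ?thesis by simp
  qed
  finally show ?thesis using volume_pos by (simp add: scaleR_conv_of_real)
qed

text \<open>Translates of U cover the group, finitely many of them suffice by compactness, and all
  have the measure of U; a null set U would make the whole group null.\<close>

lemma open_measure_pos: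
  assumes "open U" "U \<noteq> {}"
  shows "measure \<mu> U > 0"
proof (rule ccontr)
  assume "\<not> measure \<mu> U > 0"
  then have "measure \<mu> U = 0" using measure_nonneg[of \<mu> U] by linarith
  then have U0: "emeasure \<mu> U = 0" by (simp add: emeasure_eq_measure)
  obtain p where p: "p \<in> U" using assms by auto
  define T where "T a = (\<lambda>x. a * x) -` U" for a
  have mult_meas: "(\<lambda>x. a * x) \<in> measurable \<mu> borel" for a
    by (intro measurable_continuous[OF finite_borel_haar] continuous_intros)
  have op: "open (T a)" for a
    unfolding T_def by (rule open_vimage[OF assms(1)]) (intro continuous_intros)
  have T0: "emeasure \<mu> (T a) = 0" for a
  proof -
    have "emeasure (distr \<mu> borel (\<lambda>x. a * x)) U = emeasure \<mu> (T a)"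
      using emeasure_distr[OF mult_meas, of U a] assms(1) by (simp add: T_def)
    then show ?thesis using U0 haar by (simp add: bi_invariant_haar_def)
  qed
  have "x \<in> T (p * inverse x)" for x by (simp add: T_def p group_simps)
  then have "UNIV \<subseteq> (\<Union>a\<in>UNIV. T a)" by blast
  from compactE_image[OF compact_UNIV _ this] op
  obtain C where C: "finite C" "UNIV \<subseteq> (\<Union>a\<in>C. T a)" by metis
  have "emeasure \<mu> (\<Union>a\<in>C. T a) \<le> (\<Sum>a\<in>C. emeasure \<mu> (T a))"
    using C(1) op sets_haar by (intro emeasure_subadditive_finite) auto
  then have "emeasure \<mu> UNIV = 0" using C(2) T0 by (simp add: top.extremum_unique)
  then show False using haar by (simp add: bi_invariant_haar_def)
qed

section \<open>The inner product of continuous functions\<close>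

definition ip :: "('a \<Rightarrow> complex) \<Rightarrow> ('a \<Rightarrow> complex) \<Rightarrow> complex" where
  "ip f g = (LINT x|\<mu>. f x * cnj (g x))"

definition sqnorm :: "('a \<Rightarrow> complex) \<Rightarrow> real" where
  "sqnorm f = Re (ip f f)"

lemma ip_integrable:
  "continuous_on UNIV f \<Longrightarrow> continuous_on UNIV g \<Longrightarrow> integrable \<mu> (\<lambda>x. f x * cnj (g x))"
  by (intro integrable_continuous[OF finite_borel_haar] continuous_intros)

lemma ip_diff_left: "continuous_on UNIV f \<Longrightarrow> continuous_on UNIV g \<Longrightarrow> continuous_on UNIV h \<Longrightarrow>
    ip (\<lambda>x. f x - g x) h = ip f h - ip g h"
  by (simp add: ip_def left_diff_distrib ip_integrable)

lemma ip_scale_left: "ip (\<lambda>x. c * f x) h = c * ip f h"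
  by (simp add: ip_def mult.assoc)

lemma ip_cnj: "cnj (ip f g) = ip g f"
proof -
  have "cnj (ip f g) = (LINT x|\<mu>. cnj (f x * cnj (g x)))" by (simp only: ip_def Bochner_Integration.integral_cnj)
  then show ?thesis by (simp add: ip_def mult.commute)
qed

lemma ip_diff_right: "continuous_on UNIV f \<Longrightarrow> continuous_on UNIV g \<Longrightarrow> continuous_on UNIV h \<Longrightarrow>
    ip h (\<lambda>x. f x - g x) = ip h f - ip h g"
  using arg_cong[OF ip_diff_left[of f g h], of cnj] by (simp only: ip_cnj complex_cnj_diff)

lemma ip_scale_right: "ip h (\<lambda>x. c * f x) = cnj c * ip h f"
  using arg_cong[OF ip_scale_left[of c f h], of cnj] by (simp only: ip_cnj complex_cnj_mult)

lemma ip_sum_left: "(\<And>i. i \<in> I \<Longrightarrow> continuous_on UNIV (f i)) \<Longrightarrow> continuous_on UNIV h \<Longrightarrow>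
    ip (\<lambda>x. \<Sum>i\<in>I. f i x) h = (\<Sum>i\<in>I. ip (f i) h)"
  unfolding ip_def sum_distrib_right by (rule Bochner_Integration.integral_sum) (rule ip_integrable)

lemma ip_self: "ip f f = complex_of_real (sqnorm f)"
  using ip_cnj[of f f] by (simp add: sqnorm_def complex_eq_iff)

lemma sqnorm_altdef: "sqnorm f = (LINT x|\<mu>. (cmod (f x))\<^sup>2)"
  unfolding sqnorm_def ip_def complex_norm_square[symmetric]
  by (simp del: of_real_power)

lemma sqnorm_nonneg: "sqnorm f \<ge> 0"
  by (simp add: sqnorm_altdef)

lemma integrable_square:
  assumes "continuous_on UNIV f"
  shows "integrable \<mu> (\<lambda>x. (cmod (f x))\<^sup>2)"
proof -
  have "integrable \<mu> (\<lambda>x. f x * cnj (f x))" by (intro ip_integrable assms)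
  then have "integrable \<mu> (\<lambda>x. complex_of_real ((cmod (f x))\<^sup>2))"
    by (simp only: complex_norm_square)
  then show ?thesis by (simp only: complex_of_real_integrable_eq)
qed

text \<open>The set where f does not vanish is open and null, hence empty. Continuity thus turns
  almost everywhere into everywhere, and no quotient space is formed.\<close>

lemma sqnorm_eq_0:
  assumes "continuous_on UNIV f" "sqnorm f = 0"
  shows "f x = 0"
proof -
  let ?U = "{x. f x \<noteq> 0}"
  have "AE x in \<mu>. (cmod (f x))\<^sup>2 = 0"
    using assms(2) integral_nonneg_eq_0_iff_AE[OF integrable_square[OF assms(1)]] by (simp add: sqnorm_altdef)
  then have "AE x in \<mu>. x \<notin> ?U" by auto
  moreover have op: "open ?U"
    by (intro open_Collect_neq assms continuous_intros)
  ultimately have "emeasure \<mu> ?U = 0"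
    using sets_haar by (subst AE_iff_measurable[symmetric]) auto
  then have "?U = {}" using open_measure_pos[OF op] by (auto simp: measure_def)
  then show ?thesis by auto
qed

lemma Cauchy_Schwarz:
  assumes f: "continuous_on UNIV f" and g: "continuous_on UNIV g"
  shows "(cmod (ip f g))\<^sup>2 \<le> sqnorm f * sqnorm g"
proof -
  have *: "0 \<le> sqnorm f - 2 * t * (cmod (ip f g))\<^sup>2 + t\<^sup>2 * (cmod (ip f g))\<^sup>2 * sqnorm g" for t :: real
  proof -
    have "ip (\<lambda>x. f x - c * g x) (\<lambda>x. f x - c * g x) =
      ip f f - cnj c * ip f g - c * ip g f + c * cnj c * ip g g" for c
    proof -
      have cg: "continuous_on UNIV (\<lambda>x. c * g x)" by (intro continuous_intros g)
      have "continuous_on UNIV (\<lambda>x. f x - c * g x)" by (intro continuous_intros f g)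
      then show ?thesis
        by (simp only: ip_diff_left[OF f cg] ip_diff_right[OF f cg f] ip_diff_right[OF f cg cg]
            ip_scale_left ip_scale_right) (simp add: algebra_simps)
    qed
    \<comment> \<open>The factor \<open>ip f g\<close> absorbs the phase, so that a quadratic
      polynomial in the real variable t remains.\<close>
    note this[of "of_real t * ip f g"]
    then have "complex_of_real (sqnorm (\<lambda>x. f x - of_real t * ip f g * g x)) = complex_of_real (sqnorm f) -
      2 * of_real t * (ip f g * cnj (ip f g)) +
      (of_real t)\<^sup>2 * (ip f g * cnj (ip f g)) * complex_of_real (sqnorm g)"
      unfolding ip_self ip_cnj by (simp add: ip_cnj power2_eq_square algebra_simps)
    also have "\<dots> = complex_of_real (sqnorm f - 2 * t * (cmod (ip f g))\<^sup>2 + t\<^sup>2 * (cmod (ip f g))\<^sup>2 * sqnorm g)"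
      unfolding complex_norm_square[symmetric] by simp
    finally have "sqnorm (\<lambda>x. f x - of_real t * ip f g * g x) =
      sqnorm f - 2 * t * (cmod (ip f g))\<^sup>2 + t\<^sup>2 * (cmod (ip f g))\<^sup>2 * sqnorm g"
      by (simp only: of_real_eq_iff)
    then show ?thesis using sqnorm_nonneg by metis
  qed
  show ?thesis
  proof (cases "sqnorm g = 0")
    case True
    have "(cmod (ip f g))\<^sup>2 = 0"
    proof (rule ccontr)
      assume "(cmod (ip f g))\<^sup>2 \<noteq> 0"
      \<comment> \<open>With \<open>sqnorm g = 0\<close> the expression is affine in t, and at this
        t it equals -1.\<close>
      then show False
        using *[of "(sqnorm f + 1) / (2 * (cmod (ip f g))\<^sup>2)"] True by simp
    qed
    then show ?thesis using True by simp
  next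
    case False
    then have "sqnorm g > 0" using sqnorm_nonneg[of g] by simp
    then show ?thesis using *[of "1 / sqnorm g"] by (simp add: field_simps power2_eq_square)
  qed
qed

section \<open>Convolution\<close>

definition conv :: "('a \<Rightarrow> complex) \<Rightarrow> ('a \<Rightarrow> complex) \<Rightarrow> 'a \<Rightarrow> complex" where
  "conv f g x = (LINT y|\<mu>. f (x * inverse y) * g y)"

lemma continuous_conv:
  assumes "continuous_on UNIV f" "continuous_on UNIV g"
  shows "continuous_on UNIV (conv f g)"
  unfolding conv_def
  by (intro continuous_integral finite_borel_haar continuous_intros assms[THEN continuous_comp_UNIV])

lemma conv_altdef:
  assumes f: "continuous_on UNIV f" and g: "continuous_on UNIV g"
  shows "conv f g x = (LINT y|\<mu>. f y * g (inverse y * x))"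
proof -
  have "conv f g x = (LINT y|\<mu>. f (x * y) * g (inverse y))"
    using integral_inverse[of "\<lambda>y. f (x * inverse y) * g y"]
    by (simp add: conv_def group_simps f g continuous_intros continuous_comp_UNIV[OF f])
  also have "\<dots> = (LINT y|\<mu>. f y * g (inverse y * x))"
    using integral_left_translate[of "\<lambda>y. f y * g (inverse y * x)" x]
    by (simp add: group_simps f g continuous_intros continuous_comp_UNIV[OF f] continuous_comp_UNIV[OF g])
  finally show ?thesis .
qed

lemma conv_assoc:
  assumes f: "continuous_on UNIV f" and g: "continuous_on UNIV g" and h: "continuous_on UNIV h"
  shows "conv (conv f g) h = conv f (conv g h)"
proof
  fix x
  have "conv (conv f g) h x = (LINT y|\<mu>. LINT z|\<mu>. f (x * inverse z) * g (z * inverse y) * h y)"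
  proof -
    have "conv f g (x * inverse y) * h y = (LINT z|\<mu>. f (x * inverse z) * g (z * inverse y) * h y)" for y
    proof -
      have "conv f g (x * inverse y) = (LINT z|\<mu>. f (x * inverse z) * g (z * inverse y))"
        unfolding conv_def
        using integral_right_translate[of "\<lambda>z. f (x * (inverse y * inverse z)) * g z" "inverse y"]
        by (simp add: group_simps continuous_intros continuous_comp_UNIV[OF f] continuous_comp_UNIV[OF g])
      then show ?thesis by simp
    qed
    then show ?thesis by (simp only: conv_def[of "conv f g"])
  qed
  also have "\<dots> = (LINT z|\<mu>. LINT y|\<mu>. f (x * inverse z) * g (z * inverse y) * h y)"
    by (intro Fubini_continuous finite_borel_haar continuous_intros
        f[THEN continuous_comp_UNIV] g[THEN continuous_comp_UNIV] h[THEN continuous_comp_UNIV])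
  also have "\<dots> = conv f (conv g h) x"
    by (simp add: conv_def mult.assoc)
  finally show "conv (conv f g) h x = conv f (conv g h) x" .
qed

text \<open>The involution that sends f to \<open>\<lambda>x. cnj (f (inverse x))\<close> reverses
  convolution. Hence a function convolved with its own image under the involution is hermitian, and
  so are the powers of a hermitian function.\<close>

lemma conv_adjoint:
  assumes f: "continuous_on UNIV f" and g: "continuous_on UNIV g"
  shows "cnj (conv f g (inverse x)) = conv (\<lambda>y. cnj (g (inverse y))) (\<lambda>y. cnj (f (inverse y))) x"
proof -
  have "cnj (conv f g (inverse x)) = (LINT y|\<mu>. cnj (f (inverse x * inverse y) * g y))"
    by (simp only: conv_def Bochner_Integration.integral_cnj)
  also have "\<dots> = (LINT y|\<mu>. cnj (f (inverse x * y) * g (inverse y)))"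
    using integral_inverse[of "\<lambda>y. cnj (f (inverse x * inverse y) * g y)"]
    by (simp add: group_simps continuous_intros continuous_comp_UNIV[OF f] g)
  also have "\<dots> = conv (\<lambda>y. cnj (g (inverse y))) (\<lambda>y. cnj (f (inverse y))) x"
    by (subst conv_altdef)
      (auto simp: group_simps mult.commute intro!: continuous_intros f[THEN continuous_comp_UNIV] g[THEN continuous_comp_UNIV])
  finally show ?thesis .
qed

lemma sqnorm_reflect:
  assumes f: "continuous_on UNIV f"
  shows "sqnorm (\<lambda>y. f (x * inverse y)) = sqnorm f" "sqnorm (\<lambda>y. cnj (f (inverse y * x))) = sqnorm f"
proof -
  have *: "continuous_on UNIV (\<lambda>y. f y * cnj (f y))" by (intro continuous_intros f)
  show "sqnorm (\<lambda>y. f (x * inverse y)) = sqnorm f"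
    using integral_inverse[of "\<lambda>y. f (x * y) * cnj (f (x * y))"] integral_left_translate[OF *, of x]
    by (simp add: sqnorm_def ip_def continuous_intros continuous_comp_UNIV[OF f])
  show "sqnorm (\<lambda>y. cnj (f (inverse y * x))) = sqnorm f"
    using integral_inverse[of "\<lambda>y. f (y * x) * cnj (f (y * x))"] integral_right_translate[OF *, of x]
    by (simp add: sqnorm_def ip_def continuous_intros continuous_comp_UNIV[OF f] mult.commute)
qed

text \<open>A value of the convolution is an inner product with a reflected translate of f, which
  has the norm of f. The point is that quadratic norms control values at every single x; this later
  turns mean-square convergence into uniform convergence.\<close>

lemma conv_bound:
  assumes f: "continuous_on UNIV f" and g: "continuous_on UNIV g"
  shows "(cmod (conv f g x))\<^sup>2 \<le> sqnorm f * sqnorm g"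
proof -
  have "conv f g x = ip (\<lambda>y. f (x * inverse y)) (\<lambda>y. cnj (g y))"
    by (simp add: conv_def ip_def)
  moreover have "sqnorm (\<lambda>y. cnj (g y)) = sqnorm g" by (simp add: sqnorm_altdef)
  ultimately show ?thesis
    using Cauchy_Schwarz[of "\<lambda>y. f (x * inverse y)" "\<lambda>y. cnj (g y)"] sqnorm_reflect(1)[OF f]
    by (simp add: continuous_intros continuous_comp_UNIV[OF f] g)
qed

lemma sqnorm_le:
  assumes f: "continuous_on UNIV f" and "\<And>x. (cmod (f x))\<^sup>2 \<le> B"
  shows "sqnorm f \<le> measure \<mu> UNIV * B"
proof -
  have "sqnorm f \<le> (LINT x|\<mu>. B)"
    unfolding sqnorm_altdef using assms(2) by (intro integral_mono integrable_square f) auto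
  then show ?thesis by simp
qed

end

section \<open>Uniqueness of Fourier coefficients\<close>

text \<open>By convexity the ratios b (n+1) / b n increase, and they are bounded by V * b 0; let M
  be their limit. Then b n / M^n decreases. Submultiplicativity keeps it away from 0: as in Fekete's
  lemma, the growth rate M satisfies M^N \<le> V * b (N - 1), so b n / M^n is at least M /
  V.\<close>

lemma log_convex_submultiplicative_limit:
  fixes b :: "nat \<Rightarrow> real"
  assumes pos: "\<And>n. b n > 0" and V: "V > 0"
    and convex: "\<And>n. (b (Suc n))\<^sup>2 \<le> b n * b (Suc (Suc n))"
    and submult: "\<And>n m. b (Suc (n + m)) \<le> V * b n * b m"
  obtains M c where "M > 0" "c > 0" "(\<lambda>n. b n / M ^ n) \<longlonglongrightarrow> c"
proof -
  define r where "r n = b (Suc n) / b n" for n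
  have r_pos: "r n > 0" for n by (simp add: r_def pos)
  have r_le: "r n \<le> r (Suc n)" for n
    using convex[of n] pos[of n] pos[of "Suc n"] by (simp add: r_def field_simps power2_eq_square)
  then have "incseq r" by (simp add: incseq_SucI)
  moreover have "r n \<le> V * b 0" for n
    using submult[of n 0] pos[of n] by (simp add: r_def field_simps)
  ultimately obtain M where M: "r \<longlonglongrightarrow> M" "\<And>n. r n \<le> M"
    using incseq_convergent[of r "V * b 0"] by blast
  have M_pos: "M > 0" using M(2)[of 0] r_pos[of 0] by linarith
  have b_Suc: "b (Suc n) = r n * b n" for n using pos[of n] by (simp add: r_def)
  define c where "c n = b n / M ^ n" for n
  have "c (Suc n) \<le> c n" for n
    using M(2)[of n] pos[of n] M_pos by (simp add: c_def b_Suc field_simps)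
  then have dec: "decseq c" by (simp add: decseq_SucI)
  \<comment> \<open>The shift absorbs the successor in \<open>submult\<close>: for positive n and m
    it reads B (n + m) \<le> B n * B m.\<close>
  define B where "B n = V * b (n - 1)" for n
  have B_mult: "B (j * N) \<le> B N ^ j" if "j \<ge> 1" "N \<ge> 1" for j N
    using that(1)
  proof (induction j rule: dec_induct)
    case (step j)
    have "Suc ((j * N - 1) + (N - 1)) = Suc j * N - 1"
      using step(1) that(2) by (cases N; cases j) auto
    then have "B (Suc j * N) \<le> B (j * N) * B N"
      using submult[of "j * N - 1" "N - 1"] V mult_left_mono[of "b (Suc j * N - 1)" _ V]
      by (simp only: B_def) (simp add: mult_ac)
    also have "\<dots> \<le> B N ^ j * B N"
      using step(3) pos V by (intro mult_right_mono) (simp_all add: B_def less_imp_le)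
    finally show ?case by (simp add: mult.commute)
  qed simp
  have B_pos: "B n > 0" for n by (simp add: B_def V pos)
  have lower: "M ^ N \<le> B N" if N: "N \<ge> 1" for N
  proof (rule ccontr)
    assume "\<not> M ^ N \<le> B N"
    \<comment> \<open>Some ratio s = r k satisfies s^N > B N. From k on, b grows at least
      geometrically with ratio s, while B (j * N) is at most (B N)^j; letting j grow gives the
      contradiction.\<close>
    moreover have "(\<lambda>k. r k ^ N) \<longlonglongrightarrow> M ^ N" by (intro tendsto_intros M)
    ultimately have "eventually (\<lambda>k. r k ^ N > B N) sequentially"
      by (intro order_tendstoD(1)) auto
    then obtain k where k: "r k ^ N > B N" by (auto simp: eventually_sequentially)
    define s where "s = r k"
    have s: "s > 0" by (simp add: s_def r_pos)
    have ge: "b k * s ^ l \<le> b (k + l)" for l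
    proof (induction l)
      case (Suc l)
      have "s \<le> r (k + l)" using \<open>incseq r\<close> by (simp add: s_def incseqD)
      then have "s * (b k * s ^ l) \<le> r (k + l) * b (k + l)"
        using Suc s pos[of k] by (intro mult_mono) (simp_all add: less_imp_le)
      then show ?case by (simp add: b_Suc mult_ac)
    qed simp
    let ?q = "B N / s ^ N"
    have q: "0 < ?q" "?q < 1" using k s B_pos by (simp_all add: s_def)
    have "V * b k / s ^ (Suc k) \<le> ?q ^ j" if j: "j \<ge> Suc k" for j
    proof -
      have jN: "j * N = Suc (k + (j * N - Suc k))" using j N by (metis add_Suc le_add_diff_inverse le_trans mult_le_mono2 mult.right_neutral)
      have "V * b k * s ^ (j * N) / s ^ Suc k = V * (b k * s ^ (j * N - Suc k))"
        using s by (subst (1) jN) (simp add: power_add)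
      also have "\<dots> \<le> V * b (k + (j * N - Suc k))" using ge V by (intro mult_left_mono) auto
      also have "\<dots> = B (j * N)" using jN by (metis B_def diff_Suc_1)
      also have "\<dots> \<le> B N ^ j" using B_mult j N by simp
      finally have "V * b k * s ^ (j * N) / s ^ Suc k / s ^ (j * N) \<le> B N ^ j / s ^ (j * N)"
        using s by (intro divide_right_mono) auto
      then show ?thesis using s by (simp add: power_divide power_mult mult.commute[of j N])
    qed
    then have "eventually (\<lambda>j. V * b k / s ^ (Suc k) \<le> ?q ^ j) sequentially"
      by (auto simp: eventually_sequentially)
    moreover have "(\<lambda>j. ?q ^ j) \<longlonglongrightarrow> 0" using q by (intro LIMSEQ_realpow_zero) auto
    ultimately have "V * b k / s ^ (Suc k) \<le> 0"
      by (intro tendsto_lowerbound[of "\<lambda>j. ?q ^ j"]) auto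
    moreover have "V * b k / s ^ (Suc k) > 0" using V pos[of k] s by (intro divide_pos_pos mult_pos_pos) auto
    ultimately show False by linarith
  qed
  have c_ge: "c n \<ge> M / V" for n
    using lower[of "Suc n"] V M_pos by (simp add: c_def B_def field_simps)
  obtain L where L: "c \<longlonglongrightarrow> L" using decseq_convergent[OF dec, of "M / V"] c_ge by blast
  have "L \<ge> M / V" using L c_ge by (intro tendsto_lowerbound[OF L]) auto
  moreover have "M / V > 0" using M_pos V by simp
  ultimately have "L > 0" by linarith
  then show thesis using that[of M L] M_pos L by (simp add: c_def[abs_def])
qed

context haar_group
begin

lemma norm_integral_le:
  fixes f :: "'a \<Rightarrow> complex"
  assumes \<nu>: "finite_borel \<nu>" and f: "continuous_on UNIV f" and K: "\<And>x. norm (f x) \<le> K"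
  shows "norm (LINT x|\<nu>. f x) \<le> K * measure \<nu> UNIV"
proof -
  interpret \<nu>: finite_measure \<nu> using \<nu> by (simp add: finite_borel_def)
  have sp: "space \<nu> = UNIV" using \<nu> sets_eq_imp_space_eq[of \<nu> borel] by (simp add: finite_borel_def)
  have "norm (LINT x|\<nu>. f x) \<le> (LINT x|\<nu>. norm (f x))" by (rule integral_norm_bound)
  also have "\<dots> \<le> (LINT x|\<nu>. K)"
    using integrable_continuous[OF \<nu> f] K by (intro integral_mono) auto
  finally show ?thesis by (simp add: sp mult.commute)
qed

text \<open>The filter and the reparametrisation \<tau> are arbitrary in order to cover two uses:
  sequences with \<tau> y = x * inverse y, which is convolution, and sums over finite sets of
  classes with \<tau> the identity.\<close>

lemma tendsto_integral_uniform:
  fixes F :: "'i \<Rightarrow> 'a \<Rightarrow> complex" and \<nu> :: "'a measure"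
  assumes \<nu>: "finite_borel \<nu>" and lim: "uniform_limit UNIV F G flt"
    and F: "\<And>n. continuous_on UNIV (F n)" and G: "continuous_on UNIV G"
    and g: "continuous_on UNIV g" and \<tau>: "continuous_on UNIV \<tau>"
  shows "((\<lambda>n. LINT y|\<nu>. F n (\<tau> y) * g y) \<longlongrightarrow> (LINT y|\<nu>. G (\<tau> y) * g y)) flt"
proof (rule tendstoI)
  fix \<epsilon> :: real assume \<epsilon>: "\<epsilon> > 0"
  obtain B where B: "\<And>x. norm (g x) \<le> B" using continuous_bounded[OF g] by blast
  have B0: "B \<ge> 0" using B norm_ge_zero order_trans by blast
  let ?V = "measure \<nu> UNIV"
  have V0: "?V \<ge> 0" by simp
  define \<delta> where "\<delta> = \<epsilon> / ((B + 1) * (?V + 1))"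
  have \<delta>: "\<delta> > 0" unfolding \<delta>_def using \<epsilon> B0 by (intro divide_pos_pos mult_pos_pos) (auto intro: add_nonneg_pos)
  have "eventually (\<lambda>n. \<forall>x\<in>UNIV. dist (F n x) (G x) < \<delta>) flt"
    using lim \<delta> by (auto simp: uniform_limit_iff)
  then show "eventually (\<lambda>n. dist (LINT y|\<nu>. F n (\<tau> y) * g y) (LINT y|\<nu>. G (\<tau> y) * g y) < \<epsilon>) flt"
  proof eventually_elim
    case (elim n)
    have c: "continuous_on UNIV (\<lambda>y. F n (\<tau> y) * g y)" "continuous_on UNIV (\<lambda>y. G (\<tau> y) * g y)"
      by (intro continuous_intros g continuous_comp_UNIV[OF F] continuous_comp_UNIV[OF G] \<tau>)+
    have "dist (LINT y|\<nu>. F n (\<tau> y) * g y) (LINT y|\<nu>. G (\<tau> y) * g y) =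
        norm (LINT y|\<nu>. F n (\<tau> y) * g y - G (\<tau> y) * g y)"
      by (simp add: dist_norm Bochner_Integration.integral_diff integrable_continuous[OF \<nu>] c)
    also have "\<dots> \<le> (\<delta> * B) * ?V"
    proof (rule norm_integral_le[OF \<nu>])
      fix y
      have "norm (F n (\<tau> y) - G (\<tau> y)) \<le> \<delta>" using elim by (simp add: dist_norm less_imp_le)
      then show "norm (F n (\<tau> y) * g y - G (\<tau> y) * g y) \<le> \<delta> * B"
        unfolding left_diff_distrib[symmetric] norm_mult using B \<delta> by (intro mult_mono) auto
    qed (intro continuous_intros c)
    also have "\<dots> < \<delta> * ((B + 1) * (?V + 1))"
    proof -
      have "B * ?V < (B + 1) * (?V + 1)" proof -
        have "(B + 1) * (?V + 1) = B * ?V + (B + ?V + 1)" by (simp add: algebra_simps)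
        then show ?thesis using B0 V0 by linarith
      qed
      then show ?thesis using \<delta> by (simp add: mult.assoc)
    qed
    also have "\<dots> = \<epsilon>"
      using B0 V0 by (simp add: \<delta>_def add_nonneg_eq_0_iff)
    finally show ?case .
  qed
qed

lemma
  assumes "continuous_on UNIV f" "continuous_on UNIV g" "continuous_on UNIV h"
  shows conv_diff_left: "conv (\<lambda>x. f x - g x) h x = conv f h x - conv g h x"
    and conv_add_left: "conv (\<lambda>x. f x + g x) h x = conv f h x + conv g h x"
proof -
  have "integrable \<mu> (\<lambda>y. f (x * inverse y) * h y)" "integrable \<mu> (\<lambda>y. g (x * inverse y) * h y)"
    by (intro integrable_continuous[OF finite_borel_haar] continuous_intros assms
        assms[THEN continuous_comp_UNIV])+
  then show "conv (\<lambda>x. f x - g x) h x = conv f h x - conv g h x"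
    "conv (\<lambda>x. f x + g x) h x = conv f h x + conv g h x"
    by (simp_all add: conv_def left_diff_distrib distrib_right)
qed

lemma conv_scale_left: "conv (\<lambda>x. c * f x) h x = c * conv f h x"
  by (simp add: conv_def mult.assoc)

text \<open>In general no continuous function is a unit for convolution, so the powers begin with f
  itself: index n stands for the (n+1)-fold convolution.\<close>

primrec conv_power :: "('a \<Rightarrow> complex) \<Rightarrow> nat \<Rightarrow> 'a \<Rightarrow> complex" where
  "conv_power f 0 = f"
| "conv_power f (Suc n) = conv (conv_power f n) f"

lemma continuous_conv_power: "continuous_on UNIV f \<Longrightarrow> continuous_on UNIV (conv_power f n)"
  by (induction n) (auto intro: continuous_conv)

lemma conv_power_add:
  assumes "continuous_on UNIV f"
  shows "conv (conv_power f n) (conv_power f m) = conv_power f (Suc (n + m))"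
proof (induction m)
  case (Suc m)
  have "conv (conv_power f n) (conv_power f (Suc m)) = conv (conv (conv_power f n) (conv_power f m)) f"
    by (simp add: conv_assoc continuous_conv_power assms)
  then show ?case using Suc by simp
qed simp

lemma conv_power_hermitian:
  assumes f: "continuous_on UNIV f" and h: "\<And>x. f (inverse x) = cnj (f x)"
  shows "conv_power f n (inverse x) = cnj (conv_power f n x)"
proof (induction n arbitrary: x)
  case (Suc n)
  have "cnj (conv_power f (Suc n) (inverse x)) =
    conv (\<lambda>y. cnj (f (inverse y))) (\<lambda>y. cnj (conv_power f n (inverse y))) x"
    using conv_adjoint[OF continuous_conv_power[OF f] f] by simp
  also have "\<dots> = conv f (conv_power f n) x" by (simp add: h Suc)
  also have "\<dots> = conv_power f (Suc n) x" using conv_power_add[OF f, of 0 n] by simp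
  finally show ?case by (metis complex_cnj_cnj)
qed (simp add: h)

text \<open>The powers \<open>\<phi>\<^sup>2\<^sup>n\<close>, suitably rescaled, converge to an eigenfunction of convolution with
  \<open>\<phi>\<^sup>2\<close>: the numbers \<open>\<parallel>\<phi>\<^sup>n\<parallel>\<^sup>2\<close> are log-convex by Cauchy-Schwarz, and the submultiplicativity of
  the Hilbert-Schmidt norm keeps the limit from vanishing. This replaces the spectral theorem for
  compact operators.\<close>

lemma conv_eigenfunction:
  assumes f: "continuous_on UNIV f" and h: "\<And>x. f (inverse x) = cnj (f x)" and nz: "f x0 \<noteq> 0"
  obtains e M where "continuous_on UNIV e" "e 1 \<noteq> 0" "M \<noteq> 0" "\<And>x. conv e (conv f f) x = M * e x"
proof -
  define p where "p n = conv_power f n" for n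
  have cp [simp]: "continuous_on UNIV (p n)" for n unfolding p_def by (rule continuous_conv_power[OF f])
  have p_conv: "conv (p n) (p m) = p (Suc (n + m))" for n m
    unfolding p_def by (rule conv_power_add[OF f])
  have p_inv: "p n (inverse x) = cnj (p n x)" for n x
    unfolding p_def by (rule conv_power_hermitian[OF f h])
  \<comment> \<open>For hermitian functions the inner product is the value at 1 of a convolution, so
    all inner products of powers are read off from one sequence of numbers.\<close>
  have ip_p: "ip (p n) (p m) = p (Suc (n + m)) 1" for n m
    by (simp add: p_conv[symmetric] add.commute[of n m] conv_def[of "p m" "p n"] ip_def p_inv mult.commute)
  define b where "b n = sqnorm (p n)" for n
  have b_eq: "p (Suc (2 * n)) 1 = of_real (b n)" for n
    using ip_self[of "p n"] by (simp add: ip_p b_def mult_2)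
  have convex: "(b (Suc n))\<^sup>2 \<le> b n * b (Suc (Suc n))" for n
  proof -
    have "ip (p n) (p (Suc (Suc n))) = of_real (b (Suc n))" using b_eq[of "Suc n"] by (simp add: ip_p mult_2)
    then show ?thesis using Cauchy_Schwarz[of "p n" "p (Suc (Suc n))"] by (simp add: b_def)
  qed
  have b_pos: "b n > 0" for n
  proof -
    have "b n \<noteq> 0 \<and> b (Suc n) \<noteq> 0"
    proof (induction n)
      case 0
      have "b 0 \<noteq> 0" using sqnorm_eq_0[OF f, of x0] nz by (auto simp: b_def p_def)
      moreover have "p (Suc 0) 1 = of_real (b 0)" using b_eq[of 0] by simp
      ultimately show ?case using sqnorm_eq_0[OF cp[of "Suc 0"], of 1] by (auto simp: b_def)
    next
      case (Suc n)
      then show ?case using convex[of n] by auto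
    qed
    then show ?thesis using sqnorm_nonneg[of "p n"] by (simp add: b_def less_le)
  qed
  have submult: "b (Suc (n + m)) \<le> measure \<mu> UNIV * b n * b m" for n m
    using sqnorm_le[OF cp[of "Suc (n + m)"], of "b n * b m"] conv_bound[OF cp[of n] cp[of m]]
    by (simp add: p_conv b_def mult.assoc)
  obtain M c where M: "M > 0" "c > 0" "(\<lambda>n. b n / M ^ n) \<longlonglongrightarrow> c"
    using log_convex_submultiplicative_limit[OF b_pos volume_pos convex submult] by blast
  let ?\<psi> = "conv f f"
  have \<psi>: "?\<psi> = p 1" by (simp add: p_def)
  \<comment> \<open>\<open>p (Suc (2 * n))\<close> is the (n+1)-fold convolution of
    \<open>?\<psi>\<close> with itself. The scaling makes \<open>e n 1\<close> equal to b n / M^n,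
    whose limit is positive.\<close>
  define e where "e n = (\<lambda>x. of_real (inverse (M ^ n)) * p (Suc (2 * n)) x)" for n
  have ce [simp]: "continuous_on UNIV (e n)" for n
    unfolding e_def by (intro continuous_intros cp)
  have e_Suc: "conv (e n) ?\<psi> x = of_real M * e (Suc n) x" for n x
    using M(1) p_conv[of "Suc (2 * n)" 1] by (simp add: e_def conv_scale_left \<psi>)
  define C where "C n = b n / M ^ n" for n
  have C: "C \<longlonglongrightarrow> c" using M(3) by (simp add: C_def[abs_def])
  have ip_e: "ip (e n) (e m) = of_real (M * C (Suc (n + m)))" for n m
  proof -
    have "ip (p (Suc (2 * n))) (p (Suc (2 * m))) = of_real (b (Suc (n + m)))"
      using b_eq[of "Suc (n + m)"] by (simp add: ip_p)
    then show ?thesis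
      using M(1) unfolding e_def ip_scale_left ip_scale_right
      by (simp add: C_def power_add field_simps)
  qed
  have dist_e: "sqnorm (\<lambda>x. e n x - e m x) = M * (C (Suc (n + n)) - 2 * C (Suc (n + m)) + C (Suc (m + m)))" for n m
  proof -
    have "continuous_on UNIV (\<lambda>x. e n x - e m x)" by (intro continuous_intros ce)
    then have "ip (\<lambda>x. e n x - e m x) (\<lambda>x. e n x - e m x) =
        ip (e n) (e n) - ip (e n) (e m) - (ip (e m) (e n) - ip (e m) (e m))"
      by (simp only: ip_diff_left[OF ce ce] ip_diff_right[OF ce ce ce])
    also have "\<dots> = of_real (M * (C (Suc (n + n)) - 2 * C (Suc (n + m)) + C (Suc (m + m))))"
      unfolding ip_e add.commute[of m n] by (simp add: right_diff_distrib distrib_left)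
    finally show ?thesis by (simp only: sqnorm_def Re_complex_of_real)
  qed
  define K where "K = sqnorm ?\<psi> + 1"
  have K: "K > 0" "sqnorm ?\<psi> \<le> K" using sqnorm_nonneg[of ?\<psi>] by (simp_all add: K_def)
  have c\<psi>: "continuous_on UNIV ?\<psi>" by (intro continuous_conv f)
  \<comment> \<open>One further convolution with \<open>?\<psi>\<close> bounds pointwise differences
    by mean-square ones. This costs one index, which is why the limit is taken along
    \<open>e (Suc n)\<close>.\<close>
  have close: "(cmod (e (Suc n) x - e (Suc m) x))\<^sup>2 \<le> sqnorm (\<lambda>x. e n x - e m x) * K / M\<^sup>2" for n m x
  proof -
    have "conv (\<lambda>x. e n x - e m x) ?\<psi> x = of_real M * (e (Suc n) x - e (Suc m) x)"
      by (simp add: conv_diff_left c\<psi> e_Suc right_diff_distrib)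
    then have "M\<^sup>2 * (cmod (e (Suc n) x - e (Suc m) x))\<^sup>2 = (cmod (conv (\<lambda>x. e n x - e m x) ?\<psi> x))\<^sup>2"
      using M(1) by (simp add: norm_mult power_mult_distrib)
    also have "\<dots> \<le> sqnorm (\<lambda>x. e n x - e m x) * sqnorm ?\<psi>"
      by (intro conv_bound c\<psi> continuous_intros ce)
    also have "\<dots> \<le> sqnorm (\<lambda>x. e n x - e m x) * K"
      by (intro mult_left_mono K sqnorm_nonneg)
    finally show ?thesis using M(1) by (simp add: field_simps)
  qed
  have "uniformly_Cauchy_on UNIV (\<lambda>n. e (Suc n))"
  proof (rule uniformly_Cauchy_onI)
    fix \<epsilon> :: real assume \<epsilon>: "\<epsilon> > 0"
    \<comment> \<open>Chosen such that M * (4 * \<delta>) * K / M^2 is half of \<epsilon>^2; the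
      factor 4 counts the weights 1, 2, 1 with which values of \<open>C\<close> enter
      \<open>dist_e\<close>.\<close>
    define \<delta> where "\<delta> = \<epsilon>\<^sup>2 * M / (8 * K)"
    have \<delta>: "\<delta> > 0" using \<epsilon> M K by (simp add: \<delta>_def)
    then obtain N where N: "\<And>n. n \<ge> N \<Longrightarrow> \<bar>C n - c\<bar> < \<delta>"
      using C unfolding lim_sequentially dist_real_def by blast
    have "dist (e (Suc m) x) (e (Suc n) x) < \<epsilon>" if "m \<ge> N" "n \<ge> N" for m n x
    proof -
      have "C (Suc (m + m)) - 2 * C (Suc (m + n)) + C (Suc (n + n)) \<le> 4 * \<delta>"
        using N[of "Suc (m + m)"] N[of "Suc (m + n)"] N[of "Suc (n + n)"] that by (simp add: abs_if split: if_splits)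
      then have "sqnorm (\<lambda>x. e m x - e n x) \<le> M * (4 * \<delta>)"
        unfolding dist_e using M(1) by (intro mult_left_mono) auto
      then have "(cmod (e (Suc m) x - e (Suc n) x))\<^sup>2 \<le> M * (4 * \<delta>) * K / M\<^sup>2"
        using close[of m x n] K M(1) by (meson divide_right_mono mult_right_mono less_imp_le order_trans zero_le_power2)
      also have "\<dots> = \<epsilon>\<^sup>2 / 2" using M(1) K by (simp add: \<delta>_def power2_eq_square)
      also have "\<dots> < \<epsilon>\<^sup>2" using \<epsilon> by simp
      finally show ?thesis using \<epsilon> by (simp add: dist_norm power2_less_imp_less)
    qed
    then show "\<exists>N. \<forall>x\<in>UNIV. \<forall>m\<ge>N. \<forall>n\<ge>N. dist (e (Suc m) x) (e (Suc n) x) < \<epsilon>" by blast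
  qed
  then obtain E where E: "uniform_limit UNIV (\<lambda>n. e (Suc n)) E sequentially"
    using Cauchy_uniformly_convergent uniformly_convergent_on_def by blast
  have cE: "continuous_on UNIV E"
    by (rule uniform_limit_theorem[OF _ E]) auto
  have E_lim: "(\<lambda>n. e (Suc n) x) \<longlonglongrightarrow> E x" for x
    using tendsto_uniform_limitI[OF E] by simp
  have "conv E ?\<psi> x = of_real M * E x" for x
  proof (rule LIMSEQ_unique)
    have "continuous_on UNIV (\<lambda>y. x * inverse y)" by (intro continuous_intros)
    from tendsto_integral_uniform[OF finite_borel_haar E ce cE c\<psi> this]
    show "(\<lambda>n. conv (e (Suc n)) ?\<psi> x) \<longlonglongrightarrow> conv E ?\<psi> x" by (simp only: conv_def)
    show "(\<lambda>n. conv (e (Suc n)) ?\<psi> x) \<longlonglongrightarrow> of_real M * E x"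
      unfolding e_Suc by (intro tendsto_intros LIMSEQ_Suc[OF E_lim])
  qed
  moreover have "E 1 = of_real c"
  proof (rule LIMSEQ_unique[OF E_lim])
    have "e (Suc n) 1 = of_real (C (Suc n))" for n
      using b_eq[of "Suc n"] by (simp add: e_def C_def field_simps)
    then show "(\<lambda>n. e (Suc n) 1) \<longlonglongrightarrow> of_real c"
      using LIMSEQ_Suc[OF C] by (simp add: tendsto_of_real_iff)
  qed
  ultimately show thesis using that[of E "of_real M"] cE M by auto
qed


section \<open>Finite orthonormal systems and Bessel's inequality\<close>

lemma ip_sum_right: "(\<And>i. i \<in> I \<Longrightarrow> continuous_on UNIV (f i)) \<Longrightarrow> continuous_on UNIV h \<Longrightarrow>
    ip h (\<lambda>x. \<Sum>i\<in>I. f i x) = (\<Sum>i\<in>I. ip h (f i))"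
  using arg_cong[OF ip_sum_left[of I f h], of cnj] by (simp only: ip_cnj cnj_sum)

definition orthonormal :: "nat \<Rightarrow> (nat \<Rightarrow> 'a \<Rightarrow> complex) \<Rightarrow> bool" where
  "orthonormal N u \<longleftrightarrow> (\<forall>i<N. continuous_on UNIV (u i)) \<and>
     (\<forall>i<N. \<forall>j<N. ip (u i) (u j) = (if i = j then 1 else 0))"

lemma continuous_combination:
  "orthonormal N u \<Longrightarrow> continuous_on UNIV (\<lambda>x. \<Sum>i<N. a i * u i x)"
  by (auto simp: orthonormal_def intro!: continuous_intros)

lemma ip_combination:
  assumes u: "orthonormal N u" and k: "k < N"
  shows "ip (\<lambda>x. \<Sum>i<N. a i * u i x) (u k) = a k"
proof -
  have "ip (\<lambda>x. \<Sum>i<N. a i * u i x) (u k) = (\<Sum>i<N. a i * ip (u i) (u k))"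
    using u k by (subst ip_sum_left) (auto simp: orthonormal_def ip_scale_left intro!: continuous_intros)
  also have "\<dots> = (\<Sum>i<N. if i = k then a i else 0)"
    using u k by (intro sum.cong) (auto simp: orthonormal_def)
  also have "\<dots> = a k" using k by simp
  finally show ?thesis .
qed

lemma
  assumes u: "orthonormal N u" and f: "continuous_on UNIV f"
  defines "r \<equiv> \<lambda>x. f x - (\<Sum>i<N. ip f (u i) * u i x)"
  shows continuous_residual: "continuous_on UNIV r"
    and ip_residual: "\<And>k. k < N \<Longrightarrow> ip r (u k) = 0"
    and sqnorm_residual: "sqnorm r = sqnorm f - (\<Sum>i<N. (cmod (ip f (u i)))\<^sup>2)"
proof -
  let ?g = "\<lambda>x. \<Sum>i<N. ip f (u i) * u i x"
  have g: "continuous_on UNIV ?g" by (rule continuous_combination[OF u])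
  show r: "continuous_on UNIV r" unfolding r_def by (intro continuous_intros f g)
  have cu: "continuous_on UNIV (u i)" if "i < N" for i using u that by (simp add: orthonormal_def)
  show 0: "ip r (u k) = 0" if "k < N" for k
    unfolding r_def using ip_combination[OF u that] by (simp add: ip_diff_left f g cu that)
  have "ip r ?g = (\<Sum>i<N. cnj (ip f (u i)) * ip r (u i))"
    using cu r by (subst ip_sum_right) (auto simp: ip_scale_right intro!: continuous_intros)
  then have rg: "ip r ?g = 0" using 0 by simp
  have gf: "ip ?g f = (\<Sum>i<N. of_real ((cmod (ip f (u i)))\<^sup>2))"
  proof -
    have "ip ?g f = (\<Sum>i<N. ip f (u i) * ip (u i) f)"
      using cu f by (subst ip_sum_left) (auto simp: ip_scale_left intro!: continuous_intros)
    then show ?thesis by (simp only: complex_norm_square ip_cnj)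
  qed
  have "ip r r = ip r f - ip r ?g" unfolding r_def[symmetric]
    by (subst (2) r_def) (rule ip_diff_right[OF f g r])
  also have "\<dots> = ip f f - ip ?g f" using rg by (simp add: r_def ip_diff_left f g)
  finally show "sqnorm r = sqnorm f - (\<Sum>i<N. (cmod (ip f (u i)))\<^sup>2)"
    unfolding gf by (simp add: sqnorm_def del: of_real_power)
qed

lemma Bessel:
  "orthonormal N u \<Longrightarrow> continuous_on UNIV f \<Longrightarrow> (\<Sum>i<N. (cmod (ip f (u i)))\<^sup>2) \<le> sqnorm f"
  using sqnorm_residual[of N u f] sqnorm_nonneg[of "\<lambda>x. f x - (\<Sum>i<N. ip f (u i) * u i x)"] by linarith

text \<open>For fixed x, the number c * u i x is the inner product of u i with the kernel y
  \<mapsto> cnj (\<psi> (inverse y * x)), whose norm is that of \<psi>. Bessel's inequality at each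
  x, integrated over x, bounds N: this is the Hilbert-Schmidt estimate for the multiplicity of an
  eigenvalue.\<close>

lemma orthonormal_eigenfunctions_bound:
  assumes u: "orthonormal N u" and \<psi>: "continuous_on UNIV \<psi>"
    and eigen: "\<And>i x. i < N \<Longrightarrow> conv (u i) \<psi> x = c * u i x"
  shows "(cmod c)\<^sup>2 * real N \<le> measure \<mu> UNIV * sqnorm \<psi>"
proof -
  have cu: "continuous_on UNIV (u i)" if "i < N" for i using u that by (simp add: orthonormal_def)
  have le: "(\<Sum>i<N. (cmod c)\<^sup>2 * (cmod (u i x))\<^sup>2) \<le> sqnorm \<psi>" for x
  proof -
    let ?k = "\<lambda>y. cnj (\<psi> (inverse y * x))"
    have k: "continuous_on UNIV ?k" by (intro continuous_intros continuous_comp_UNIV[OF \<psi>])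
    have "cmod (ip ?k (u i)) = cmod c * cmod (u i x)" if "i < N" for i
    proof -
      have "c * u i x = ip (u i) ?k"
        using conv_altdef[OF cu[OF that] \<psi>, of x] eigen[OF that, of x] by (simp add: ip_def)
      then have "ip ?k (u i) = cnj (c * u i x)" by (simp only: ip_cnj)
      then show ?thesis by (simp add: norm_mult)
    qed
    then have "(\<Sum>i<N. (cmod c)\<^sup>2 * (cmod (u i x))\<^sup>2) = (\<Sum>i<N. (cmod (ip ?k (u i)))\<^sup>2)"
      by (simp add: power_mult_distrib)
    also have "\<dots> \<le> sqnorm \<psi>" using Bessel[OF u k] sqnorm_reflect(2)[OF \<psi>] by simp
    finally show ?thesis .
  qed
  have "(cmod c)\<^sup>2 * real N = (\<Sum>i<N. (cmod c)\<^sup>2 * sqnorm (u i))"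
    using u by (simp add: sqnorm_def orthonormal_def)
  also have "\<dots> = (LINT x|\<mu>. (\<Sum>i<N. (cmod c)\<^sup>2 * (cmod (u i x))\<^sup>2))"
    using cu by (subst Bochner_Integration.integral_sum) (auto simp: sqnorm_altdef intro!: integrable_square)
  also have "\<dots> \<le> (LINT x|\<mu>. sqnorm \<psi>)"
    using cu le by (intro integral_mono Bochner_Integration.integrable_sum integrable_mult_right)
      (auto intro!: integrable_square)
  finally show ?thesis by simp
qed

definition fun_subspace :: "('a \<Rightarrow> complex) set \<Rightarrow> bool" where
  "fun_subspace S \<longleftrightarrow> (\<forall>f\<in>S. continuous_on UNIV f) \<and> (\<lambda>_. 0) \<in> S \<and>
     (\<forall>f\<in>S. \<forall>g\<in>S. (\<lambda>x. f x + g x) \<in> S) \<and> (\<forall>c. \<forall>f\<in>S. (\<lambda>x. c * f x) \<in> S)"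

lemma fun_subspace_add: "fun_subspace S \<Longrightarrow> f \<in> S \<Longrightarrow> g \<in> S \<Longrightarrow> (\<lambda>x. f x + g x) \<in> S"
  by (simp add: fun_subspace_def)

lemma fun_subspace_scale: "fun_subspace S \<Longrightarrow> f \<in> S \<Longrightarrow> (\<lambda>x. c * f x) \<in> S"
  by (simp add: fun_subspace_def)

lemma fun_subspace_combination:
  fixes N :: nat
  shows "fun_subspace S \<Longrightarrow> (\<And>i. i < N \<Longrightarrow> u i \<in> S) \<Longrightarrow> (\<lambda>x. \<Sum>i<N. a i * u i x) \<in> S"
  by (induction N) (auto simp: fun_subspace_def)

definition orthonormal_in :: "('a \<Rightarrow> complex) set \<Rightarrow> nat \<Rightarrow> (nat \<Rightarrow> 'a \<Rightarrow> complex) \<Rightarrow> bool" where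
  "orthonormal_in S N u \<longleftrightarrow> orthonormal N u \<and> (\<forall>i<N. u i \<in> S)"

text \<open>Dimension as the size of a largest orthonormal system. Excluding N + 1 excludes every
  larger size too, because initial segments of orthonormal systems are orthonormal.\<close>

definition has_dim :: "('a \<Rightarrow> complex) set \<Rightarrow> nat \<Rightarrow> bool" where
  "has_dim S N \<longleftrightarrow> (\<exists>u. orthonormal_in S N u) \<and> \<not> (\<exists>u. orthonormal_in S (Suc N) u)"

lemma orthonormal_in_mono: "orthonormal_in S N u \<Longrightarrow> n \<le> N \<Longrightarrow> S \<subseteq> T \<Longrightarrow> orthonormal_in T n u"
  by (auto simp: orthonormal_in_def orthonormal_def)

text \<open>A nonzero residual of f lies in S and is orthogonal to all u i; normalised, it would
  enlarge the system.\<close>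

lemma orthonormal_expansion:
  assumes S: "fun_subspace S" and u: "orthonormal_in S N u"
    and max: "\<not> (\<exists>u. orthonormal_in S (Suc N) u)" and f: "f \<in> S"
  shows "f = (\<lambda>x. \<Sum>i<N. ip f (u i) * u i x)"
proof -
  have on: "orthonormal N u" and uS: "\<And>i. i < N \<Longrightarrow> u i \<in> S" using u by (auto simp: orthonormal_in_def)
  have cf: "continuous_on UNIV f" using S f by (auto simp: fun_subspace_def)
  define r where "r = (\<lambda>x. f x - (\<Sum>i<N. ip f (u i) * u i x))"
  note res = continuous_residual[OF on cf, folded r_def] ip_residual[OF on cf, folded r_def]
  have "(\<lambda>x. - 1 * (\<Sum>i<N. ip f (u i) * u i x)) \<in> S"
    by (intro fun_subspace_scale fun_subspace_combination S uS)
  then have "(\<lambda>x. f x + - 1 * (\<Sum>i<N. ip f (u i) * u i x)) \<in> S"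
    by (rule fun_subspace_add[OF S f])
  then have rS: "r \<in> S" by (simp add: r_def)
  have "sqnorm r = 0"
  proof (rule ccontr)
    assume "sqnorm r \<noteq> 0"
    then have pos: "sqnorm r > 0" using sqnorm_nonneg[of r] by simp
    define v where "v = (\<lambda>x. of_real (inverse (sqrt (sqnorm r))) * r x)"
    have vS: "v \<in> S" using rS S by (auto simp: fun_subspace_def v_def)
    have vv: "ip v v = 1"
      using pos unfolding v_def ip_scale_left ip_scale_right ip_self
      by (simp add: field_simps flip: of_real_mult)
    have vu: "ip v (u k) = 0" if "k < N" for k using res(2)[OF that] by (simp add: v_def ip_scale_left)
    then have uv: "ip (u k) v = 0" if "k < N" for k using that ip_cnj[of v "u k"] by simp
    have "orthonormal_in S (Suc N) (u(N := v))"
      using on uS vS vv vu uv S by (auto simp: orthonormal_in_def orthonormal_def less_Suc_eq fun_subspace_def)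
    then show False using max by blast
  qed
  then have "r x = 0" for x using sqnorm_eq_0 res(1) by blast
  then show ?thesis by (auto simp: r_def fun_eq_iff)
qed

lemma has_dim_exists:
  assumes bound: "\<And>N u. orthonormal_in S N u \<Longrightarrow> N \<le> K"
  shows "\<exists>N. has_dim S N"
proof (rule ccontr)
  assume no: "\<nexists>N. has_dim S N"
  have "\<exists>u. orthonormal_in S N u" for N
  proof (induction N)
    case 0
    then show ?case by (simp add: orthonormal_in_def orthonormal_def)
  next
    case (Suc N)
    then show ?case using no by (auto simp: has_dim_def)
  qed
  from this[of "Suc K"] show False using bound by fastforce
qed

end

lemma index_mult_mat_sum:
  assumes "A \<in> carrier_mat n m" "B \<in> carrier_mat m p" "i < n" "j < p"
  shows "(A * B) $$ (i, j) = (\<Sum>k<m. A $$ (i, k) * B $$ (k, j))"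
  using assms by (simp add: scalar_prod_def atLeast0LessThan)

lemma index_mult_mat_vec_sum:
  assumes "A \<in> carrier_mat n m" "v \<in> carrier_vec m" "i < n"
  shows "(A *\<^sub>v v) $ i = (\<Sum>k<m. A $$ (i, k) * v $ k)"
  using assms by (simp add: scalar_prod_def atLeast0LessThan)

context haar_group
begin

definition ltrans :: "'a \<Rightarrow> ('a \<Rightarrow> complex) \<Rightarrow> 'a \<Rightarrow> complex" where
  "ltrans z f = (\<lambda>x. f (inverse z * x))"

lemma conv_ltrans: "conv (ltrans z f) g x = conv f g (inverse z * x)"
  by (simp add: conv_def ltrans_def mult.assoc)

text \<open>Convolution with \<psi> acts from the right, so its eigenspace is stable under left
  translation, and it is finite-dimensional by the bound on orthonormal eigenfunctions. A nonzero
  stable subspace of least dimension is irreducible; \<rho> is left translation on it, written in an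
  orthonormal basis.\<close>

lemma irreducible_constituent:
  assumes \<psi>: "continuous_on UNIV \<psi>" and c: "c \<noteq> 0"
    and e: "continuous_on UNIV e" "\<And>x. conv e \<psi> x = c * e x" "e x0 \<noteq> 0"
  obtains \<rho> N u where "irreducible_rep \<rho>" "rep_dim \<rho> = N" "N > 0" "orthonormal N u"
    "\<And>i x. i < N \<Longrightarrow> conv (u i) \<psi> x = c * u i x"
    "\<And>j z x. j < N \<Longrightarrow> u j (inverse z * x) = (\<Sum>i<N. \<rho> z $$ (i, j) * u i x)"
proof -
  define E where "E = {f. continuous_on UNIV f \<and> (\<forall>x. conv f \<psi> x = c * f x)}"
  define inv_sub where "inv_sub S \<longleftrightarrow> fun_subspace S \<and> S \<subseteq> E \<and> S \<noteq> {\<lambda>_. 0} \<and> (\<forall>f\<in>S. \<forall>z. ltrans z f \<in> S)" for S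
  have "fun_subspace E"
    using \<psi> by (auto simp: fun_subspace_def E_def conv_add_left conv_scale_left distrib_left conv_def[of "\<lambda>_. 0"]
        intro!: continuous_intros)
  moreover have "ltrans z f \<in> E" if "f \<in> E" for z f
    using that by (auto simp: E_def conv_ltrans) (auto simp: ltrans_def intro!: continuous_intros elim!: continuous_comp_UNIV)
  moreover have "e \<in> E" using e by (simp add: E_def)
  then have "E \<noteq> {\<lambda>_. 0}" using e(3) by auto
  ultimately have E: "inv_sub E" by (simp add: inv_sub_def)
  define K where "K = nat \<lceil>measure \<mu> UNIV * sqnorm \<psi> / (cmod c)\<^sup>2\<rceil>"
  have bound: "N \<le> K" if "orthonormal_in E N u" for N u
  proof -
    have "(cmod c)\<^sup>2 * real N \<le> measure \<mu> UNIV * sqnorm \<psi>"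
      using that by (intro orthonormal_eigenfunctions_bound[of N u]) (auto simp: orthonormal_in_def E_def \<psi>)
    then have "real N \<le> measure \<mu> UNIV * sqnorm \<psi> / (cmod c)\<^sup>2" using c by (simp add: field_simps)
    then show ?thesis unfolding K_def by linarith
  qed
  have dim: "\<exists>N. has_dim S N" if "inv_sub S" for S
    using that bound by (intro has_dim_exists[of S K]) (auto simp: inv_sub_def intro: orthonormal_in_mono)
  define N where "N = (LEAST N. \<exists>S. inv_sub S \<and> has_dim S N)"
  have "\<exists>S. inv_sub S \<and> has_dim S N"
    unfolding N_def by (rule LeastI_ex) (use dim E in blast)
  then obtain S where S: "inv_sub S" "has_dim S N" by blast
  have N_min: "N \<le> n" if "inv_sub T" "has_dim T n" for T n
    unfolding N_def by (rule Least_le) (use that in blast)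
  have subS: "fun_subspace S" and SE: "S \<subseteq> E" and transS: "\<And>f z. f \<in> S \<Longrightarrow> ltrans z f \<in> S"
    using S(1) by (auto simp: inv_sub_def)
  obtain u where u: "orthonormal_in S N u" and max: "\<not> (\<exists>u. orthonormal_in S (Suc N) u)"
    using S(2) by (auto simp: has_dim_def)
  have on: "orthonormal N u" and uS: "\<And>i. i < N \<Longrightarrow> u i \<in> S" using u by (auto simp: orthonormal_in_def)
  have cu: "continuous_on UNIV (u i)" if "i < N" for i using on that by (simp add: orthonormal_def)
  note expand = orthonormal_expansion[OF subS u max]
  \<comment> \<open>Column j holds the coordinates of the translate of \<open>u j\<close>. Since
    \<open>ltrans\<close> uses \<open>inverse z\<close>, translation by z * w is translation by w
    followed by translation by z, which makes \<rho> multiplicative.\<close>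
  define \<rho> where "\<rho> z = mat N N (\<lambda>(i, j). ip (ltrans z (u j)) (u i))" for z
  have \<rho>_carrier [simp]: "\<rho> z \<in> carrier_mat N N" for z by (simp add: \<rho>_def)
  have dim_\<rho>: "rep_dim \<rho> = N" by (simp add: rep_dim_def \<rho>_def)
  have act: "u j (inverse z * x) = (\<Sum>i<N. \<rho> z $$ (i, j) * u i x)" if "j < N" for j z x
    using fun_cong[OF expand[OF transS[OF uS[OF that], of z]], of x] that
    by (simp add: \<rho>_def ltrans_def)
  have coeffs: "a i = b i" if "\<And>x. (\<Sum>i<N. a i * u i x) = (\<Sum>i<N. b i * u i x)" "i < N" for a b i
    using ip_combination[OF on that(2), of a] ip_combination[OF on that(2), of b] that(1) by simp
  have N_pos: "N > 0"
  proof (rule ccontr)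
    assume "\<not> N > 0"
    then have "f = (\<lambda>_. 0)" if "f \<in> S" for f using expand[OF that] by simp
    then have "S = {\<lambda>_. 0}" using subS by (auto simp: fun_subspace_def)
    then show False using S(1) by (simp add: inv_sub_def)
  qed
  have rep: "representation \<rho>"
    unfolding representation_def dim_\<rho>
  proof (intro conjI allI impI)
    show "\<rho> 1 = 1\<^sub>m N"
      using on by (intro eq_matI) (auto simp: \<rho>_def ltrans_def group_inverse_one orthonormal_def)
    show "\<rho> (z * w) = \<rho> z * \<rho> w" for z w
    proof (rule eq_matI)
      fix i j assume "i < dim_row (\<rho> z * \<rho> w)" "j < dim_col (\<rho> z * \<rho> w)"
      then have ij: "i < N" "j < N" by (simp_all add: \<rho>_def)
      have "(\<Sum>i<N. \<rho> (z * w) $$ (i, j) * u i x) = (\<Sum>i<N. (\<rho> z * \<rho> w) $$ (i, j) * u i x)" for x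
      proof -
        have "(\<Sum>i<N. \<rho> (z * w) $$ (i, j) * u i x) = u j (inverse w * (inverse z * x))"
          using act[OF ij(2), of "z * w" x] by (simp add: group_simps)
        also have "\<dots> = (\<Sum>k<N. \<rho> w $$ (k, j) * (\<Sum>i<N. \<rho> z $$ (i, k) * u i x))"
          using act ij by simp
        also have "\<dots> = (\<Sum>i<N. \<Sum>k<N. \<rho> w $$ (k, j) * (\<rho> z $$ (i, k) * u i x))"
          unfolding sum_distrib_left by (rule sum.swap)
        also have "\<dots> = (\<Sum>i<N. (\<rho> z * \<rho> w) $$ (i, j) * u i x)"
          using ij by (intro sum.cong refl)
            (simp add: index_mult_mat_sum[OF \<rho>_carrier \<rho>_carrier] sum_distrib_left mult_ac del: index_mult_mat)
        finally show ?thesis .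
      qed
      from coeffs[OF this ij(1)] show "\<rho> (z * w) $$ (i, j) = (\<rho> z * \<rho> w) $$ (i, j)" .
    qed (simp_all add: \<rho>_def)
    show "continuous_on UNIV (\<lambda>z. \<rho> z $$ (i, j))" if "i < N" "j < N" for i j
    proof -
      have "continuous_on UNIV (\<lambda>z. ip (ltrans z (u j)) (u i))"
        unfolding ip_def ltrans_def
        by (intro continuous_integral finite_borel_haar continuous_intros
            cu[OF that(1), THEN continuous_comp_UNIV] cu[OF that(2), THEN continuous_comp_UNIV])
      then show ?thesis using that by (simp add: \<rho>_def)
    qed
  qed simp
  have "W = carrier_vec N" if W: "invariant_subspace \<rho> W" and nz: "W \<noteq> {0\<^sub>v N}" for W
  proof -
    have W': "W \<subseteq> carrier_vec N" "0\<^sub>v N \<in> W" "\<And>v w. v \<in> W \<Longrightarrow> w \<in> W \<Longrightarrow> v + w \<in> W"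
      "\<And>c v. v \<in> W \<Longrightarrow> c \<cdot>\<^sub>v v \<in> W" "\<And>z v. v \<in> W \<Longrightarrow> \<rho> z *\<^sub>v v \<in> W"
      using W by (auto simp: invariant_subspace_def dim_\<rho>)
    define comb where "comb w = (\<lambda>x. \<Sum>i<N. w $ i * u i x)" for w
    \<comment> \<open>The functions with coordinate vector in W. They form a nonzero
      translation-stable subspace of S, to which the minimality of N applies.\<close>
    define T where "T = comb ` W"
    have TS: "T \<subseteq> S" using subS uS by (auto simp: T_def comb_def intro!: fun_subspace_combination)
    have "fun_subspace T"
      unfolding fun_subspace_def
    proof (intro conjI ballI allI)
      show "continuous_on UNIV f" if "f \<in> T" for f using TS that subS by (auto simp: fun_subspace_def)
      have "(\<lambda>_. 0) = comb (0\<^sub>v N)" by (simp add: comb_def)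
      then show "(\<lambda>_. 0) \<in> T" using W'(2) by (auto simp: T_def)
      show "(\<lambda>x. f x + g x) \<in> T" if "f \<in> T" "g \<in> T" for f g
      proof -
        obtain v w where vw: "v \<in> W" "w \<in> W" "f = comb v" "g = comb w" using \<open>f \<in> T\<close> \<open>g \<in> T\<close> by (auto simp: T_def)
        then have "(\<lambda>x. f x + g x) = comb (v + w)"
          using W'(1) by (auto simp: comb_def fun_eq_iff distrib_right sum.distrib)
        then show ?thesis using vw W'(3) by (auto simp: T_def)
      qed
      show "(\<lambda>x. a * f x) \<in> T" if "f \<in> T" for a f
      proof -
        obtain v where v: "v \<in> W" "f = comb v" using \<open>f \<in> T\<close> by (auto simp: T_def)
        then have "(\<lambda>x. a * f x) = comb (a \<cdot>\<^sub>v v)"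
          using W'(1) by (auto simp: comb_def fun_eq_iff sum_distrib_left mult.assoc)
        then show ?thesis using v W'(4) by (auto simp: T_def)
      qed
    qed
    moreover have "ltrans z f \<in> T" if "f \<in> T" for z f
    proof -
      obtain v where v: "v \<in> W" "f = comb v" using \<open>f \<in> T\<close> by (auto simp: T_def)
      have vc: "v \<in> carrier_vec N" using v W'(1) by auto
      have "ltrans z f x = comb (\<rho> z *\<^sub>v v) x" for x
      proof -
        have "ltrans z f x = (\<Sum>j<N. v $ j * (\<Sum>i<N. \<rho> z $$ (i, j) * u i x))"
          unfolding v(2) by (simp add: ltrans_def comb_def act)
        also have "\<dots> = (\<Sum>i<N. \<Sum>j<N. v $ j * (\<rho> z $$ (i, j) * u i x))"
          unfolding sum_distrib_left by (rule sum.swap)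
        also have "\<dots> = comb (\<rho> z *\<^sub>v v) x"
          unfolding comb_def by (intro sum.cong refl)
            (simp add: index_mult_mat_vec_sum[OF \<rho>_carrier vc] sum_distrib_left mult_ac del: index_mult_mat_vec)
        finally show ?thesis .
      qed
      then have "ltrans z f = comb (\<rho> z *\<^sub>v v)" by (rule ext)
      then show ?thesis using v W'(5) by (auto simp: T_def)
    qed
    moreover have "T \<noteq> {\<lambda>_. 0}"
    proof
      assume T0: "T = {\<lambda>_. 0}"
      have "w = 0\<^sub>v N" if "w \<in> W" for w
      proof (rule eq_vecI)
        have "comb w \<in> {\<lambda>_. 0}" using T0 that unfolding T_def by blast
        then have "(\<Sum>i<N. w $ i * u i x) = (\<Sum>i<N. 0 * u i x)" for x by (simp add: comb_def fun_eq_iff)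
        from coeffs[OF this] show "w $ i = 0\<^sub>v N $ i" if "i < dim_vec (0\<^sub>v N)" for i using that by simp
        show "dim_vec w = dim_vec (0\<^sub>v N)" using that W'(1) by auto
      qed
      then have "W = {0\<^sub>v N}" using W'(2) by blast
      then show False using nz by contradiction
    qed
    ultimately have T: "inv_sub T" using TS SE by (auto simp: inv_sub_def)
    then obtain n where n: "has_dim T n" using dim by blast
    then obtain v where "orthonormal_in T n v" by (auto simp: has_dim_def)
    \<comment> \<open>Minimality gives N \<le> n, so T contains N orthonormal functions. Such a
      system is maximal in S as well, hence spans S, and T is all of S.\<close>
    then have v: "orthonormal_in T N v" using N_min[OF T n] by (rule orthonormal_in_mono) auto
    then have "orthonormal_in S N v" by (rule orthonormal_in_mono) (use TS in auto)
    note expand' = orthonormal_expansion[OF subS this max]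
    have ST: "f \<in> T" if "f \<in> S" for f
    proof -
      have "(\<lambda>x. \<Sum>i<N. ip f (v i) * v i x) \<in> T"
        using v T by (intro fun_subspace_combination) (auto simp: orthonormal_in_def inv_sub_def)
      then show ?thesis using expand'[OF that] by simp
    qed
    have "a \<in> W" if a: "a \<in> carrier_vec N" for a
    proof -
      have "comb a \<in> S" unfolding comb_def using subS uS by (intro fun_subspace_combination) auto
      then obtain w where w: "w \<in> W" "comb a = comb w" using ST by (auto simp: T_def)
      have "a = w"
      proof (rule eq_vecI)
        have "(\<Sum>i<N. a $ i * u i x) = (\<Sum>i<N. w $ i * u i x)" for x using w(2) by (simp add: comb_def fun_eq_iff)
        from coeffs[OF this] show "a $ i = w $ i" if "i < dim_vec w" for i using that w(1) W'(1) by auto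
        show "dim_vec a = dim_vec w" using a w(1) W'(1) by auto
      qed
      then show ?thesis using w(1) by simp
    qed
    then show ?thesis using W'(1) by blast
  qed
  then have "irreducible_rep \<rho>" using rep N_pos by (auto simp: irreducible_rep_def dim_\<rho>)
  moreover have "conv (u i) \<psi> x = c * u i x" if "i < N" for i x using uS[OF that] SE by (auto simp: E_def)
  ultimately show thesis using that[of \<rho> N u] dim_\<rho> N_pos on act by blast
qed

text \<open>The coefficient matrix of a convolution is the product of the coefficient matrices of
  its factors, so it vanishes together with that of g. The proof finds the vanishing already for
  each fixed y, before the integration against f.\<close>

lemma fourier_conv_zero:
  assumes rep: "representation \<rho>" and f: "continuous_on UNIV f" and g: "continuous_on UNIV g"
    and zero: "\<And>i j. i < rep_dim \<rho> \<Longrightarrow> j < rep_dim \<rho> \<Longrightarrow> (LINT x|\<mu>. g x * \<rho> x $$ (i, j)) = 0"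
    and ij: "i < rep_dim \<rho>" "j < rep_dim \<rho>"
  shows "(LINT x|\<mu>. conv f g x * \<rho> x $$ (i, j)) = 0"
proof -
  let ?d = "rep_dim \<rho>"
  have \<rho>c: "\<rho> x \<in> carrier_mat ?d ?d" for x using rep by (auto simp: representation_def)
  have \<rho>m: "\<rho> (x * y) = \<rho> x * \<rho> y" for x y using rep by (auto simp: representation_def)
  have \<rho>k: "continuous_on UNIV (\<lambda>x. \<rho> x $$ (k, l))" if "k < ?d" "l < ?d" for k l
    using rep that by (auto simp: representation_def)
  note comp = f[THEN continuous_comp_UNIV] g[THEN continuous_comp_UNIV] \<rho>k[THEN continuous_comp_UNIV]
  have "(LINT x|\<mu>. conv f g x * \<rho> x $$ (i, j)) =
      (LINT x|\<mu>. LINT y|\<mu>. f y * g (inverse y * x) * \<rho> x $$ (i, j))"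
    by (simp add: conv_altdef[OF f g])
  also have "\<dots> = (LINT y|\<mu>. LINT x|\<mu>. f y * g (inverse y * x) * \<rho> x $$ (i, j))"
    by (intro Fubini_continuous finite_borel_haar continuous_intros comp ij)
  also have "\<dots> = 0"
  proof -
    have "(LINT x|\<mu>. f y * g (inverse y * x) * \<rho> x $$ (i, j)) = 0" for y
    proof -
      have "(LINT x|\<mu>. g (inverse y * x) * \<rho> x $$ (i, j)) = (LINT x|\<mu>. g x * \<rho> (y * x) $$ (i, j))"
        using integral_left_translate[of "\<lambda>x. g (inverse y * x) * \<rho> x $$ (i, j)" y]
        by (simp add: group_simps continuous_intros comp ij)
      also have "\<dots> = (LINT x|\<mu>. (\<Sum>k<?d. \<rho> y $$ (i, k) * (g x * \<rho> x $$ (k, j))))"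
        unfolding \<rho>m index_mult_mat_sum[OF \<rho>c \<rho>c ij] by (simp add: sum_distrib_left mult_ac)
      also have "\<dots> = (\<Sum>k<?d. \<rho> y $$ (i, k) * (LINT x|\<mu>. g x * \<rho> x $$ (k, j)))"
        using ij by (subst Bochner_Integration.integral_sum)
          (auto intro!: integrable_continuous finite_borel_haar continuous_intros comp)
      also have "\<dots> = 0" using zero ij by simp
      finally show ?thesis by (simp add: mult.assoc)
    qed
    then show ?thesis by simp
  qed
  finally show ?thesis .
qed

theorem Peter_Weyl_uniqueness:
  assumes F: "continuous_on UNIV F"
    and zero: "\<And>\<rho> i j. irreducible_rep \<rho> \<Longrightarrow> i < rep_dim \<rho> \<Longrightarrow> j < rep_dim \<rho> \<Longrightarrow>
      (LINT x|\<mu>. F x * \<rho> x $$ (i, j)) = 0"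
  shows "F x0 = 0"
proof (rule ccontr)
  assume "F x0 \<noteq> 0"
  then have "sqnorm F \<noteq> 0" using sqnorm_eq_0[OF F] by blast
  define G where "G = (\<lambda>x. cnj (F (inverse x)))"
  have G: "continuous_on UNIV G" unfolding G_def by (intro continuous_intros continuous_comp_UNIV[OF F])
  define \<phi> where "\<phi> = conv G F"
  have \<phi>: "continuous_on UNIV \<phi>" unfolding \<phi>_def by (rule continuous_conv[OF G F])
  have "cnj (\<phi> (inverse x)) = \<phi> x" for x
    unfolding \<phi>_def conv_adjoint[OF G F] by (simp add: G_def group_simps)
  then have herm: "\<phi> (inverse x) = cnj (\<phi> x)" for x by (metis complex_cnj_cnj)
  \<comment> \<open>This is why F is convolved with its image under the involution: the value at 1
    is the squared norm of F, so \<phi> is not zero.\<close>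
  have "\<phi> 1 = ip F F" by (simp add: \<phi>_def conv_def G_def group_simps ip_def mult.commute)
  then have "\<phi> 1 \<noteq> 0" using \<open>sqnorm F \<noteq> 0\<close> by (simp add: ip_self)
  from conv_eigenfunction[OF \<phi> herm this]
  obtain e M where e: "continuous_on UNIV e" "e 1 \<noteq> 0" "M \<noteq> 0" "\<And>x. conv e (conv \<phi> \<phi>) x = M * e x"
    by blast
  define \<psi> where "\<psi> = conv \<phi> \<phi>"
  have \<psi>: "continuous_on UNIV \<psi>" unfolding \<psi>_def by (rule continuous_conv[OF \<phi> \<phi>])
  obtain \<rho> N u where \<rho>: "irreducible_rep \<rho>" "rep_dim \<rho> = N" "N > 0" and u: "orthonormal N u"
    "\<And>i x. i < N \<Longrightarrow> conv (u i) \<psi> x = M * u i x"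
    "\<And>j z x. j < N \<Longrightarrow> u j (inverse z * x) = (\<Sum>i<N. \<rho> z $$ (i, j) * u i x)"
    by (rule irreducible_constituent[OF \<psi> e(3) e(1) e(4)[folded \<psi>_def] e(2)]) (rule that)
  have rep: "representation \<rho>" using \<rho>(1) by (simp add: irreducible_rep_def)
  have \<rho>c: "\<rho> x \<in> carrier_mat N N" for x using rep \<rho>(2) by (auto simp: representation_def)
  have \<rho>m: "\<rho> (x * y) = \<rho> x * \<rho> y" for x y using rep by (auto simp: representation_def)
  have \<rho>k: "continuous_on UNIV (\<lambda>x. \<rho> x $$ (k, l))" if "k < N" "l < N" for k l
    using rep that \<rho>(2) by (auto simp: representation_def)
  have F0: "(LINT x|\<mu>. F x * \<rho> x $$ (i, j)) = 0" if "i < N" "j < N" for i j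
    using zero[OF \<rho>(1)] that \<rho>(2) by simp
  have \<phi>0: "(LINT x|\<mu>. \<phi> x * \<rho> x $$ (i, j)) = 0" if "i < N" "j < N" for i j
    unfolding \<phi>_def using fourier_conv_zero[OF rep G F] F0 that \<rho>(2) by simp
  have \<psi>0: "(LINT x|\<mu>. \<psi> x * \<rho> x $$ (i, j)) = 0" if "i < N" "j < N" for i j
    unfolding \<psi>_def using fourier_conv_zero[OF rep \<phi> \<phi>] \<phi>0 that \<rho>(2) by simp
  have "conv (u 0) \<psi> x = 0" for x
  proof -
    \<comment> \<open>The argument is the translate of 1 by y * inverse x, so multiplicativity of
      \<rho> isolates the entries of \<open>\<rho> y\<close>. What remains to integrate over y are
      Fourier coefficients of \<psi>.\<close>
    have "u 0 (x * inverse y) * \<psi> y =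
       (\<Sum>i<N. \<Sum>k<N. (u i 1 * \<rho> (inverse x) $$ (k, 0)) * (\<psi> y * \<rho> y $$ (i, k)))" for y
    proof -
      have "u 0 (x * inverse y) = (\<Sum>i<N. \<rho> (y * inverse x) $$ (i, 0) * u i 1)"
        using u(3)[OF \<rho>(3), of "y * inverse x" 1] by (simp add: group_simps)
      also have "\<dots> = (\<Sum>i<N. (\<Sum>k<N. \<rho> y $$ (i, k) * \<rho> (inverse x) $$ (k, 0)) * u i 1)"
        unfolding \<rho>m using \<rho>(3) by (intro sum.cong refl) (simp add: index_mult_mat_sum[OF \<rho>c \<rho>c] del: index_mult_mat)
      finally show ?thesis by (simp add: sum_distrib_right sum_distrib_left mult_ac)
    qed
    then have "conv (u 0) \<psi> x =
      (LINT y|\<mu>. (\<Sum>i<N. \<Sum>k<N. (u i 1 * \<rho> (inverse x) $$ (k, 0)) * (\<psi> y * \<rho> y $$ (i, k))))"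
      by (simp only: conv_def)
    also have "\<dots> = (\<Sum>i<N. \<Sum>k<N. (u i 1 * \<rho> (inverse x) $$ (k, 0)) * (LINT y|\<mu>. \<psi> y * \<rho> y $$ (i, k)))"
    proof -
      have i: "integrable \<mu> (\<lambda>y. \<psi> y * \<rho> y $$ (i, k))" if "i < N" "k < N" for i k
        by (intro integrable_continuous finite_borel_haar continuous_intros \<psi> \<rho>k that)
      have ii: "integrable \<mu> (\<lambda>y. (u i 1 * \<rho> (inverse x) $$ (k, 0)) * (\<psi> y * \<rho> y $$ (i, k)))"
        if "i < N" "k < N" for i k
        using i[OF that] by (rule integrable_mult_right)
      show ?thesis
        by (subst Bochner_Integration.integral_sum)
          (auto intro!: Bochner_Integration.integrable_sum ii sum.cong simp: Bochner_Integration.integral_sum ii)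
    qed
    also have "\<dots> = 0" using \<psi>0 by simp
    finally show ?thesis .
  qed
  then have "u 0 x = 0" for x using u(2)[OF \<rho>(3)] e(3) by simp
  then have "ip (u 0) (u 0) = 0" by (simp add: ip_def)
  then show False using u(1) \<rho>(3) by (simp add: orthonormal_def)
qed

end

section \<open>Schur orthogonality and the Frobenius-Schur indicator\<close>

definition mat_trace :: "complex mat \<Rightarrow> complex" where
  "mat_trace A = (\<Sum>i<dim_row A. A $$ (i, i))"

lemma mat_trace_mult_comm:
  assumes "A \<in> carrier_mat n m" "B \<in> carrier_mat m n"
  shows "mat_trace (A * B) = mat_trace (B * A)"
proof -
  have "mat_trace (A * B) = (\<Sum>i<n. \<Sum>k<m. A $$ (i, k) * B $$ (k, i))"
    using assms by (simp add: mat_trace_def index_mult_mat_sum[OF assms] del: index_mult_mat(1))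
  also have "\<dots> = (\<Sum>k<m. \<Sum>i<n. B $$ (k, i) * A $$ (i, k))"
    by (subst sum.swap) (simp add: mult.commute)
  also have "\<dots> = mat_trace (B * A)"
    using assms by (simp add: mat_trace_def index_mult_mat_sum[OF assms(2,1)] del: index_mult_mat(1))
  finally show ?thesis .
qed

lemma mat_trace_similar:
  assumes "A \<in> carrier_mat n n" "P \<in> carrier_mat n n" "Q \<in> carrier_mat n n" "Q * P = 1\<^sub>m n"
  shows "mat_trace (P * A * Q) = mat_trace A"
proof -
  have "mat_trace (P * A * Q) = mat_trace (Q * (P * A))"
    using assms by (intro mat_trace_mult_comm) auto
  also have "Q * (P * A) = (Q * P) * A" using assms by (intro assoc_mult_mat[symmetric]) auto
  also have "\<dots> = A" using assms by simp
  finally show ?thesis .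
qed

lemma representation_facts:
  assumes "representation \<rho>" "rep_dim \<rho> = n"
  shows "\<rho> x \<in> carrier_mat n n" "\<rho> 1 = 1\<^sub>m n" "\<rho> (x * y) = \<rho> x * \<rho> y"
    "i < n \<Longrightarrow> j < n \<Longrightarrow> continuous_on UNIV (\<lambda>x. \<rho> x $$ (i, j))"
  using assms by (auto simp: representation_def)

lemma representation_inverse:
  assumes "representation \<rho>" "rep_dim \<rho> = n"
  shows "\<rho> (inverse x) * \<rho> x = 1\<^sub>m n" "\<rho> x * \<rho> (inverse x) = 1\<^sub>m n"
  by (simp_all add: representation_facts(2,3)[OF assms, symmetric] group_simps)

lemma mat_eq_zero_if_kernel_full:
  fixes P :: "complex mat"
  assumes P: "P \<in> carrier_mat n m" and ker: "\<And>v. v \<in> carrier_vec m \<Longrightarrow> P *\<^sub>v v = 0\<^sub>v n"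
  shows "P = 0\<^sub>m n m"
proof (rule eq_matI)
  fix i j assume ij: "i < dim_row (0\<^sub>m n m)" "j < dim_col (0\<^sub>m n m)"
  have "P $$ (i, j) = (P *\<^sub>v unit_vec m j) $ i"
    using P ij by (auto simp: scalar_prod_right_unit)
  also have "\<dots> = 0" using ker[of "unit_vec m j"] ij by simp
  finally show "P $$ (i, j) = 0\<^sub>m n m $$ (i, j)" using ij by simp
qed (use P in auto)

text \<open>The kernel of P is invariant. The matrices Q are arbitrary so that two situations are
  covered: intertwiners with another representation, and invariant bilinear forms, where Q is the
  transpose of \<open>\<rho> (inverse x)\<close>.\<close>

lemma irreducible_kernel_trivial:
  fixes P :: "complex mat"
  assumes \<sigma>: "irreducible_rep \<sigma>" "rep_dim \<sigma> = m" and P: "P \<in> carrier_mat n m" "P \<noteq> 0\<^sub>m n m"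
    and comm: "\<And>x. \<exists>Q\<in>carrier_mat n n. P * \<sigma> x = Q * P"
    and v: "v \<in> carrier_vec m" "P *\<^sub>v v = 0\<^sub>v n"
  shows "v = 0\<^sub>v m"
proof -
  have rep: "representation \<sigma>" using \<sigma> by (simp add: irreducible_rep_def)
  note \<sigma>c = representation_facts(1)[OF rep \<sigma>(2)]
  define W where "W = {v \<in> carrier_vec m. P *\<^sub>v v = 0\<^sub>v n}"
  have "invariant_subspace \<sigma> W"
    unfolding invariant_subspace_def \<sigma>(2)
  proof (intro conjI ballI allI)
    fix x w assume "w \<in> W"
    then have w: "w \<in> carrier_vec m" "P *\<^sub>v w = 0\<^sub>v n" by (auto simp: W_def)
    obtain Q where Q: "Q \<in> carrier_mat n n" "P * \<sigma> x = Q * P" using comm by blast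
    have "P *\<^sub>v (\<sigma> x *\<^sub>v w) = Q *\<^sub>v (P *\<^sub>v w)"
      using assoc_mult_mat_vec[OF P(1) \<sigma>c w(1)] assoc_mult_mat_vec[OF Q(1) P(1) w(1)] Q(2) by metis
    also have "\<dots> = 0\<^sub>v n" unfolding w(2) using carrier_matD[OF Q(1)] by (intro eq_vecI) (auto simp: scalar_prod_def)
    finally show "\<sigma> x *\<^sub>v w \<in> W" using mult_mat_vec_carrier[OF \<sigma>c w(1)] by (simp add: W_def)
  qed (use P(1) in \<open>auto simp: W_def mult_add_distrib_mat_vec mult_mat_vec\<close>)
  then have "W = {0\<^sub>v m} \<or> W = carrier_vec m" using \<sigma> by (auto simp: irreducible_rep_def)
  moreover have "W \<noteq> carrier_vec m"
    using mat_eq_zero_if_kernel_full[OF P(1)] P(2) by (auto simp: W_def)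
  ultimately show ?thesis using v by (auto simp: W_def)
qed

text \<open>Kernel and image of P are invariant, so P is injective and surjective. Preimages of the
  unit vectors are the columns of a right inverse, and injectivity makes it a left inverse.\<close>

lemma Schur_lemma_inverse:
  fixes P :: "complex mat"
  assumes \<rho>: "irreducible_rep \<rho>" "rep_dim \<rho> = n" and \<sigma>: "irreducible_rep \<sigma>" "rep_dim \<sigma> = m"
    and P: "P \<in> carrier_mat n m" "P \<noteq> 0\<^sub>m n m" and comm: "\<And>x. \<rho> x * P = P * \<sigma> x"
  obtains Q where "Q \<in> carrier_mat m n" "P * Q = 1\<^sub>m n" "Q * P = 1\<^sub>m m" "n = m"
proof -
  have rep: "representation \<rho>" "representation \<sigma>" using \<rho> \<sigma> by (auto simp: irreducible_rep_def)
  note \<rho>c = representation_facts(1)[OF rep(1) \<rho>(2)] and \<sigma>c = representation_facts(1)[OF rep(2) \<sigma>(2)]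
  have act: "P *\<^sub>v (\<sigma> x *\<^sub>v v) = \<rho> x *\<^sub>v (P *\<^sub>v v)" if "v \<in> carrier_vec m" for x v
    using comm[of x] assoc_mult_mat_vec[OF P(1) \<sigma>c that] assoc_mult_mat_vec[OF \<rho>c P(1) that] by metis
  have W0: "v = 0\<^sub>v m" if "v \<in> carrier_vec m" "P *\<^sub>v v = 0\<^sub>v n" for v
    using irreducible_kernel_trivial[OF \<sigma> P _ that] comm \<rho>c by metis
  define R where "R = (\<lambda>v. P *\<^sub>v v) ` carrier_vec m"
  have "invariant_subspace \<rho> R"
    unfolding invariant_subspace_def \<rho>(2)
  proof (intro conjI ballI allI)
    show "R \<subseteq> carrier_vec n" using P(1) by (auto simp: R_def)
    show "0\<^sub>v n \<in> R" using P(1) by (auto simp: R_def intro!: image_eqI[of _ _ "0\<^sub>v m"])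
    show "v + w \<in> R" if "v \<in> R" "w \<in> R" for v w
      using that P(1) by (auto simp: R_def mult_add_distrib_mat_vec[symmetric])
    show "c \<cdot>\<^sub>v v \<in> R" if "v \<in> R" for c v
      using that P(1) by (auto simp: R_def mult_mat_vec[symmetric])
    show "\<rho> x *\<^sub>v v \<in> R" if "v \<in> R" for x v
      using that \<sigma>c by (auto simp: R_def act[symmetric] intro!: imageI mult_mat_vec_carrier[of _ m m])
  qed
  then have "R = {0\<^sub>v n} \<or> R = carrier_vec n" using \<rho> by (auto simp: irreducible_rep_def)
  moreover have "R \<noteq> {0\<^sub>v n}"
  proof
    assume R0: "R = {0\<^sub>v n}"
    have "P *\<^sub>v v = 0\<^sub>v n" if "v \<in> carrier_vec m" for v using R0 that unfolding R_def by blast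
    then show False using mat_eq_zero_if_kernel_full[OF P(1)] P(2) by blast
  qed
  ultimately have R: "R = carrier_vec n" by blast
  have "\<exists>v. v \<in> carrier_vec m \<and> P *\<^sub>v v = unit_vec n j" for j
  proof -
    have "unit_vec n j \<in> R" unfolding R by simp
    then show ?thesis unfolding R_def by force
  qed
  then obtain q where q: "\<And>j. q j \<in> carrier_vec m" "\<And>j. P *\<^sub>v q j = unit_vec n j" by metis
  define Q where "Q = mat_of_cols m (map q [0..<n])"
  have Q: "Q \<in> carrier_mat m n" by (simp add: Q_def mat_of_cols_carrier(1)[of m "map q [0..<n]", simplified])
  have colQ: "col Q j = q j" if "j < n" for j
    using that q(1) unfolding Q_def by (subst col_mat_of_cols) auto
  have PQ: "P * Q = 1\<^sub>m n"
  proof (rule eq_matI)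
    fix i j assume ij: "i < dim_row (1\<^sub>m n :: complex mat)" "j < dim_col (1\<^sub>m n :: complex mat)"
    have "(P * Q) $$ (i, j) = (P *\<^sub>v q j) $ i"
      using ij P(1) Q colQ by simp
    then show "(P * Q) $$ (i, j) = 1\<^sub>m n $$ (i, j)" using q(2)[of j] ij by simp
  qed (use P Q in auto)
  have QP: "Q * P = 1\<^sub>m m"
  proof -
    have "Q * P - 1\<^sub>m m = 0\<^sub>m m m"
    proof (rule mat_eq_zero_if_kernel_full)
      show "Q * P - 1\<^sub>m m \<in> carrier_mat m m" by (intro minus_carrier_mat one_carrier_mat)
      fix v :: "complex vec" assume v: "v \<in> carrier_vec m"
      have QPv: "(Q * P) *\<^sub>v v \<in> carrier_vec m" using P Q v by (intro mult_mat_vec_carrier[of _ m m]) auto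
      have "P *\<^sub>v ((Q * P) *\<^sub>v v - v) = P *\<^sub>v ((Q * P) *\<^sub>v v) - P *\<^sub>v v"
        by (rule mult_minus_distrib_mat_vec[OF P(1) QPv v])
      also have "P *\<^sub>v ((Q * P) *\<^sub>v v) = (P * (Q * P)) *\<^sub>v v"
        using P Q v by (intro assoc_mult_mat_vec[symmetric, of _ n m _ m]) auto
      also have "P * (Q * P) = P"
        using P Q PQ by (simp add: assoc_mult_mat[symmetric, of P n m Q n P m])
      also have "P *\<^sub>v v - P *\<^sub>v v = 0\<^sub>v n" using P v by auto
      finally have "(Q * P) *\<^sub>v v - v = 0\<^sub>v m" using QPv v by (intro W0) auto
      moreover have "(Q * P - 1\<^sub>m m) *\<^sub>v v = (Q * P) *\<^sub>v v - 1\<^sub>m m *\<^sub>v v"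
        using P Q v by (intro minus_mult_distrib_mat_vec[of _ m m]) auto
      ultimately show "(Q * P - 1\<^sub>m m) *\<^sub>v v = 0\<^sub>v m" using v by simp
    qed
    then have "Q * P - 1\<^sub>m m + 1\<^sub>m m = 0\<^sub>m m m + 1\<^sub>m m" by simp
    moreover have "Q * P - 1\<^sub>m m + 1\<^sub>m m = Q * P" using P Q by (intro eq_matI) auto
    ultimately show ?thesis by simp
  qed
  \<comment> \<open>Both products are identity matrices with the same trace, and over the complex
    numbers the trace of an identity matrix determines its size.\<close>
  have "n = m"
    using mat_trace_mult_comm[OF P(1) Q] unfolding PQ QP by (simp add: mat_trace_def)
  with Q PQ QP show thesis by (rule that)
qed

text \<open>P has an eigenvalue because the field is algebraically closed and n > 0. The eigenspace
  is invariant and nonzero, hence everything.\<close>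

lemma Schur_lemma_scalar:
  fixes P :: "complex mat"
  assumes \<rho>: "irreducible_rep \<rho>" "rep_dim \<rho> = n"
    and P: "P \<in> carrier_mat n n" and comm: "\<And>x. \<rho> x * P = P * \<rho> x"
  obtains c where "P = c \<cdot>\<^sub>m 1\<^sub>m n"
proof -
  have rep: "representation \<rho>" using \<rho> by (auto simp: irreducible_rep_def)
  note \<rho>c = representation_facts(1)[OF rep(1) \<rho>(2)]
  have n: "n > 0" using \<rho> by (auto simp: irreducible_rep_def)
  obtain c v where v: "v \<in> carrier_vec n" "v \<noteq> 0\<^sub>v n" "P *\<^sub>v v = c \<cdot>\<^sub>v v"
    using spectrum_non_empty[OF P n] P by (auto simp: spectrum_def eigenvalue_def eigenvector_def)
  have act: "P *\<^sub>v (\<rho> x *\<^sub>v v) = \<rho> x *\<^sub>v (P *\<^sub>v v)" if "v \<in> carrier_vec n" for x v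
    using comm[of x] assoc_mult_mat_vec[OF P(1) \<rho>c that] assoc_mult_mat_vec[OF \<rho>c P(1) that] by metis
  define W where "W = {v \<in> carrier_vec n. P *\<^sub>v v = c \<cdot>\<^sub>v v}"
  have "invariant_subspace \<rho> W"
    unfolding invariant_subspace_def \<rho>(2)
  proof (intro conjI ballI allI)
    show "W \<subseteq> carrier_vec n" by (auto simp: W_def)
    show "0\<^sub>v n \<in> W" using P by (auto simp: W_def)
    show "v + w \<in> W" if "v \<in> W" "w \<in> W" for v w
      using that P by (auto simp: W_def mult_add_distrib_mat_vec smult_add_distrib_vec)
    show "a \<cdot>\<^sub>v v \<in> W" if "v \<in> W" for a v
      using that P by (auto simp: W_def mult_mat_vec smult_smult_assoc mult.commute)
    show "\<rho> x *\<^sub>v v \<in> W" if "v \<in> W" for x v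
      using that \<rho>c by (auto simp: W_def act mult_mat_vec[OF \<rho>c] intro!: mult_mat_vec_carrier[of _ n n])
  qed
  moreover have "W \<noteq> {0\<^sub>v n}" using v by (auto simp: W_def)
  ultimately have W: "W = carrier_vec n" using \<rho> by (auto simp: irreducible_rep_def)
  have "P = c \<cdot>\<^sub>m 1\<^sub>m n"
  proof (rule eq_matI)
    fix i j assume "i < dim_row (c \<cdot>\<^sub>m 1\<^sub>m n)" "j < dim_col (c \<cdot>\<^sub>m 1\<^sub>m n)"
    then have ij: "i < n" "j < n" by auto
    have "unit_vec n j \<in> W" using W by simp
    then have "(P *\<^sub>v unit_vec n j) $ i = c * unit_vec n j $ i" using ij by (simp add: W_def)
    moreover have "(P *\<^sub>v unit_vec n j) $ i = P $$ (i, j)"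
      using P ij by (auto simp: scalar_prod_right_unit)
    ultimately show "P $$ (i, j) = (c \<cdot>\<^sub>m 1\<^sub>m n) $$ (i, j)" using ij by auto
  qed (use P in auto)
  then show thesis by (rule that)
qed

context haar_group
begin

section \<open>Integration of matrix-valued functions\<close>

definition cmat :: "nat \<Rightarrow> nat \<Rightarrow> ('a \<Rightarrow> complex mat) \<Rightarrow> bool" where
  "cmat n m F \<longleftrightarrow> (\<forall>x. F x \<in> carrier_mat n m) \<and> (\<forall>i<n. \<forall>j<m. continuous_on UNIV (\<lambda>x. F x $$ (i, j)))"

definition mint :: "nat \<Rightarrow> nat \<Rightarrow> ('a \<Rightarrow> complex mat) \<Rightarrow> complex mat" where
  "mint n m F = mat n m (\<lambda>(i, j). LINT x|\<mu>. F x $$ (i, j))"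

lemma mint_carrier [simp]: "mint n m F \<in> carrier_mat n m"
  by (simp add: mint_def)

lemma cmat_mult:
  assumes "cmat n m F" "cmat m p G"
  shows "cmat n p (\<lambda>x. F x * G x)"
proof -
  have c: "\<And>x. F x \<in> carrier_mat n m" "\<And>x. G x \<in> carrier_mat m p" using assms by (auto simp: cmat_def)
  have "continuous_on UNIV (\<lambda>x. (F x * G x) $$ (i, j))" if "i < n" "j < p" for i j
    unfolding index_mult_mat_sum[OF c that] using assms that
    by (auto simp: cmat_def intro!: continuous_intros)
  then show ?thesis using mult_carrier_mat[OF c] by (simp add: cmat_def)
qed

lemma cmat_const: "A \<in> carrier_mat n m \<Longrightarrow> cmat n m (\<lambda>_. A)"
  by (simp add: cmat_def)

lemma cmat_rep: "representation \<rho> \<Longrightarrow> rep_dim \<rho> = n \<Longrightarrow> cmat n n \<rho>"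
  by (auto simp: cmat_def representation_def)

lemma cmat_comp: "cmat n m F \<Longrightarrow> continuous_on UNIV \<tau> \<Longrightarrow> cmat n m (\<lambda>x. F (\<tau> x))"
  by (auto simp: cmat_def intro: continuous_comp_UNIV)

lemma cmat_transpose: "cmat n m F \<Longrightarrow> cmat m n (\<lambda>x. (F x)\<^sup>T)"
proof -
  assume F: "cmat n m F"
  have "(F x)\<^sup>T $$ (i, j) = F x $$ (j, i)" if "i < m" "j < n" for x i j
  proof -
    have "F x \<in> carrier_mat n m" using F by (simp add: cmat_def)
    from carrier_matD[OF this] show ?thesis using that by simp
  qed
  then show ?thesis using F by (simp add: cmat_def)
qed

lemma mint_mult_left:
  assumes A: "A \<in> carrier_mat p n" and F: "cmat n m F"
  shows "mint p m (\<lambda>x. A * F x) = A * mint n m F"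
proof (rule eq_matI)
  fix i j assume "i < dim_row (A * mint n m F)" "j < dim_col (A * mint n m F)"
  then have ij: "i < p" "j < m" using A by (auto simp: mint_def)
  have Fc: "F x \<in> carrier_mat n m" for x using F by (auto simp: cmat_def)
  have "(LINT x|\<mu>. (A * F x) $$ (i, j)) = (LINT x|\<mu>. (\<Sum>k<n. A $$ (i, k) * F x $$ (k, j)))"
    by (simp only: index_mult_mat_sum[OF A Fc ij])
  also have "\<dots> = (\<Sum>k<n. A $$ (i, k) * (LINT x|\<mu>. F x $$ (k, j)))"
    using F ij by (subst Bochner_Integration.integral_sum)
      (auto simp: cmat_def intro!: integrable_mult_right integrable_continuous finite_borel_haar)
  also have "\<dots> = (A * mint n m F) $$ (i, j)"
    using ij by (subst index_mult_mat_sum[OF A mint_carrier ij]) (simp add: mint_def)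
  finally show "mint p m (\<lambda>x. A * F x) $$ (i, j) = (A * mint n m F) $$ (i, j)"
    using ij by (simp add: mint_def)
qed (use A in \<open>auto simp: mint_def\<close>)

lemma mint_mult_right:
  assumes A: "A \<in> carrier_mat m p" and F: "cmat n m F"
  shows "mint n p (\<lambda>x. F x * A) = mint n m F * A"
proof (rule eq_matI)
  fix i j assume "i < dim_row (mint n m F * A)" "j < dim_col (mint n m F * A)"
  then have ij: "i < n" "j < p" using A by (auto simp: mint_def)
  have Fc: "F x \<in> carrier_mat n m" for x using F by (auto simp: cmat_def)
  have "(LINT x|\<mu>. (F x * A) $$ (i, j)) = (LINT x|\<mu>. (\<Sum>k<m. F x $$ (i, k) * A $$ (k, j)))"
    by (simp only: index_mult_mat_sum[OF Fc A ij])
  also have "\<dots> = (\<Sum>k<m. (LINT x|\<mu>. F x $$ (i, k)) * A $$ (k, j))"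
    using F ij by (subst Bochner_Integration.integral_sum)
      (auto simp: cmat_def intro!: integrable_mult_left integrable_continuous finite_borel_haar)
  also have "\<dots> = (mint n m F * A) $$ (i, j)"
    using ij by (subst index_mult_mat_sum[OF mint_carrier A ij]) (simp add: mint_def)
  finally show "mint n p (\<lambda>x. F x * A) $$ (i, j) = (mint n m F * A) $$ (i, j)"
    using ij by (simp add: mint_def)
qed (use A in \<open>auto simp: mint_def\<close>)

lemma mint_left_translate: "cmat n m F \<Longrightarrow> mint n m (\<lambda>x. F (a * x)) = mint n m F"
  by (auto simp: mint_def cmat_def integral_left_translate[of "\<lambda>x. F x $$ _"] intro!: eq_matI)

lemma mint_right_translate: "cmat n m F \<Longrightarrow> mint n m (\<lambda>x. F (x * a)) = mint n m F"
  by (auto simp: mint_def cmat_def integral_right_translate[of "\<lambda>x. F x $$ _"] intro!: eq_matI)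

lemma mat_trace_mint:
  assumes "cmat n n F"
  shows "mat_trace (mint n n F) = (LINT x|\<mu>. mat_trace (F x))"
proof -
  have c: "F x \<in> carrier_mat n n" for x using assms by (auto simp: cmat_def)
  have "(LINT x|\<mu>. mat_trace (F x)) = (LINT x|\<mu>. (\<Sum>i<n. F x $$ (i, i)))"
    using c by (simp add: mat_trace_def carrier_matD(1)[OF c])
  also have "\<dots> = (\<Sum>i<n. LINT x|\<mu>. F x $$ (i, i))"
    using assms by (intro Bochner_Integration.integral_sum)
      (auto simp: cmat_def intro!: integrable_continuous finite_borel_haar)
  finally show ?thesis by (simp add: mat_trace_def mint_def)
qed

text \<open>Replacing x by x * a leaves T unchanged and pulls \<open>\<rho> (inverse a)\<close> out
  on the left and \<open>\<sigma> a\<close> on the right.\<close>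

lemma intertwiner_average:
  assumes \<rho>: "representation \<rho>" "rep_dim \<rho> = n" and \<sigma>: "representation \<sigma>" "rep_dim \<sigma> = m"
    and B: "B \<in> carrier_mat n m"
  defines "T \<equiv> mint n m (\<lambda>x. \<rho> (inverse x) * B * \<sigma> x)"
  shows "\<rho> a * T = T * \<sigma> a"
proof -
  note \<rho>c = representation_facts(1)[OF \<rho>] and \<sigma>c = representation_facts(1)[OF \<sigma>]
  have cm: "cmat n m (\<lambda>x. \<rho> (inverse x) * B * \<sigma> x)"
    by (intro cmat_mult[of n m _ m] cmat_mult[of n n _ m] cmat_const B cmat_rep[OF \<sigma>]
        cmat_comp[OF cmat_rep[OF \<rho>]] continuous_intros)
  have "T = mint n m (\<lambda>x. \<rho> (inverse (x * a)) * B * \<sigma> (x * a))"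
    unfolding T_def using mint_right_translate[OF cm, of a] by simp
  also have "\<dots> = mint n m (\<lambda>x. \<rho> (inverse a) * ((\<rho> (inverse x) * B * \<sigma> x) * \<sigma> a))"
  proof (rule arg_cong[of _ _ "mint n m"], rule ext)
    fix x
    have "\<rho> (inverse (x * a)) * B * \<sigma> (x * a) = (\<rho> (inverse a) * \<rho> (inverse x)) * B * (\<sigma> x * \<sigma> a)"
      by (simp add: group_simps representation_facts(3)[OF \<rho>] representation_facts(3)[OF \<sigma>])
    then show "\<rho> (inverse (x * a)) * B * \<sigma> (x * a) = \<rho> (inverse a) * ((\<rho> (inverse x) * B * \<sigma> x) * \<sigma> a)"
      using \<rho>c \<sigma>c B
      by (simp add: assoc_mult_mat[of _ n n _ n _ m] assoc_mult_mat[of _ n n _ m _ m] assoc_mult_mat[of _ n m _ m _ m]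
          mult_carrier_mat[of _ n n] mult_carrier_mat[of _ n m] mult_carrier_mat[of _ m m])
  qed
  also have "\<dots> = \<rho> (inverse a) * (T * \<sigma> a)"
    unfolding T_def
    by (simp only: mint_mult_left[OF \<rho>c cmat_mult[OF cm cmat_const[OF \<sigma>c]]] mint_mult_right[OF \<sigma>c cm])
  finally have "\<rho> a * T = \<rho> a * (\<rho> (inverse a) * (T * \<sigma> a))" by simp
  also have "\<dots> = (\<rho> a * \<rho> (inverse a)) * (T * \<sigma> a)"
    using \<rho>c \<sigma>c by (subst assoc_mult_mat[of _ n n _ n _ m]) (auto simp: T_def intro!: mult_carrier_mat[of _ n m])
  also have "\<dots> = T * \<sigma> a"
    unfolding representation_inverse(2)[OF \<rho>] using \<sigma>c
    by (intro left_mult_one_mat[of _ n m] mult_carrier_mat[of _ n m]) (auto simp: T_def)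
  finally show ?thesis .
qed


abbreviation volume :: complex where "volume \<equiv> complex_of_real (measure \<mu> UNIV)"

definition mat_unit :: "nat \<Rightarrow> nat \<Rightarrow> nat \<Rightarrow> nat \<Rightarrow> complex mat" where
  "mat_unit n m k l = mat n m (\<lambda>(i, j). if i = k \<and> j = l then 1 else 0)"

lemma mat_unit_carrier [simp]: "mat_unit n m k l \<in> carrier_mat n m"
  by (simp add: mat_unit_def)

text \<open>With a matrix unit in the middle, the entries of an average are integrals of products of
  two single entries. In this way Schur's lemma becomes orthogonality of matrix entries.\<close>

lemma index_mat_unit_sandwich:
  assumes A: "A \<in> carrier_mat p n" and C: "C \<in> carrier_mat m q" and "i < p" "j < q" "k < n" "l < m"
  shows "(A * mat_unit n m k l * C) $$ (i, j) = A $$ (i, k) * C $$ (l, j)"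
proof -
  have 1: "(A * mat_unit n m k l) $$ (i, b) = (if b = l then A $$ (i, k) else 0)" if "b < m" for b
    unfolding index_mult_mat_sum[OF A mat_unit_carrier \<open>i < p\<close> that]
    using assms that by (auto simp: mat_unit_def sum.delta if_distrib cong: if_cong)
  have "(A * mat_unit n m k l * C) $$ (i, j) = (\<Sum>b<m. (A * mat_unit n m k l) $$ (i, b) * C $$ (b, j))"
    by (rule index_mult_mat_sum[OF mult_carrier_mat[OF A mat_unit_carrier] C \<open>i < p\<close> \<open>j < q\<close>])
  also have "\<dots> = (\<Sum>b<m. if b = l then A $$ (i, k) * C $$ (b, j) else 0)"
    by (intro sum.cong refl) (simp add: 1 del: index_mult_mat)
  also have "\<dots> = A $$ (i, k) * C $$ (l, j)" using \<open>l < m\<close> by simp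
  finally show ?thesis .
qed

lemma mat_trace_scalar: "mat_trace (c \<cdot>\<^sub>m 1\<^sub>m n) = c * of_nat n"
  by (simp add: mat_trace_def)

lemma integral_rep_mult_distinct:
  assumes \<rho>: "irreducible_rep \<rho>" "rep_dim \<rho> = n" and \<sigma>: "irreducible_rep \<sigma>" "rep_dim \<sigma> = m"
    and not_iso: "\<not> rep_iso \<sigma> \<rho>" and ij: "i < n" "j < n" "k < m" "l < m"
  shows "(LINT x|\<mu>. \<rho> (inverse x) $$ (i, j) * \<sigma> x $$ (k, l)) = 0"
proof -
  have rep: "representation \<rho>" "representation \<sigma>" using \<rho> \<sigma> by (auto simp: irreducible_rep_def)
  note \<rho>c = representation_facts(1)[OF rep(1) \<rho>(2)] and \<sigma>c = representation_facts(1)[OF rep(2) \<sigma>(2)]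
  define T where "T = mint n m (\<lambda>x. \<rho> (inverse x) * mat_unit n m j k * \<sigma> x)"
  have comm: "\<rho> x * T = T * \<sigma> x" for x
    unfolding T_def by (rule intertwiner_average[OF rep(1) \<rho>(2) rep(2) \<sigma>(2) mat_unit_carrier])
  have Tc: "T \<in> carrier_mat n m" by (simp add: T_def)
  have "T = 0\<^sub>m n m"
  proof (rule ccontr)
    assume "T \<noteq> 0\<^sub>m n m"
    then obtain Q where Q: "Q \<in> carrier_mat m n" "T * Q = 1\<^sub>m n" "Q * T = 1\<^sub>m m" "n = m"
      using Schur_lemma_inverse[OF \<rho> \<sigma> Tc _ comm] by blast
    have "invertible_mat T"
      using Q Tc by (auto simp: invertible_mat_def inverts_mat_def intro!: exI[of _ Q])
    then have "rep_iso \<sigma> \<rho>"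
      unfolding rep_iso_def using comm \<rho>(2) \<sigma>(2) Q(4) Tc by (auto intro!: bexI[of _ T])
    then show False using not_iso by simp
  qed
  then have "T $$ (i, l) = 0" using ij by simp
  then show ?thesis
    using ij by (simp add: T_def mint_def index_mat_unit_sandwich[OF \<rho>c \<sigma>c] del: index_mult_mat)
qed

text \<open>Schur's lemma makes the average a scalar matrix; the scalar follows from the trace,
  which is constant along the conjugates of B.\<close>

lemma average_irreducible:
  assumes \<rho>: "irreducible_rep \<rho>" "rep_dim \<rho> = n" and B: "B \<in> carrier_mat n n"
  shows "mint n n (\<lambda>x. \<rho> (inverse x) * B * \<rho> x) = (volume * mat_trace B / of_nat n) \<cdot>\<^sub>m 1\<^sub>m n"
proof -
  have rep: "representation \<rho>" using \<rho> by (auto simp: irreducible_rep_def)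
  have n: "n > 0" using \<rho> by (auto simp: irreducible_rep_def)
  note \<rho>c = representation_facts(1)[OF rep \<rho>(2)]
  define T where "T = mint n n (\<lambda>x. \<rho> (inverse x) * B * \<rho> x)"
  have comm: "\<rho> x * T = T * \<rho> x" for x
    unfolding T_def by (rule intertwiner_average[OF rep \<rho>(2) rep \<rho>(2) B])
  have cm: "cmat n n (\<lambda>x. \<rho> (inverse x) * B * \<rho> x)"
    by (intro cmat_mult[of n n _ n] cmat_const B cmat_rep[OF rep \<rho>(2)]
        cmat_comp[OF cmat_rep[OF rep \<rho>(2)]] continuous_intros)
  obtain c where c: "T = c \<cdot>\<^sub>m 1\<^sub>m n"
    using Schur_lemma_scalar[OF \<rho> _ comm] by (auto simp: T_def)
  have "mat_trace T = (LINT x|\<mu>. mat_trace (\<rho> (inverse x) * B * \<rho> x))"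
    unfolding T_def by (rule mat_trace_mint[OF cm])
  also have "\<dots> = (LINT x|\<mu>. mat_trace B)"
    using mat_trace_similar[OF B \<rho>c \<rho>c representation_inverse(2)[OF rep \<rho>(2)]] by simp
  also have "\<dots> = volume * mat_trace B" by (simp add: scaleR_conv_of_real)
  finally have "c * of_nat n = volume * mat_trace B" unfolding c mat_trace_scalar .
  then have "c = volume * mat_trace B / of_nat n" using n by (simp add: field_simps)
  then show ?thesis using c unfolding T_def by simp
qed

lemma mat_trace_unit: "j < n \<Longrightarrow> k < n \<Longrightarrow> mat_trace (mat_unit n n j k) = (if j = k then 1 else 0)"
  by (auto simp: mat_trace_def mat_unit_def sum.delta if_distrib cong: if_cong)

lemma integral_rep_mult_same:
  assumes \<rho>: "irreducible_rep \<rho>" "rep_dim \<rho> = n" and ij: "i < n" "j < n" "k < n" "l < n"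
  shows "(LINT x|\<mu>. \<rho> (inverse x) $$ (i, j) * \<rho> x $$ (k, l)) =
    (if i = l \<and> j = k then volume / of_nat n else 0)"
proof -
  have rep: "representation \<rho>" using \<rho> by (auto simp: irreducible_rep_def)
  note \<rho>c = representation_facts(1)[OF rep \<rho>(2)]
  have "(LINT x|\<mu>. \<rho> (inverse x) $$ (i, j) * \<rho> x $$ (k, l)) =
    mint n n (\<lambda>x. \<rho> (inverse x) * mat_unit n n j k * \<rho> x) $$ (i, l)"
    using ij by (simp add: mint_def index_mat_unit_sandwich[OF \<rho>c \<rho>c] del: index_mult_mat)
  also have "\<dots> = (if i = l \<and> j = k then volume / of_nat n else 0)"
    unfolding average_irreducible[OF \<rho> mat_unit_carrier] using ij by (simp add: mat_trace_unit)
  finally show ?thesis .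
qed

text \<open>The average commutes with \<open>\<rho> a\<close>: multiplying the square of
  \<open>inverse a * x\<close> by a on the left, and the square of \<open>x * inverse a\<close> by a
  on the right, gives the same element \<open>x * inverse a * x\<close>, and both substitutions
  preserve the integral. The scalar is then found by taking traces.\<close>

lemma integral_rep_square:
  assumes \<rho>: "irreducible_rep \<rho>" "rep_dim \<rho> = n"
  shows "mint n n (\<lambda>x. \<rho> (x * x)) = ((LINT x|\<mu>. mat_trace (\<rho> (x * x))) / of_nat n) \<cdot>\<^sub>m 1\<^sub>m n"
proof -
  have rep: "representation \<rho>" using \<rho> by (auto simp: irreducible_rep_def)
  have n: "n > 0" using \<rho> by (auto simp: irreducible_rep_def)
  note \<rho>c = representation_facts(1)[OF rep \<rho>(2)] and \<rho>m = representation_facts(3)[OF rep \<rho>(2)]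
  define T where "T = mint n n (\<lambda>x. \<rho> (x * x))"
  have cm: "cmat n n (\<lambda>x. \<rho> (x * x))"
    by (intro cmat_comp[OF cmat_rep[OF rep \<rho>(2)]] continuous_intros)
  have comm: "\<rho> a * T = T * \<rho> a" for a
  proof -
    have "\<rho> a * T = mint n n (\<lambda>x. \<rho> a * \<rho> (x * x))"
      unfolding T_def by (rule mint_mult_left[OF \<rho>c cm, symmetric])
    also have "\<dots> = mint n n (\<lambda>x. \<rho> (x * inverse a * (x * inverse a)) * \<rho> a)"
    proof -
      have cm': "cmat n n (\<lambda>x. \<rho> a * \<rho> (x * x))" "cmat n n (\<lambda>x. \<rho> a * \<rho> (inverse a * x * (inverse a * x)))"
        by (intro cmat_mult[of n n _ n] cmat_const \<rho>c cmat_comp[OF cmat_rep[OF rep \<rho>(2)]] continuous_intros)+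
      have "mint n n (\<lambda>x. \<rho> a * \<rho> (x * x)) = mint n n (\<lambda>x. \<rho> a * \<rho> (inverse a * x * (inverse a * x)))"
        using mint_left_translate[OF cm'(1), of "inverse a"] by simp
      also have "(\<lambda>x. \<rho> a * \<rho> (inverse a * x * (inverse a * x))) = (\<lambda>x. \<rho> (x * inverse a * (x * inverse a)) * \<rho> a)"
        by (simp add: \<rho>m[symmetric] group_simps)
      finally show ?thesis .
    qed
    also have "\<dots> = mint n n (\<lambda>x. \<rho> (x * inverse a * (x * inverse a))) * \<rho> a"
      by (intro mint_mult_right \<rho>c cmat_comp[OF cmat_rep[OF rep \<rho>(2)]] continuous_intros)
    also have "mint n n (\<lambda>x. \<rho> (x * inverse a * (x * inverse a))) = T"
      unfolding T_def using mint_right_translate[OF cm, of "inverse a"] by simp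
    finally show ?thesis .
  qed
  obtain c where c: "T = c \<cdot>\<^sub>m 1\<^sub>m n"
    using Schur_lemma_scalar[OF \<rho> _ comm] by (auto simp: T_def)
  have "c * of_nat n = (LINT x|\<mu>. mat_trace (\<rho> (x * x)))"
    using mat_trace_mint[OF cm] unfolding T_def[symmetric] c mat_trace_scalar .
  then have "c = (LINT x|\<mu>. mat_trace (\<rho> (x * x))) / of_nat n" using n by (simp add: field_simps)
  then show ?thesis using c unfolding T_def by simp
qed

text \<open>The trace of \<open>\<rho> (x * x)\<close> is the sum of these products of entries over
  i and j, so its integral becomes a sum of entries of averaged bilinear forms.\<close>

lemma matrix_unit_form_entries:
  assumes \<rho>: "representation \<rho>" "rep_dim \<rho> = n" and "i < n" "j < n"
  shows "mint n n (\<lambda>x. (\<rho> x)\<^sup>T * mat_unit n n i j * \<rho> x) $$ (j, i) = (LINT x|\<mu>. \<rho> x $$ (i, j) * \<rho> x $$ (j, i))"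
proof -
  note \<rho>c = representation_facts(1)[OF \<rho>]
  have tc: "(\<rho> x)\<^sup>T \<in> carrier_mat n n" for x using \<rho>c by simp
  have "(\<rho> x)\<^sup>T $$ (j, i) = \<rho> x $$ (i, j)" for x using carrier_matD[OF \<rho>c] assms by simp
  then show ?thesis
    using assms by (simp add: mint_def index_mat_unit_sandwich[OF tc \<rho>c] del: index_mult_mat)
qed

text \<open>\<open>T B\<close> is the average over the group of the bilinear form with matrix B,
  hence an invariant form. By irreducibility all invariant forms are multiples of one form J, if
  there is a nonzero one. The transpose of J is again invariant, so it is c * J with c^2 = 1, and
  this c turns out to be the indicator: 1 for symmetric J, -1 for alternating J, while 0 means that
  all averages vanish.\<close>

theorem Frobenius_Schur:
  assumes \<rho>: "irreducible_rep \<rho>" "rep_dim \<rho> = n"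
  shows "(LINT x|\<mu>. mat_trace (\<rho> (x * x))) / volume \<in> {0, 1, -1}"
proof -
  have rep: "representation \<rho>" using \<rho> by (auto simp: irreducible_rep_def)
  have n: "n > 0" using \<rho> by (auto simp: irreducible_rep_def)
  note \<rho>c [simp] = representation_facts(1)[OF rep \<rho>(2)] and \<rho>m = representation_facts(3)[OF rep \<rho>(2)]
  note \<rho>inv = representation_inverse[OF rep \<rho>(2)]
  have tc [simp]: "(\<rho> x)\<^sup>T \<in> carrier_mat n n" for x by simp
  note assoc = assoc_mult_mat[of _ n n _ n _ n]
  note mc [simp] = mult_carrier_mat[of _ n n _ n]
  note one [simp] = left_mult_one_mat[of _ n n] right_mult_one_mat[of _ n n]
  define T where "T B = mint n n (\<lambda>x. (\<rho> x)\<^sup>T * B * \<rho> x)" for B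
  have Tc [simp]: "T B \<in> carrier_mat n n" for B by (simp add: T_def)
  have cmT: "cmat n n (\<lambda>x. (\<rho> x)\<^sup>T * B * \<rho> x)" if "B \<in> carrier_mat n n" for B
    by (intro cmat_mult[of n n _ n] cmat_const that cmat_transpose cmat_rep[OF rep \<rho>(2)])
  have T_inv: "(\<rho> a)\<^sup>T * T B * \<rho> a = T B" if B: "B \<in> carrier_mat n n" for a B
  proof -
    have "T B = mint n n (\<lambda>x. (\<rho> (x * a))\<^sup>T * B * \<rho> (x * a))"
      unfolding T_def using mint_right_translate[OF cmT[OF B], of a] by simp
    also have "(\<lambda>x. (\<rho> (x * a))\<^sup>T * B * \<rho> (x * a)) = (\<lambda>x. (\<rho> a)\<^sup>T * ((\<rho> x)\<^sup>T * B * \<rho> x * \<rho> a))"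
      using B by (intro ext) (simp add: \<rho>m transpose_mult[of _ n n _ n] assoc)
    also have "mint n n \<dots> = (\<rho> a)\<^sup>T * (T B * \<rho> a)"
      unfolding T_def using mint_mult_left[OF tc cmat_mult[OF cmT[OF B] cmat_const[OF \<rho>c]]]
        mint_mult_right[OF \<rho>c cmT[OF B]] by simp
    finally show ?thesis by (simp add: assoc)
  qed
  have trace_eq: "(LINT x|\<mu>. mat_trace (\<rho> (x * x))) = (\<Sum>i<n. \<Sum>j<n. T (mat_unit n n i j) $$ (j, i))"
  proof -
    have c: "continuous_on UNIV (\<lambda>x. \<rho> x $$ (i, j))" if "i < n" "j < n" for i j
      by (rule representation_facts(4)[OF rep \<rho>(2) that])
    have "(LINT x|\<mu>. mat_trace (\<rho> (x * x))) = (LINT x|\<mu>. (\<Sum>i<n. \<Sum>j<n. \<rho> x $$ (i, j) * \<rho> x $$ (j, i)))"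
      unfolding \<rho>m mat_trace_def carrier_matD(1)[OF mc[OF \<rho>c \<rho>c]]
      by (simp add: index_mult_mat_sum[OF \<rho>c \<rho>c] del: index_mult_mat)
    also have "\<dots> = (\<Sum>i<n. \<Sum>j<n. LINT x|\<mu>. \<rho> x $$ (i, j) * \<rho> x $$ (j, i))"
      using c by (subst Bochner_Integration.integral_sum)
        (auto intro!: Bochner_Integration.integrable_sum integrable_continuous finite_borel_haar continuous_intros
          sum.cong Bochner_Integration.integral_sum)
    also have "\<dots> = (\<Sum>i<n. \<Sum>j<n. T (mat_unit n n i j) $$ (j, i))"
      by (intro sum.cong refl) (simp add: T_def matrix_unit_form_entries[OF rep \<rho>(2)])
    finally show ?thesis .
  qed
  show ?thesis
  proof (cases "\<forall>i<n. \<forall>j<n. T (mat_unit n n i j) = 0\<^sub>m n n")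
    case True
    then show ?thesis unfolding trace_eq by simp
  next
    case False
    then obtain B0 where B0: "B0 \<in> carrier_mat n n" "T B0 \<noteq> 0\<^sub>m n n" by (metis mat_unit_carrier)
    define J where "J = T B0"
    have J [simp]: "J \<in> carrier_mat n n" and J0: "J \<noteq> 0\<^sub>m n n" using B0 by (simp_all add: J_def)
    \<comment> \<open>Invariance of a bilinear form says that its matrix intertwines \<rho> with the
      dual representation, the transpose of \<open>\<rho> (inverse a)\<close>.\<close>
    have move: "P * \<rho> a = (\<rho> (inverse a))\<^sup>T * P" if P: "P \<in> carrier_mat n n" and inv: "\<And>a. (\<rho> a)\<^sup>T * P * \<rho> a = P" for P a
    proof -
      have "(\<rho> (inverse a))\<^sup>T * P = (\<rho> (inverse a))\<^sup>T * ((\<rho> a)\<^sup>T * (P * \<rho> a))"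
        using inv[of a] P by (simp add: assoc)
      also have "\<dots> = ((\<rho> (inverse a))\<^sup>T * (\<rho> a)\<^sup>T) * (P * \<rho> a)" using P by (simp add: assoc)
      also have "(\<rho> (inverse a))\<^sup>T * (\<rho> a)\<^sup>T = 1\<^sub>m n"
        using \<rho>inv(2)[of a] transpose_mult[OF \<rho>c \<rho>c, of a "inverse a"] by simp
      finally show ?thesis using P by simp
    qed
    have J_inv: "(\<rho> a)\<^sup>T * J * \<rho> a = J" for a unfolding J_def by (rule T_inv[OF B0(1)])
    note J_move = move[OF J J_inv]
    have "v = 0\<^sub>v n" if "v \<in> carrier_vec n" "J *\<^sub>v v = 0\<^sub>v n" for v
      using irreducible_kernel_trivial[OF \<rho> J J0 _ that] J_move tc by metis
    then have "det J \<noteq> 0" unfolding det_0_iff_vec_prod_zero[OF J] by blast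
    from det_non_zero_imp_unit[OF J this, unfolded Units_def, of "()"]
    obtain K where K [simp]: "K \<in> carrier_mat n n" and KJ: "K * J = 1\<^sub>m n" and JK: "J * K = 1\<^sub>m n"
      by (auto simp: ring_mat_def)
    have K_move: "\<rho> a * K = K * (\<rho> (inverse a))\<^sup>T" for a
    proof -
      have "\<rho> a * K = (K * J) * (\<rho> a * K)" unfolding KJ by simp
      also have "\<dots> = K * ((J * \<rho> a) * K)" by (simp add: assoc)
      also have "\<dots> = K * ((\<rho> (inverse a))\<^sup>T * (J * K))" unfolding J_move by (simp add: assoc)
      also have "\<dots> = K * (\<rho> (inverse a))\<^sup>T" unfolding JK by simp
      finally show ?thesis .
    qed
    have Jt [simp]: "J\<^sup>T \<in> carrier_mat n n" by simp
    have Jt_inv: "(\<rho> a)\<^sup>T * J\<^sup>T * \<rho> a = J\<^sup>T" for a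
    proof -
      have "J\<^sup>T = ((\<rho> a)\<^sup>T * J * \<rho> a)\<^sup>T" using J_inv by simp
      also have "\<dots> = (\<rho> a)\<^sup>T * (J\<^sup>T * \<rho> a)"
        by (simp add: transpose_mult[of _ n n _ n])
      finally show ?thesis by (simp add: assoc)
    qed
    \<comment> \<open>\<open>J\<^sup>T\<close> leads from \<rho> to its dual and K leads back, so
      the product commutes with \<rho> and is a scalar.\<close>
    have "\<rho> a * (K * J\<^sup>T) = (K * J\<^sup>T) * \<rho> a" for a
    proof -
      have "\<rho> a * (K * J\<^sup>T) = (\<rho> a * K) * J\<^sup>T" by (simp add: assoc)
      also have "\<dots> = K * ((\<rho> (inverse a))\<^sup>T * J\<^sup>T)" unfolding K_move by (simp add: assoc)
      also have "\<dots> = K * (J\<^sup>T * \<rho> a)" unfolding move[OF Jt Jt_inv] ..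
      finally show ?thesis by (simp add: assoc)
    qed
    then obtain c where c: "K * J\<^sup>T = c \<cdot>\<^sub>m 1\<^sub>m n"
      using Schur_lemma_scalar[OF \<rho>, of "K * J\<^sup>T"] by (metis mc K Jt)
    have JT: "J\<^sup>T = c \<cdot>\<^sub>m J"
    proof -
      have "J\<^sup>T = (J * K) * J\<^sup>T" unfolding JK by simp
      also have "\<dots> = J * (c \<cdot>\<^sub>m 1\<^sub>m n)" unfolding c[symmetric] by (simp add: assoc)
      also have "\<dots> = c \<cdot>\<^sub>m J" using mult_smult_distrib[OF J, of "1\<^sub>m n" n c] by simp
      finally show ?thesis .
    qed
    have swap: "J $$ (j, i) = c * J $$ (i, j)" if "i < n" "j < n" for i j
    proof -
      have "J $$ (j, i) = J\<^sup>T $$ (i, j)" using that carrier_matD[OF J] by simp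
      also have "\<dots> = c * J $$ (i, j)" unfolding JT using that carrier_matD[OF J] by simp
      finally show ?thesis .
    qed
    have "c * c = 1"
    proof -
      have "\<exists>i<n. \<exists>j<n. J $$ (i, j) \<noteq> 0"
      proof (rule ccontr)
        assume "\<not> (\<exists>i<n. \<exists>j<n. J $$ (i, j) \<noteq> 0)"
        then have "J = 0\<^sub>m n n" using carrier_matD[OF J] by (intro eq_matI) auto
        then show False using J0 by simp
      qed
      then obtain i j where "i < n" "j < n" "J $$ (i, j) \<noteq> 0" by blast
      moreover from this have "(c * c) * J $$ (i, j) = J $$ (i, j)"
        using swap[of i j] swap[of j i] by (metis mult.assoc)
      ultimately show ?thesis by simp
    qed
    then have c1: "c = 1 \<or> c = -1" by (simp add: square_eq_1_iff)
    \<comment> \<open>Multiplication by J converts conjugation of \<open>K * B\<close> into the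
      action on the form B. Averages of forms thereby reduce to the averages of conjugates that are
      already computed.\<close>
    have TB: "T B = J * ((volume * mat_trace (K * B) / of_nat n) \<cdot>\<^sub>m 1\<^sub>m n)" if B [simp]: "B \<in> carrier_mat n n" for B
    proof -
      have "(\<rho> x)\<^sup>T * B * \<rho> x = J * (\<rho> (inverse x) * (K * B) * \<rho> x)" for x
      proof -
        have "J * (\<rho> (inverse x) * (K * B) * \<rho> x) = (J * (\<rho> (inverse x) * K)) * (B * \<rho> x)"
          by (simp add: assoc)
        also have "J * (\<rho> (inverse x) * K) = J * K * (\<rho> x)\<^sup>T"
          unfolding K_move by (simp add: assoc group_simps)
        finally show ?thesis unfolding JK by (simp add: assoc)
      qed
      then have "T B = mint n n (\<lambda>x. J * (\<rho> (inverse x) * (K * B) * \<rho> x))" by (simp add: T_def)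
      also have "\<dots> = J * mint n n (\<lambda>x. \<rho> (inverse x) * (K * B) * \<rho> x)"
        by (intro mint_mult_left J cmat_mult[of n n _ n] cmat_const cmat_rep[OF rep \<rho>(2)] mc K B
            cmat_comp[OF cmat_rep[OF rep \<rho>(2)]] continuous_intros)
      finally show ?thesis unfolding average_irreducible[OF \<rho> mc[OF K B]] .
    qed
    have entry: "T (mat_unit n n i j) $$ (j, i) = volume / of_nat n * c * (J $$ (i, j) * K $$ (j, i))"
      if ij: "i < n" "j < n" for i j
    proof -
      have tr: "mat_trace (K * mat_unit n n i j) = K $$ (j, i)"
      proof -
        have "mat_trace (K * mat_unit n n i j) = (\<Sum>a<n. (K * mat_unit n n i j * 1\<^sub>m n) $$ (a, a))"
          by (simp add: mat_trace_def carrier_matD(1)[OF K] right_mult_one_mat[OF mc[OF K mat_unit_carrier]] del: index_mult_mat(1))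
        also have "\<dots> = (\<Sum>a<n. if a = j then K $$ (a, i) else 0)"
        proof (intro sum.cong refl)
          fix a assume "a \<in> {..<n}"
          then have a: "a < n" by simp
          show "(K * mat_unit n n i j * 1\<^sub>m n) $$ (a, a) = (if a = j then K $$ (a, i) else 0)"
            unfolding index_mat_unit_sandwich[OF K one_carrier_mat a a ij] using a ij by simp
        qed
        finally show ?thesis using ij by simp
      qed
      let ?s = "volume * mat_trace (K * mat_unit n n i j) / of_nat n"
      have "J * (?s \<cdot>\<^sub>m 1\<^sub>m n) = ?s \<cdot>\<^sub>m J" using mult_smult_distrib[OF J, of "1\<^sub>m n" n ?s] by simp
      then have "T (mat_unit n n i j) $$ (j, i) = ?s * J $$ (j, i)"
        using TB[OF mat_unit_carrier] ij carrier_matD[OF J] by simp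
      then show ?thesis unfolding tr swap[OF ij] by simp
    qed
    \<comment> \<open>The double sum is the trace of \<open>J * K\<close>, which is n; it cancels
      the denominator, and the volume times c is left.\<close>
    have "(LINT x|\<mu>. mat_trace (\<rho> (x * x))) = volume / of_nat n * c * (\<Sum>i<n. \<Sum>j<n. J $$ (i, j) * K $$ (j, i))"
      unfolding trace_eq sum_distrib_left by (intro sum.cong refl) (simp add: entry)
    also have "(\<Sum>i<n. \<Sum>j<n. J $$ (i, j) * K $$ (j, i)) = mat_trace (J * K)"
      by (simp add: mat_trace_def carrier_matD(1)[OF J] index_mult_mat_sum[OF J K] del: index_mult_mat(1))
    also have "\<dots> = of_nat n" unfolding JK by (simp add: mat_trace_def)
    finally have "(LINT x|\<mu>. mat_trace (\<rho> (x * x))) / volume = c" using n volume_pos by simp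
    then show ?thesis using c1 by auto
  qed
qed

text \<open>Entries of \<rho> are bounded on the compact group, while an eigenvalue of modulus
  greater than 1 would make the powers \<open>\<rho> (x ^ k)\<close> unbounded. So all n eigenvalues
  lie in the closed unit disc, and the trace is their sum.\<close>

lemma character_bound:
  fixes \<rho> :: "'a \<Rightarrow> complex mat"
  assumes \<rho>: "representation \<rho>" "rep_dim \<rho> = n"
  shows "cmod (mat_trace (\<rho> x)) \<le> real n"
proof -
  note \<rho>c = representation_facts(1)[OF \<rho>] and \<rho>m = representation_facts(3)[OF \<rho>]
  have "\<exists>B. \<forall>x. cmod (\<rho> x $$ (i, j)) \<le> B" if "i < n" "j < n" for i j
    using continuous_bounded[OF representation_facts(4)[OF \<rho> that]] by blast
  then obtain b where b: "\<And>i j x. i < n \<Longrightarrow> j < n \<Longrightarrow> cmod (\<rho> x $$ (i, j)) \<le> b i j"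
    by metis
  have eigen_le: "cmod e \<le> 1" if e: "eigenvalue (\<rho> x) e" for e
  proof -
    obtain v where v: "v \<in> carrier_vec n" "v \<noteq> 0\<^sub>v n" "\<rho> x *\<^sub>v v = e \<cdot>\<^sub>v v"
      using e carrier_matD[OF \<rho>c] by (auto simp: eigenvalue_def eigenvector_def)
    have pow: "\<rho> (x ^ k) *\<^sub>v v = e ^ k \<cdot>\<^sub>v v" for k
    proof (induction k)
      case 0
      then show ?case using v(1) representation_facts(2)[OF \<rho>] by simp
    next
      case (Suc k)
      have "\<rho> (x ^ Suc k) *\<^sub>v v = \<rho> x *\<^sub>v (\<rho> (x ^ k) *\<^sub>v v)"
        using assoc_mult_mat_vec[OF \<rho>c \<rho>c v(1)] by (simp add: \<rho>m)
      also have "\<dots> = e ^ k \<cdot>\<^sub>v (e \<cdot>\<^sub>v v)" unfolding Suc v(3)[symmetric] by (rule mult_mat_vec[OF \<rho>c v(1)])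
      finally show ?case by (simp add: smult_smult_assoc mult.commute)
    qed
    obtain i where i: "i < n" "v $ i \<noteq> 0"
      using v(1,2) by (metis carrier_vecD eq_vecI index_zero_vec)
    define C where "C = (\<Sum>k<n. b i k * cmod (v $ k))"
    have bound: "cmod e ^ k * cmod (v $ i) \<le> C" for k
    proof -
      have "cmod e ^ k * cmod (v $ i) = cmod ((\<rho> (x ^ k) *\<^sub>v v) $ i)"
        unfolding pow using i v(1) by (simp add: norm_mult norm_power)
      also have "\<dots> \<le> (\<Sum>l<n. cmod (\<rho> (x ^ k) $$ (i, l) * v $ l))"
        unfolding index_mult_mat_vec_sum[OF \<rho>c v(1) i(1)] by (rule norm_sum)
      also have "\<dots> \<le> C"
        unfolding C_def using b i by (intro sum_mono) (auto simp: norm_mult intro!: mult_right_mono)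
      finally show ?thesis .
    qed
    show ?thesis
    proof (rule ccontr)
      assume "\<not> cmod e \<le> 1"
      then obtain k where "C / cmod (v $ i) < cmod e ^ k" using real_arch_pow[of "cmod e"] by auto
      then show False using bound[of k] i by (simp add: field_simps not_less[symmetric])
    qed
  qed
  \<comment> \<open>Triangularisation puts the eigenvalues, with multiplicity, on the diagonal
    without changing the trace.\<close>
  obtain as where as: "char_poly (\<rho> x) = (\<Prod>a\<leftarrow>as. [:- a, 1:])"
    using char_poly_factorized[OF \<rho>c] by blast
  obtain B where B: "B \<in> carrier_mat n n" "upper_triangular B" "similar_mat (\<rho> x) B"
    using schur_decomposition_exists[OF \<rho>c as] by blast
  obtain P Q where PQ: "P \<in> carrier_mat n n" "Q \<in> carrier_mat n n" "Q * P = 1\<^sub>m n" "\<rho> x = P * B * Q"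
    using B(3) carrier_matD[OF \<rho>c] unfolding similar_mat_def similar_mat_wit_def Let_def by auto
  have "mat_trace (\<rho> x) = mat_trace B"
    unfolding PQ(4) by (rule mat_trace_similar[OF B(1) PQ(1-3)])
  also have "cmod \<dots> \<le> (\<Sum>i<n. cmod (B $$ (i, i)))"
    using carrier_matD[OF B(1)] unfolding mat_trace_def by (simp add: norm_sum)
  also have "\<dots> \<le> (\<Sum>i<n. 1)"
  proof (rule sum_mono)
    fix i assume "i \<in> {..<n}"
    then have "B $$ (i, i) \<in> set (diag_mat B)" using carrier_matD[OF B(1)] by (auto simp: diag_mat_def)
    then have "poly (char_poly B) (B $$ (i, i)) = 0"
      unfolding char_poly_upper_triangular[OF B(1,2)] by (auto simp: poly_prod_list prod_list_zero_iff)
    then have "eigenvalue (\<rho> x) (B $$ (i, i))"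
      unfolding eigenvalue_root_char_poly[OF \<rho>c] char_poly_similar[OF B(3)] .
    then show "cmod (B $$ (i, i)) \<le> 1" by (rule eigen_le)
  qed
  finally show ?thesis by simp
qed

end

section \<open>The Fourier series of the volume distribution\<close>

lemma rep_isoE:
  assumes "rep_iso \<rho> \<sigma>" "rep_dim \<rho> = n"
  obtains P Q where "P \<in> carrier_mat n n" "Q \<in> carrier_mat n n" "P * Q = 1\<^sub>m n" "Q * P = 1\<^sub>m n"
    "rep_dim \<sigma> = n" "\<And>x. P * \<rho> x = \<sigma> x * P"
proof -
  obtain P where P: "P \<in> carrier_mat n n" "invertible_mat P" "\<And>x. P * \<rho> x = \<sigma> x * P"
    and dim: "rep_dim \<sigma> = n"
    using assms unfolding rep_iso_def by auto
  obtain Q where Q: "P * Q = 1\<^sub>m (dim_row P)" "Q * P = 1\<^sub>m (dim_row Q)"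
    using P(2) unfolding invertible_mat_def inverts_mat_def by auto
  \<comment> \<open>The size of the inverse is recovered by counting the columns of the two identity
    matrices.\<close>
  have "dim_col Q = n" using arg_cong[OF Q(1), of dim_col] P(1) by simp
  moreover have "dim_row Q = n" using arg_cong[OF Q(2), of dim_col] P(1) by simp
  ultimately have "Q \<in> carrier_mat n n" by auto
  then show thesis using that[of P Q] P Q dim by auto
qed

lemma rep_isoI:
  assumes "rep_dim \<rho> = n" "rep_dim \<sigma> = n" "P \<in> carrier_mat n n" "Q \<in> carrier_mat n n"
    "P * Q = 1\<^sub>m n" "Q * P = 1\<^sub>m n" "\<And>x. P * \<rho> x = \<sigma> x * P"
  shows "rep_iso \<rho> \<sigma>"
proof -
  have "invertible_mat P"
    using assms(3-6) by (auto simp: invertible_mat_def inverts_mat_def intro!: exI[of _ Q])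
  then show ?thesis using assms unfolding rep_iso_def by auto
qed

lemma rep_iso_refl: "representation \<rho> \<Longrightarrow> rep_iso \<rho> \<rho>"
  using representation_facts(1)[of \<rho> "rep_dim \<rho>", THEN left_mult_one_mat]
    representation_facts(1)[of \<rho> "rep_dim \<rho>", THEN right_mult_one_mat]
  by (intro rep_isoI[of _ "rep_dim \<rho>" _ "1\<^sub>m (rep_dim \<rho>)" "1\<^sub>m (rep_dim \<rho>)"]) simp_all

lemma rep_iso_sym:
  assumes iso: "rep_iso \<rho> \<sigma>" and rep: "representation \<rho>" "representation \<sigma>"
  shows "rep_iso \<sigma> \<rho>"
proof -
  define n where "n = rep_dim \<rho>"
  obtain P Q where PQ: "P \<in> carrier_mat n n" "Q \<in> carrier_mat n n" "P * Q = 1\<^sub>m n" "Q * P = 1\<^sub>m n"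
    and dim: "rep_dim \<sigma> = n" and c: "\<And>x. P * \<rho> x = \<sigma> x * P"
    using rep_isoE[OF iso n_def[symmetric]] by metis
  note \<rho>c = representation_facts(1)[OF rep(1) n_def[symmetric]] and \<sigma>c = representation_facts(1)[OF rep(2) dim]
  note assoc = assoc_mult_mat[of _ n n _ n _ n] and one = left_mult_one_mat[of _ n n] right_mult_one_mat[of _ n n]
  note mc = mult_carrier_mat[of _ n n _ n]
  have "Q * \<sigma> x = \<rho> x * Q" for x
  proof -
    have "Q * \<sigma> x = Q * (\<sigma> x * (P * Q))" using PQ \<sigma>c by (simp add: one)
    also have "\<dots> = Q * ((\<sigma> x * P) * Q)" using PQ \<sigma>c by (simp add: assoc)
    also have "\<dots> = (Q * P) * (\<rho> x * Q)" unfolding c[symmetric] using PQ(1,2) \<rho>c by (simp add: assoc mc)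
    also have "\<dots> = \<rho> x * Q" using PQ \<rho>c by (simp add: one mc)
    finally show ?thesis .
  qed
  then show ?thesis using PQ dim n_def by (intro rep_isoI[of _ n _ Q P]) auto
qed

lemma rep_iso_trans:
  assumes iso: "rep_iso \<rho> \<sigma>" "rep_iso \<sigma> \<tau>"
    and rep: "representation \<rho>" "representation \<sigma>" "representation \<tau>"
  shows "rep_iso \<rho> \<tau>"
proof -
  define n where "n = rep_dim \<rho>"
  obtain P Q where PQ: "P \<in> carrier_mat n n" "Q \<in> carrier_mat n n" "P * Q = 1\<^sub>m n" "Q * P = 1\<^sub>m n"
    and dim: "rep_dim \<sigma> = n" and c: "\<And>x. P * \<rho> x = \<sigma> x * P"
    using rep_isoE[OF iso(1) n_def[symmetric]] by metis
  obtain R S where RS: "R \<in> carrier_mat n n" "S \<in> carrier_mat n n" "R * S = 1\<^sub>m n" "S * R = 1\<^sub>m n"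
    and dim': "rep_dim \<tau> = n" and c': "\<And>x. R * \<sigma> x = \<tau> x * R"
    using rep_isoE[OF iso(2) dim] by metis
  note \<rho>c = representation_facts(1)[OF rep(1) n_def[symmetric]]
    and \<sigma>c = representation_facts(1)[OF rep(2) dim] and \<tau>c = representation_facts(1)[OF rep(3) dim']
  note assoc = assoc_mult_mat[of _ n n _ n _ n] and one = left_mult_one_mat[of _ n n] right_mult_one_mat[of _ n n]
  note mc = mult_carrier_mat[of _ n n _ n]
  have "(R * P) * (Q * S) = R * ((P * Q) * S)" using PQ(1,2) RS(1,2) by (simp add: assoc mc)
  then have 1: "(R * P) * (Q * S) = 1\<^sub>m n" using PQ RS by (simp add: one)
  have "(Q * S) * (R * P) = Q * ((S * R) * P)" using PQ(1,2) RS(1,2) by (simp add: assoc mc)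
  then have 2: "(Q * S) * (R * P) = 1\<^sub>m n" using PQ RS by (simp add: one)
  have "(R * P) * \<rho> x = \<tau> x * (R * P)" for x
  proof -
    have "(R * P) * \<rho> x = R * (\<sigma> x * P)" unfolding c[symmetric] using PQ RS \<rho>c by (simp add: assoc)
    also have "\<dots> = (R * \<sigma> x) * P" using PQ RS \<sigma>c by (simp add: assoc)
    also have "\<dots> = \<tau> x * (R * P)" unfolding c' using PQ RS \<tau>c by (simp add: assoc)
    finally show ?thesis .
  qed
  then show ?thesis
    using 1 2 PQ RS dim' n_def mc by (intro rep_isoI[of _ n _ "R * P" "Q * S"]) auto
qed

lemma rep_iso_trace:
  assumes iso: "rep_iso \<rho> \<sigma>" and rep: "representation \<rho>" "representation \<sigma>"
  shows "mat_trace (\<rho> x) = mat_trace (\<sigma> x)"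
proof -
  define n where "n = rep_dim \<rho>"
  obtain P Q where PQ: "P \<in> carrier_mat n n" "Q \<in> carrier_mat n n" "P * Q = 1\<^sub>m n" "Q * P = 1\<^sub>m n"
    and dim: "rep_dim \<sigma> = n" and c: "\<And>x. P * \<rho> x = \<sigma> x * P"
    using rep_isoE[OF iso n_def[symmetric]] by metis
  note \<rho>c = representation_facts(1)[OF rep(1) n_def[symmetric]] and \<sigma>c = representation_facts(1)[OF rep(2) dim]
  have "P * \<rho> x * Q = \<sigma> x * (P * Q)"
    unfolding c using PQ \<sigma>c by (intro assoc_mult_mat[of _ n n _ n _ n])
  also have "\<dots> = \<sigma> x" using PQ(3) right_mult_one_mat[OF \<sigma>c] by simp
  finally show ?thesis using mat_trace_similar[OF \<rho>c PQ(1,2,4)] by metis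
qed

definition rep_class :: "('a::{group_mult, topological_space} \<Rightarrow> complex mat) \<Rightarrow> ('a \<Rightarrow> complex mat) set" where
  "rep_class \<rho> = {\<sigma>. irreducible_rep \<sigma> \<and> rep_iso \<rho> \<sigma>}"

lemma irrep_classesE:
  assumes "\<Lambda> \<in> irrep_classes"
  obtains \<rho> where "irreducible_rep \<rho>" "\<Lambda> = rep_class \<rho>"
  using assms unfolding irrep_classes_def quotient_def rep_class_def by auto

lemma rep_class_in: "irreducible_rep \<rho> \<Longrightarrow> rep_class \<rho> \<in> irrep_classes"
  unfolding irrep_classes_def quotient_def rep_class_def by auto

lemma rep_class_eq:
  fixes \<rho> \<sigma> :: "'a::{group_mult, topological_space} \<Rightarrow> complex mat"
  assumes "irreducible_rep \<rho>" "irreducible_rep \<sigma>" "rep_iso \<rho> \<sigma>"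
  shows "rep_class \<rho> = rep_class \<sigma>"
proof -
  have rep: "representation \<tau>" if "irreducible_rep \<tau>" for \<tau> :: "'a \<Rightarrow> complex mat"
    using that by (simp add: irreducible_rep_def)
  have "rep_iso \<rho> \<tau> \<longleftrightarrow> rep_iso \<sigma> \<tau>" if \<tau>: "irreducible_rep \<tau>" for \<tau>
    using rep_iso_trans[OF assms(3) _ assms(1,2)[THEN rep] rep[OF \<tau>]]
      rep_iso_trans[OF rep_iso_sym[OF assms(3) assms(1,2)[THEN rep]] _ assms(2,1)[THEN rep] rep[OF \<tau>]]
    by blast
  then show ?thesis unfolding rep_class_def by blast
qed

lemma
  assumes \<rho>: "irreducible_rep \<rho>"
  shows class_dim_rep_class: "class_dim (rep_class \<rho>) = rep_dim \<rho>"
    and character_rep_class: "character (rep_class \<rho>) x = mat_trace (\<rho> x)"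
proof -
  have rep: "representation \<tau>" if "irreducible_rep \<tau>" for \<tau> :: "'a \<Rightarrow> complex mat"
    using that by (simp add: irreducible_rep_def)
  have self: "\<rho> \<in> rep_class \<rho>" using \<rho> rep rep_iso_refl by (auto simp: rep_class_def)
  have "rep_dim ` rep_class \<rho> = {rep_dim \<rho>}"
    using self by (auto simp: rep_class_def rep_iso_def)
  then show "class_dim (rep_class \<rho>) = rep_dim \<rho>" by (simp add: class_dim_def)
  have tr: "(\<Sum>i<rep_dim \<sigma>. \<sigma> x $$ (i, i)) = mat_trace (\<sigma> x)" if "irreducible_rep \<sigma>" for \<sigma> :: "'a \<Rightarrow> complex mat"
    using carrier_matD(1)[OF representation_facts(1)[OF rep[OF that] refl, of x]] by (simp add: mat_trace_def)
  have "(\<lambda>\<sigma>. \<Sum>i<rep_dim \<sigma>. \<sigma> x $$ (i, i)) ` rep_class \<rho> = {mat_trace (\<rho> x)}"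
  proof -
    have "(\<Sum>i<rep_dim \<sigma>. \<sigma> x $$ (i, i)) = mat_trace (\<rho> x)" if "\<sigma> \<in> rep_class \<rho>" for \<sigma>
    proof -
      have \<sigma>: "irreducible_rep \<sigma>" "rep_iso \<rho> \<sigma>" using that by (auto simp: rep_class_def)
      show ?thesis unfolding tr[OF \<sigma>(1)] using rep_iso_trace[OF \<sigma>(2) rep[OF \<rho>] rep[OF \<sigma>(1)]] by simp
    qed
    then show ?thesis using self by (auto intro!: image_eqI[of _ _ \<rho>])
  qed
  then show "character (rep_class \<rho>) x = mat_trace (\<rho> x)" by (simp add: character_def)
qed

lemma presentation_map_Suc:
  "presentation_map (Suc k) x = presentation_map k x * (x k * x k)"
  by (simp add: presentation_map_def power2_eq_square)

lemma presentation_map_cong: "(\<And>i. i < k \<Longrightarrow> x i = y i) \<Longrightarrow> presentation_map k x = presentation_map k y"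
  unfolding presentation_map_def by (rule arg_cong[of _ _ prod_list]) simp

section \<open>Characters and the Fourier coefficients of the density\<close>

context haar_group
begin

lemma fs_indicator_rep_class:
  "irreducible_rep \<rho> \<Longrightarrow> fs_indicator \<mu> (rep_class \<rho>) = (LINT x|\<mu>. mat_trace (\<rho> (x * x))) / volume"
  by (simp add: fs_indicator_def character_rep_class power2_eq_square)

text \<open>The inverse argument takes the place of complex conjugation, so the orthogonality of
  entries applies to representations that need not be unitary. Expanding the character as a sum of
  diagonal entries leaves only the term of the index i.\<close>

lemma integral_character_rep:
  assumes \<rho>: "irreducible_rep \<rho>" "rep_dim \<rho> = n" and \<Lambda>: "\<Lambda> \<in> irrep_classes" and ij: "i < n" "j < n"
  shows "(LINT z|\<mu>. character \<Lambda> z * \<rho> (inverse z) $$ (i, j)) =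
    (if \<Lambda> = rep_class \<rho> \<and> i = j then volume / of_nat n else 0)"
proof -
  obtain \<sigma> where \<sigma>: "irreducible_rep \<sigma>" "\<Lambda> = rep_class \<sigma>" using irrep_classesE[OF \<Lambda>] by blast
  define m where "m = rep_dim \<sigma>"
  have rep: "representation \<rho>" "representation \<sigma>" using \<rho> \<sigma> by (auto simp: irreducible_rep_def)
  have sum: "(LINT z|\<mu>. mat_trace (\<sigma> z) * \<rho> (inverse z) $$ (i, j)) =
      (\<Sum>l<m. LINT z|\<mu>. \<rho> (inverse z) $$ (i, j) * \<sigma> z $$ (l, l))"
    if \<sigma>: "representation \<sigma>" "rep_dim \<sigma> = m" for \<sigma> :: "'a \<Rightarrow> complex mat" and m
  proof -
    have "(LINT z|\<mu>. mat_trace (\<sigma> z) * \<rho> (inverse z) $$ (i, j)) =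
        (LINT z|\<mu>. (\<Sum>l<m. \<rho> (inverse z) $$ (i, j) * \<sigma> z $$ (l, l)))"
      by (simp add: mat_trace_def carrier_matD(1)[OF representation_facts(1)[OF \<sigma>]] sum_distrib_left mult.commute)
    also have "\<dots> = (\<Sum>l<m. LINT z|\<mu>. \<rho> (inverse z) $$ (i, j) * \<sigma> z $$ (l, l))"
      by (intro Bochner_Integration.integral_sum integrable_continuous finite_borel_haar continuous_intros
          continuous_comp_UNIV[OF representation_facts(4)[OF rep(1) \<rho>(2) ij]] representation_facts(4)[OF \<sigma>]) auto
    finally show ?thesis .
  qed
  show ?thesis
  proof (cases "\<Lambda> = rep_class \<rho>")
    case True
    have "(LINT z|\<mu>. character \<Lambda> z * \<rho> (inverse z) $$ (i, j)) =
        (\<Sum>l<n. LINT z|\<mu>. \<rho> (inverse z) $$ (i, j) * \<rho> z $$ (l, l))"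
      unfolding True character_rep_class[OF \<rho>(1)] by (rule sum[OF rep(1) \<rho>(2)])
    also have "\<dots> = (\<Sum>l<n. if l = i then (if i = j then volume / of_nat n else 0) else 0)"
      using ij by (intro sum.cong refl) (auto simp: integral_rep_mult_same[OF \<rho>])
    finally show ?thesis using True ij by simp
  next
    case False
    then have "\<not> rep_iso \<sigma> \<rho>" using rep_class_eq[OF \<sigma>(1) \<rho>(1)] \<sigma>(2) by blast
    then have "(\<Sum>l<m. LINT z|\<mu>. \<rho> (inverse z) $$ (i, j) * \<sigma> z $$ (l, l)) = 0"
      using ij by (intro sum.neutral ballI integral_rep_mult_distinct[OF \<rho> \<sigma>(1) m_def[symmetric]]) auto
    then show ?thesis
      unfolding \<sigma>(2) character_rep_class[OF \<sigma>(1)] sum[OF rep(2) m_def[symmetric]] using False \<sigma>(2) by simp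
  qed
qed

lemma continuous_character:
  assumes "\<Lambda> \<in> irrep_classes"
  shows "continuous_on UNIV (character \<Lambda>)"
proof -
  obtain \<rho> where \<rho>: "irreducible_rep \<rho>" "\<Lambda> = rep_class \<rho>" using irrep_classesE[OF assms] by blast
  define n where "n = rep_dim \<rho>"
  have rep: "representation \<rho>" using \<rho> by (simp add: irreducible_rep_def)
  have "continuous_on UNIV (\<lambda>x. \<Sum>i<n. \<rho> x $$ (i, i))"
    by (intro continuous_intros representation_facts(4)[OF rep n_def[symmetric]]) auto
  moreover have "character \<Lambda> x = (\<Sum>i<n. \<rho> x $$ (i, i))" for x
    unfolding \<rho>(2) character_rep_class[OF \<rho>(1)]
    by (simp add: mat_trace_def carrier_matD(1)[OF representation_facts(1)[OF rep n_def[symmetric]]])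
  ultimately show ?thesis by simp
qed

lemma character_le:
  fixes x :: 'a
  shows "\<Lambda> \<in> irrep_classes \<Longrightarrow> cmod (character \<Lambda> x) \<le> real (class_dim \<Lambda>)"
proof (elim irrep_classesE)
  fix \<rho> assume \<rho>: "irreducible_rep \<rho>" "\<Lambda> = rep_class \<rho>"
  then have "representation \<rho>" by (simp add: irreducible_rep_def)
  from character_bound[OF this refl] show ?thesis by (simp add: \<rho> character_rep_class class_dim_rep_class)
qed

lemma character_one: "\<Lambda> \<in> irrep_classes \<Longrightarrow> character \<Lambda> 1 = of_nat (class_dim \<Lambda>)"
proof (elim irrep_classesE)
  fix \<rho> assume \<rho>: "irreducible_rep \<rho>" "\<Lambda> = rep_class \<rho>"
  then have "\<rho> 1 = 1\<^sub>m (rep_dim \<rho>)" by (simp add: irreducible_rep_def representation_def)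
  then show ?thesis by (simp add: \<rho> character_rep_class class_dim_rep_class mat_trace_def)
qed

lemma class_dim_pos: "\<Lambda> \<in> irrep_classes \<Longrightarrow> class_dim \<Lambda> > 0"
  by (auto elim!: irrep_classesE simp: class_dim_rep_class irreducible_rep_def)

text \<open>By the Frobenius-Schur theorem these are exactly the classes of nonzero indicator. Their
  characters are the real-valued ones, whence the name.\<close>

definition real_classes :: "('a \<Rightarrow> complex mat) set set" where
  "real_classes = irrep_classes1 \<mu> \<union> irrep_classes4 \<mu>"

lemma real_classesD:
  "\<Lambda> \<in> real_classes \<Longrightarrow> \<Lambda> \<in> irrep_classes \<and> (fs_indicator \<mu> \<Lambda> = 1 \<or> fs_indicator \<mu> \<Lambda> = -1)"
  by (auto simp: real_classes_def irrep_classes1_def irrep_classes4_def)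

text \<open>The volume distribution has the scalar coefficient (V \<epsilon> / d)^k at a
  representation of dimension d, and the character of its class has V / d there. The quotient of the
  two is the factor that the character must carry.\<close>

definition fourier_coeff :: "nat \<Rightarrow> ('a \<Rightarrow> complex mat) set \<Rightarrow> complex" where
  "fourier_coeff k \<Lambda> = volume ^ (k - 1) * fs_indicator \<mu> \<Lambda> ^ k / of_nat (class_dim \<Lambda>) ^ (k - 1)"

text \<open>The Fourier series of \<open>h\<^sub>k\<close>: since \<open>k \<ge> 1\<close>, the classes with indicator \<open>0\<close> drop out.\<close>

definition density :: "nat \<Rightarrow> 'a \<Rightarrow> complex" where
  "density k z = (\<Sum>\<^sub>\<infinity>\<Lambda>\<in>real_classes. fourier_coeff k \<Lambda> * character \<Lambda> z)"

lemma power_int_genus: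
  fixes x :: "'f::field_char_0"
  assumes "x \<noteq> 0" "k \<ge> 1"
  shows "x powi (2 - int k) = x / x ^ (k - 1)"
proof -
  have "2 - int k = 1 - int (k - 1)" using assms(2) by simp
  then show ?thesis using assms(1) by (simp only: power_int_diff power_int_1_right power_int_of_nat simp_thms)
qed

text \<open>The coefficient contributes the power 1 - k of the dimension and the character at most
  one further factor. Together this is the power in the convergence hypothesis, uniformly in z, as
  the Weierstrass test requires.\<close>

lemma fourier_coeff_norm:
  assumes "\<Lambda> \<in> real_classes" "k \<ge> 1"
  shows "cmod (fourier_coeff k \<Lambda> * character \<Lambda> z) \<le>
    measure \<mu> UNIV ^ (k - 1) * real (class_dim \<Lambda>) powi (2 - int k)"
proof -
  have \<Lambda>: "\<Lambda> \<in> irrep_classes" "cmod (fs_indicator \<mu> \<Lambda>) = 1" using real_classesD[OF assms(1)] by auto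
  have "cmod (fourier_coeff k \<Lambda> * character \<Lambda> z) =
    measure \<mu> UNIV ^ (k - 1) / real (class_dim \<Lambda>) ^ (k - 1) * cmod (character \<Lambda> z)"
    using \<Lambda>(2) by (simp add: fourier_coeff_def norm_mult norm_divide norm_power)
  also have "\<dots> \<le> measure \<mu> UNIV ^ (k - 1) / real (class_dim \<Lambda>) ^ (k - 1) * real (class_dim \<Lambda>)"
    by (intro mult_left_mono character_le \<Lambda>) simp
  also have "\<dots> = measure \<mu> UNIV ^ (k - 1) * real (class_dim \<Lambda>) powi (2 - int k)"
    using class_dim_pos[OF \<Lambda>(1)] assms(2) by (simp add: power_int_genus)
  finally show ?thesis .
qed

lemma density_limit:
  assumes "(\<lambda>\<Lambda>. real (class_dim \<Lambda>) powi (2 - int k)) summable_on real_classes" "k \<ge> 1"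
  shows "uniform_limit UNIV (\<lambda>C z. \<Sum>\<Lambda>\<in>C. fourier_coeff k \<Lambda> * character \<Lambda> z) (density k)
    (finite_subsets_at_top real_classes)"
  unfolding density_def[abs_def]
  by (rule Weierstrass_m_test_general[OF fourier_coeff_norm])
    (use assms in \<open>auto intro: summable_on_cmult_right\<close>)

lemma continuous_partial_sum:
  assumes "C \<subseteq> irrep_classes"
  shows "continuous_on UNIV (\<lambda>z. \<Sum>\<Lambda>\<in>C. fourier_coeff k \<Lambda> * character \<Lambda> z)"
  using assms by (intro continuous_intros continuous_character) auto

lemma continuous_density:
  assumes "(\<lambda>\<Lambda>. real (class_dim \<Lambda>) powi (2 - int k)) summable_on real_classes" "k \<ge> 1"
  shows "continuous_on UNIV (density k)"
proof (rule uniform_limit_theorem[OF _ density_limit[OF assms]])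
  show "\<forall>\<^sub>F C in finite_subsets_at_top real_classes.
      continuous_on UNIV (\<lambda>z. \<Sum>\<Lambda>\<in>C. fourier_coeff k \<Lambda> * character \<Lambda> z)"
    using real_classesD by (intro eventually_finite_subsets_at_top_weakI continuous_partial_sum) blast
qed simp

text \<open>Uniform convergence permits termwise integration, and only the class of \<rho> can
  contribute. If that class is not among the summands, its indicator is 0 by the Frobenius-Schur
  theorem, and the right-hand side vanishes as well because k is positive.\<close>

lemma fourier_density:
  assumes sum: "(\<lambda>\<Lambda>. real (class_dim \<Lambda>) powi (2 - int k)) summable_on real_classes" and k: "k \<ge> 1"
    and \<rho>: "irreducible_rep \<rho>" "rep_dim \<rho> = n" and ij: "i < n" "j < n"
  shows "(LINT z|\<mu>. density k z * \<rho> (inverse z) $$ (i, j)) =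
    (if i = j then ((LINT x|\<mu>. mat_trace (\<rho> (x * x))) / of_nat n) ^ k else 0)"
proof -
  have rep: "representation \<rho>" and n: "n > 0" using \<rho> by (auto simp: irreducible_rep_def)
  define \<epsilon> where "\<epsilon> = fs_indicator \<mu> (rep_class \<rho>)"
  have \<epsilon>: "(LINT x|\<mu>. mat_trace (\<rho> (x * x))) = volume * \<epsilon>"
    using volume_pos by (simp add: \<epsilon>_def fs_indicator_rep_class[OF \<rho>(1)])
  let ?F = "finite_subsets_at_top real_classes"
  \<comment> \<open>The intersection makes the partial sum continuous for every index set C, as the
    limit theorem asks; for the sets that matter it changes nothing.\<close>
  define S where "S C z = (\<Sum>\<Lambda>\<in>C \<inter> irrep_classes. fourier_coeff k \<Lambda> * character \<Lambda> z)" for C z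
  have cS: "continuous_on UNIV (S C)" for C unfolding S_def by (rule continuous_partial_sum) simp
  have "uniform_limit UNIV S (density k) ?F"
  proof (rule uniform_limit_cong[THEN iffD1, OF _ _ density_limit[OF sum k]])
    show "\<forall>\<^sub>F C in ?F. \<forall>z\<in>UNIV. (\<Sum>\<Lambda>\<in>C. fourier_coeff k \<Lambda> * character \<Lambda> z) = S C z"
    proof (rule eventually_finite_subsets_at_top_weakI)
      fix C assume "finite C" "C \<subseteq> real_classes"
      then have "C \<inter> irrep_classes = C" using real_classesD by blast
      then show "\<forall>z\<in>UNIV. (\<Sum>\<Lambda>\<in>C. fourier_coeff k \<Lambda> * character \<Lambda> z) = S C z" by (simp add: S_def)
    qed
  qed simp
  moreover have c\<rho>: "continuous_on UNIV (\<lambda>z. \<rho> (inverse z) $$ (i, j))"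
    by (intro continuous_comp_UNIV[OF representation_facts(4)[OF rep \<rho>(2) ij]] continuous_intros)
  ultimately have lim: "((\<lambda>C. LINT z|\<mu>. S C z * \<rho> (inverse z) $$ (i, j)) \<longlongrightarrow>
      (LINT z|\<mu>. density k z * \<rho> (inverse z) $$ (i, j))) ?F"
    by (intro tendsto_integral_uniform[where \<tau> = "\<lambda>z. z"] finite_borel_haar cS continuous_density[OF sum k]
        continuous_intros)
  define L where "L = (if rep_class \<rho> \<in> real_classes \<and> i = j then fourier_coeff k (rep_class \<rho>) * (volume / of_nat n) else 0)"
  \<comment> \<open>By orthogonality the integral is constant as soon as C contains the class of
    \<rho>, provided that this class is one of the summands at all.\<close>
  have "\<forall>\<^sub>F C in ?F. (LINT z|\<mu>. S C z * \<rho> (inverse z) $$ (i, j)) = L"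
    unfolding eventually_finite_subsets_at_top
  proof (intro exI conjI allI impI)
    fix C assume C: "finite C \<and> {rep_class \<rho>} \<inter> real_classes \<subseteq> C \<and> C \<subseteq> real_classes"
    then have Ci: "C \<inter> irrep_classes = C" using real_classesD by blast
    have Ccl: "\<Lambda> \<in> irrep_classes" if "\<Lambda> \<in> C" for \<Lambda> using that Ci by blast
    have "(LINT z|\<mu>. S C z * \<rho> (inverse z) $$ (i, j)) =
        (LINT z|\<mu>. (\<Sum>\<Lambda>\<in>C. fourier_coeff k \<Lambda> * (character \<Lambda> z * \<rho> (inverse z) $$ (i, j))))"
      by (simp add: S_def Ci sum_distrib_right mult.assoc)
    also have "\<dots> = (\<Sum>\<Lambda>\<in>C. LINT z|\<mu>. fourier_coeff k \<Lambda> * (character \<Lambda> z * \<rho> (inverse z) $$ (i, j)))"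
      by (intro Bochner_Integration.integral_sum integrable_mult_right integrable_continuous finite_borel_haar
          continuous_intros c\<rho> continuous_character Ccl)
    also have "\<dots> = (\<Sum>\<Lambda>\<in>C. if \<Lambda> = rep_class \<rho> then (if i = j then fourier_coeff k \<Lambda> * (volume / of_nat n) else 0) else 0)"
      by (intro sum.cong refl) (simp add: integral_character_rep[OF \<rho> Ccl ij])
    also have "\<dots> = L" using C by (auto simp: L_def sum.delta)
    finally show "(LINT z|\<mu>. S C z * \<rho> (inverse z) $$ (i, j)) = L" .
  qed auto
  then have "((\<lambda>C. LINT z|\<mu>. S C z * \<rho> (inverse z) $$ (i, j)) \<longlongrightarrow> L) ?F"
    by (rule tendsto_eventually)
  with lim have "(LINT z|\<mu>. density k z * \<rho> (inverse z) $$ (i, j)) = L"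
    by (rule tendsto_unique[OF finite_subsets_at_top_neq_bot])
  also have "L = (if i = j then (volume * \<epsilon> / of_nat n) ^ k else 0)"
  proof (cases "rep_class \<rho> \<in> real_classes")
    case True
    obtain k' where k': "k = Suc k'" using k by (cases k) auto
    show ?thesis using True n
      by (simp add: L_def fourier_coeff_def class_dim_rep_class[OF \<rho>(1)] \<rho>(2) \<epsilon>_def[symmetric] k'
          power_divide power_mult_distrib mult_ac)
  next
    case False
    then have "\<epsilon> \<noteq> 1" "\<epsilon> \<noteq> -1"
      using rep_class_in[OF \<rho>(1)] by (auto simp: real_classes_def irrep_classes1_def irrep_classes4_def \<epsilon>_def)
    moreover have "\<epsilon> \<in> {0, 1, -1}" using Frobenius_Schur[OF \<rho>] by (simp add: \<epsilon>_def fs_indicator_rep_class[OF \<rho>(1)])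
    ultimately have "\<epsilon> = 0" by blast
    then show ?thesis using False k by (simp add: L_def)
  qed
  finally show ?thesis unfolding \<epsilon> .
qed

section \<open>The push-forward measure and its Fourier coefficients\<close>

sublocale product_sigma_finite "\<lambda>_ :: nat. \<mu>"
  by (rule product_sigma_finite.intro) (rule sigma_finite_measure_axioms)

abbreviation power_measure :: "nat \<Rightarrow> (nat \<Rightarrow> 'a) measure" where
  "power_measure k \<equiv> Pi\<^sub>M {..<k} (\<lambda>_. \<mu>)"

lemma finite_power_measure: "finite_measure (power_measure k)"
proof (rule finite_measureI)
  have "emeasure (power_measure k) (Pi\<^sub>E {..<k} (\<lambda>_. UNIV)) = (\<Prod>i<k. emeasure \<mu> UNIV)"
    by (rule emeasure_PiM) (auto simp: sets_haar)
  then show "emeasure (power_measure k) (space (power_measure k)) \<noteq> \<infinity>"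
    by (simp add: space_PiM emeasure_eq_measure ennreal_power)
qed

text \<open>The number of factors and the number of variables are kept apart so that the induction
  takes place over one fixed product space.\<close>

lemma measurable_presentation_map:
  "k \<le> n \<Longrightarrow> presentation_map k \<in> borel_measurable (power_measure n)"
proof (induction k)
  case 0
  then show ?case by (simp add: presentation_map_def[abs_def])
next
  case (Suc k)
  have "(\<lambda>x. x k) \<in> measurable (power_measure n) \<mu>"
    using Suc.prems by (intro measurable_component_singleton) auto
  then have k: "(\<lambda>x. x k) \<in> borel_measurable (power_measure n)"
    using measurable_cong_sets[OF refl sets_haar] by blast
  have "(\<lambda>x. presentation_map k x * (x k * x k)) \<in> borel_measurable (power_measure n)"
    using Suc by (intro borel_measurable_continuous_Pair[where H = "\<lambda>a b. a * b"] k
        continuous_on_subset[OF cont_mult]) (auto simp: continuous_intros)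
  then show ?case by (simp add: presentation_map_Suc[abs_def])
qed

definition volume_measure :: "nat \<Rightarrow> 'a measure" where
  "volume_measure k = distr (power_measure k) borel (presentation_map k)"

lemma finite_borel_volume_measure: "finite_borel (volume_measure k)"
  unfolding finite_borel_def volume_measure_def
  using finite_measure.finite_measure_distr[OF finite_power_measure measurable_presentation_map[OF order_refl]]
  by simp

lemma integral_volume_measure:
  fixes g :: "'a \<Rightarrow> complex"
  assumes "continuous_on UNIV g"
  shows "(LINT z|volume_measure k. g z) = volume_distribution \<mu> k g"
  unfolding volume_measure_def volume_distribution_def
  by (intro integral_distr measurable_presentation_map borel_measurable_continuous_onI assms order_refl)

text \<open>Inversion reverses the product of squares, so the last variable stands on the left as
  \<open>\<rho> (inverse (y * y))\<close>. Its integral is a scalar matrix, and every variable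
  contributes the same scalar.\<close>

lemma fourier_volume_measure:
  assumes \<rho>: "irreducible_rep \<rho>" "rep_dim \<rho> = n" and ij: "i < n" "j < n"
  shows "(LINT z|volume_measure k. \<rho> (inverse z) $$ (i, j)) =
    (if i = j then ((LINT x|\<mu>. mat_trace (\<rho> (x * x))) / of_nat n) ^ k else 0)"
proof -
  define s where "s = (LINT x|\<mu>. mat_trace (\<rho> (x * x))) / of_nat n"
  have rep: "representation \<rho>" using \<rho> by (auto simp: irreducible_rep_def)
  note \<rho>c = representation_facts(1)[OF rep \<rho>(2)] and \<rho>m = representation_facts(3)[OF rep \<rho>(2)]
  note c\<rho> = representation_facts(4)[OF rep \<rho>(2)]
  have c\<rho>': "continuous_on UNIV (\<lambda>z. \<rho> (inverse z) $$ (i, j))" if "i < n" "j < n" for i j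
    by (intro continuous_comp_UNIV[OF c\<rho>[OF that]] continuous_intros)
  \<comment> \<open>The inverse of a square is the square of the inverse, so inversion invariance of
    the Haar integral removes the inverse.\<close>
  have sq: "(LINT y|\<mu>. \<rho> (inverse (y * y)) $$ (i, l)) = (if i = l then s else 0)" if "i < n" "l < n" for i l
  proof -
    have "(LINT y|\<mu>. \<rho> (inverse (y * y)) $$ (i, l)) = (LINT y|\<mu>. \<rho> (y * y) $$ (i, l))"
      using integral_inverse[of "\<lambda>y. \<rho> (y * y) $$ (i, l)"]
      by (simp add: group_inverse_mult continuous_intros continuous_comp_UNIV[OF c\<rho>[OF that]])
    also have "\<dots> = mint n n (\<lambda>x. \<rho> (x * x)) $$ (i, l)" using that by (simp add: mint_def)
    also have "\<dots> = (if i = l then s else 0)"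
      unfolding integral_rep_square[OF \<rho>] using that by (simp add: s_def)
    finally show ?thesis .
  qed
  have "(LINT x|power_measure k. \<rho> (inverse (presentation_map k x)) $$ (i, j)) = (if i = j then s ^ k else 0)"
    if "i < n" "j < n" for i j
    using that
  proof (induction k)
    case 0
    then show ?case
      using representation_facts(2)[OF rep \<rho>(2)]
      by (simp add: PiM_empty lebesgue_integral_count_space_finite presentation_map_def group_inverse_one)
  next
    case (Suc k)
    have ins: "{..<Suc k} = insert k {..<k}" by auto
    have int: "integrable (power_measure (Suc k)) (\<lambda>x. \<rho> (inverse (presentation_map (Suc k) x)) $$ (i, j))"
    proof -
      obtain B where "\<And>z. cmod (\<rho> (inverse z) $$ (i, j)) \<le> B"
        using continuous_bounded[OF c\<rho>'[OF Suc.prems]] by blast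
      then show ?thesis
        using measurable_compose[OF measurable_presentation_map[OF order_refl]
            borel_measurable_continuous_onI[OF c\<rho>'[OF Suc.prems]], of "Suc k"]
        by (intro finite_measure.integrable_const_bound[OF finite_power_measure, where B = B]) auto
    qed
    have "(LINT x|power_measure (Suc k). \<rho> (inverse (presentation_map (Suc k) x)) $$ (i, j)) =
        (LINT x|power_measure k. LINT y|\<mu>. \<rho> (inverse (presentation_map (Suc k) (x(k := y)))) $$ (i, j))"
      using int unfolding ins by (intro product_integral_insert) auto
    also have "\<dots> = (LINT x|power_measure k. s * \<rho> (inverse (presentation_map k x)) $$ (i, j))"
    proof (intro Bochner_Integration.integral_cong refl)
      fix x :: "nat \<Rightarrow> 'a"
      let ?r = "presentation_map k x"
      have "presentation_map k (x(k := y)) = ?r" for y by (rule presentation_map_cong) simp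
      then have "(LINT y|\<mu>. \<rho> (inverse (presentation_map (Suc k) (x(k := y)))) $$ (i, j)) =
          (LINT y|\<mu>. (\<Sum>l<n. \<rho> (inverse (y * y)) $$ (i, l) * \<rho> (inverse ?r) $$ (l, j)))"
        by (simp only: presentation_map_Suc group_inverse_mult[of ?r] \<rho>m[of "inverse (_ * _)" "inverse ?r"]
            index_mult_mat_sum[OF \<rho>c \<rho>c Suc.prems] fun_upd_same)
      also have "\<dots> = (\<Sum>l<n. (LINT y|\<mu>. \<rho> (inverse (y * y)) $$ (i, l)) * \<rho> (inverse ?r) $$ (l, j))"
        using Suc.prems by (subst Bochner_Integration.integral_sum)
          (auto intro!: integrable_mult_left integrable_continuous finite_borel_haar continuous_intros
            continuous_comp_UNIV[OF c\<rho>])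
      also have "\<dots> = (\<Sum>l<n. if l = i then s * \<rho> (inverse ?r) $$ (l, j) else 0)"
        using Suc.prems by (intro sum.cong refl) (auto simp: sq)
      also have "\<dots> = s * \<rho> (inverse ?r) $$ (i, j)" using Suc.prems by simp
      finally show "(LINT y|\<mu>. \<rho> (inverse (presentation_map (Suc k) (x(k := y)))) $$ (i, j)) =
        s * \<rho> (inverse ?r) $$ (i, j)" .
    qed
    also have "\<dots> = (if i = j then s ^ Suc k else 0)" using Suc by simp
    finally show ?case .
  qed
  from this[OF ij] show ?thesis
    unfolding integral_volume_measure[OF c\<rho>'[OF ij]] volume_distribution_def s_def .
qed

text \<open>After the substitution of x * inverse z for x, the integral splits into the coefficient
  matrix of g times that of the measure with density h relative to N. So the smeared function sees
  this measure only through its coefficients. The pair N, h covers both the push-forward measure and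
  the Haar measure with \<open>density k\<close>.\<close>

lemma fourier_translate:
  assumes N: "finite_borel N" and h: "continuous_on UNIV h" and g: "continuous_on UNIV g"
    and \<rho>: "representation \<rho>" "rep_dim \<rho> = n" and ij: "i < n" "j < n"
  shows "(LINT x|\<mu>. (LINT z|N. h z * g (x * z)) * \<rho> x $$ (i, j)) =
    (\<Sum>l<n. (LINT x|\<mu>. g x * \<rho> x $$ (i, l)) * (LINT z|N. h z * \<rho> (inverse z) $$ (l, j)))"
proof -
  note \<rho>c = representation_facts(1)[OF \<rho>] and \<rho>m = representation_facts(3)[OF \<rho>]
  note c\<rho> = representation_facts(4)[OF \<rho>]
  note comp = c\<rho>[THEN continuous_comp_UNIV] g[THEN continuous_comp_UNIV] h[THEN continuous_comp_UNIV]
  have "(LINT x|\<mu>. (LINT z|N. h z * g (x * z)) * \<rho> x $$ (i, j)) =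
      (LINT x|\<mu>. LINT z|N. h z * g (x * z) * \<rho> x $$ (i, j))" by simp
  also have "\<dots> = (LINT z|N. LINT x|\<mu>. h z * g (x * z) * \<rho> x $$ (i, j))"
    by (intro Fubini_continuous finite_borel_haar N continuous_intros comp ij)
  also have "\<dots> = (LINT z|N. (\<Sum>l<n. (LINT x|\<mu>. g x * \<rho> x $$ (i, l)) * (h z * \<rho> (inverse z) $$ (l, j))))"
  proof (intro Bochner_Integration.integral_cong refl)
    fix z
    have "(LINT x|\<mu>. g (x * z) * \<rho> x $$ (i, j)) = (LINT x|\<mu>. g x * \<rho> (x * inverse z) $$ (i, j))"
      using integral_right_translate[of "\<lambda>x. g (x * z) * \<rho> x $$ (i, j)" "inverse z"]
      by (simp add: group_simps continuous_intros comp ij)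
    also have "\<dots> = (LINT x|\<mu>. (\<Sum>l<n. (g x * \<rho> x $$ (i, l)) * \<rho> (inverse z) $$ (l, j)))"
      unfolding \<rho>m index_mult_mat_sum[OF \<rho>c \<rho>c ij] by (simp add: sum_distrib_left mult.assoc)
    also have "\<dots> = (\<Sum>l<n. (LINT x|\<mu>. g x * \<rho> x $$ (i, l)) * \<rho> (inverse z) $$ (l, j))"
      using ij by (subst Bochner_Integration.integral_sum)
        (auto intro!: integrable_mult_left integrable_continuous finite_borel_haar continuous_intros comp)
    finally show "(LINT x|\<mu>. h z * g (x * z) * \<rho> x $$ (i, j)) =
      (\<Sum>l<n. (LINT x|\<mu>. g x * \<rho> x $$ (i, l)) * (h z * \<rho> (inverse z) $$ (l, j)))"
      by (simp add: mult.assoc sum_distrib_left mult.left_commute)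
  qed
  also have "\<dots> = (\<Sum>l<n. (LINT x|\<mu>. g x * \<rho> x $$ (i, l)) * (LINT z|N. h z * \<rho> (inverse z) $$ (l, j)))"
    using ij by (subst Bochner_Integration.integral_sum)
      (auto intro!: integrable_mult_right integrable_continuous N continuous_intros comp)
  finally show ?thesis .
qed

theorem volume_distribution_eq_density:
  assumes sum: "(\<lambda>\<Lambda>. real (class_dim \<Lambda>) powi (2 - int k)) summable_on real_classes" and k: "k \<ge> 1"
    and g: "continuous_on UNIV g"
  shows "volume_distribution \<mu> k g = (LINT z|\<mu>. density k z * g z)"
proof -
  note d = continuous_density[OF sum k]
  note comp = g[THEN continuous_comp_UNIV] d[THEN continuous_comp_UNIV]
  \<comment> \<open>The factor 1 is the constant h that brings the first integral into the form of
    \<open>fourier_translate\<close>. The value at x = 1 is the difference to be shown zero.\<close>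
  define F where "F x = (LINT z|volume_measure k. 1 * g (x * z)) - (LINT z|\<mu>. density k z * g (x * z))" for x
  have c: "continuous_on UNIV (\<lambda>x. LINT z|volume_measure k. 1 * g (x * z))"
    "continuous_on UNIV (\<lambda>x. LINT z|\<mu>. density k z * g (x * z))"
    by (intro continuous_integral finite_borel_volume_measure finite_borel_haar continuous_intros comp)+
  have F: "continuous_on UNIV F" unfolding F_def by (intro continuous_intros c)
  have "F 1 = 0"
  proof (rule Peter_Weyl_uniqueness[OF F])
    fix \<rho> :: "'a \<Rightarrow> complex mat" and i j
    assume \<rho>: "irreducible_rep \<rho>" and ij: "i < rep_dim \<rho>" "j < rep_dim \<rho>"
    let ?n = "rep_dim \<rho>"
    have rep: "representation \<rho>" using \<rho> by (simp add: irreducible_rep_def)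
    have c\<rho>: "continuous_on UNIV (\<lambda>x. \<rho> x $$ (i, j))" by (rule representation_facts(4)[OF rep refl ij])
    have "(LINT x|\<mu>. F x * \<rho> x $$ (i, j)) =
      (LINT x|\<mu>. (LINT z|volume_measure k. 1 * g (x * z)) * \<rho> x $$ (i, j)) -
      (LINT x|\<mu>. (LINT z|\<mu>. density k z * g (x * z)) * \<rho> x $$ (i, j))"
      unfolding F_def left_diff_distrib
      by (intro Bochner_Integration.integral_diff integrable_continuous finite_borel_haar continuous_on_mult c c\<rho>)
    also have "\<dots> = 0"
      unfolding fourier_translate[OF finite_borel_volume_measure continuous_on_const g rep refl ij]
        fourier_translate[OF finite_borel_haar d g rep refl ij]
      using ij by (simp add: fourier_volume_measure[OF \<rho> refl] fourier_density[OF sum k \<rho> refl])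
    finally show "(LINT x|\<mu>. F x * \<rho> x $$ (i, j)) = 0" .
  qed
  then show ?thesis by (simp add: F_def integral_volume_measure[OF g])
qed

end

section \<open>Local representatives and their values\<close>

lemma haar_group_compact_lie_group:
  fixes A :: "('a::{group_mult, t2_space, second_countable_topology}, 'e::real_inner) atlas"
    and \<mu> :: "'a measure"
  assumes "compact_lie_group A" "bi_invariant_haar \<mu>"
  shows "haar_group \<mu>"
proof -
  interpret compact_lie_group A by fact
  have "continuous_on UNIV (\<lambda>p :: 'a \<times> 'a. fst p * snd p)"
    using smooth_mult by (simp add: smooth_map_def case_prod_beta')
  moreover have "continuous_on UNIV (inverse :: 'a \<Rightarrow> 'a)"
    using smooth_inverse by (simp add: smooth_map_def)
  ultimately show ?thesis using compact assms(2) by unfold_locales auto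
qed

context compact_lie_group
begin

lemma smooth_fun_continuous_on:
  assumes f: "smooth_fun A W f" and W: "open W"
  shows "continuous_on W f"
proof (rule continuous_at_imp_continuous_on, rule ballI)
  fix x assume x: "x \<in> W"
  have "x \<in> (\<Union>(U, \<phi>)\<in>A. U)" using atlas unfolding smooth_atlas_def by simp
  then obtain U \<phi> where U: "(U, \<phi>) \<in> A" "x \<in> U" by blast
  have chart: "open U" "inj_on \<phi> U" "continuous_on U \<phi>"
    using atlas U(1) unfolding smooth_atlas_def by fast+
  have "smooth_on (\<phi> ` (U \<inter> W)) (f \<circ> inv_into U \<phi>)"
    using f U(1) unfolding smooth_fun_def by fast
  then have "Ck_on 0 (\<phi> ` (U \<inter> W)) (f \<circ> inv_into U \<phi>)" unfolding smooth_on_def by blast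
  then have "continuous_on (\<phi> ` (U \<inter> W)) (f \<circ> inv_into U \<phi>)" by simp
  then have "continuous_on (U \<inter> W) (\<lambda>y. (f \<circ> inv_into U \<phi>) (\<phi> y))"
    by (rule continuous_on_compose2) (auto intro: continuous_on_subset[OF chart(3)])
  moreover have "(f \<circ> inv_into U \<phi>) (\<phi> y) = f y" if "y \<in> U \<inter> W" for y
    using that chart(2) by simp
  ultimately have "continuous_on (U \<inter> W) f" by (rule continuous_on_eq)
  moreover have "open (U \<inter> W)" using chart(1) W by blast
  ultimately show "isCont f x" using x U(2) continuous_on_eq_continuous_at by blast
qed

text \<open>If the values differ by \<delta>, the real part q of cnj \<delta> * (f - h) is positive
  near p. A bump function g supported there gives q * g a vanishing integral, although it is
  continuous, nonnegative and positive at p. Only continuity of f and h is assumed, since one of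
  them will be \<open>density k\<close>.\<close>

lemma represented_on_value_unique:
  fixes D :: "('a \<Rightarrow> complex) \<Rightarrow> complex"
  assumes \<mu>: "bi_invariant_haar \<mu>" and W: "open W" "p \<in> W"
    and f: "continuous_on W f" "represented_on A \<mu> D W f"
    and h: "continuous_on W h" "represented_on A \<mu> D W h"
  shows "f p = h p"
proof (rule ccontr)
  interpret haar_group \<mu> by (rule haar_group_compact_lie_group[OF compact_lie_group_axioms \<mu>])
  assume "f p \<noteq> h p"
  define \<delta> where "\<delta> = f p - h p"
  define q where "q x = Re (cnj \<delta> * (f x - h x))" for x
  have q: "continuous_on W q" unfolding q_def by (intro continuous_intros f h)
  have "q p = (cmod \<delta>)\<^sup>2" unfolding q_def \<delta>_def[symmetric] cmod_power2 by (simp add: power2_eq_square)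
  then have qp: "q p > 0" using \<open>f p \<noteq> h p\<close> by (simp add: \<delta>_def)
  define U where "U = W \<inter> q -` {0<..}"
  have U: "open U" unfolding U_def
    using continuous_on_open_vimage[OF W(1), of q] q by (simp add: Int_commute)
  have pU: "p \<in> U" using qp W(2) by (simp add: U_def)
  obtain g where g: "smooth_fun A UNIV (\<lambda>x. complex_of_real (g x))" "closure {x. g x \<noteq> 0} \<subseteq> U"
      "\<And>x. g x \<ge> 0" "g p > 0" "continuous_on UNIV g"
    using smooth_bump[OF U pU] by blast
  let ?g = "\<lambda>x. complex_of_real (g x)"
  define K where "K = closure {x. g x \<noteq> 0}"
  have g0: "g x = 0" if "x \<notin> K" for x
    using that closure_subset[of "{x. g x \<noteq> 0}"] by (auto simp: K_def)
  have KU: "K \<subseteq> U" using g(2) by (simp add: K_def)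
  then have KW: "K \<subseteq> W" by (auto simp: U_def)
  \<comment> \<open>Nothing is known about u outside W, but the product with the bump function
    vanishes off K, and W together with the complement of K is an open cover.\<close>
  have cont: "continuous_on UNIV (\<lambda>x. u x * ?g x)" if u: "continuous_on W u" for u :: "'a \<Rightarrow> complex"
  proof -
    have "continuous_on W (\<lambda>x. u x * ?g x)"
      by (intro continuous_intros u continuous_on_subset[OF g(5)]) auto
    moreover have "continuous_on (- K) (\<lambda>x. u x * ?g x)"
      by (rule continuous_on_eq[OF continuous_on_const[of _ 0]]) (simp add: g0)
    ultimately have "continuous_on (W \<union> - K) (\<lambda>x. u x * ?g x)"
      using W(1) by (intro continuous_on_open_Un) (auto simp: K_def)
    moreover have "W \<union> - K = UNIV" using KW by blast
    ultimately show ?thesis by simp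
  qed
  have "{x. ?g x \<noteq> 0} = {x. g x \<noteq> 0}" by simp
  then have "(LINT x|\<mu>. f x * ?g x) = (LINT x|\<mu>. h x * ?g x)"
    using f(2) h(2) g(1) KW unfolding represented_on_def K_def by metis
  then have "(LINT x|\<mu>. f x * ?g x - h x * ?g x) = 0"
    by (simp add: integrable_continuous[OF finite_borel_haar] cont f(1) h(1))
  then have "(LINT x|\<mu>. (cnj \<delta> * (f x - h x)) * ?g x) = 0"
    by (simp add: left_diff_distrib[symmetric] mult.assoc)
  moreover have "integrable \<mu> (\<lambda>x. (cnj \<delta> * (f x - h x)) * ?g x)"
    by (intro integrable_continuous[OF finite_borel_haar] cont continuous_intros f h)
  ultimately have q0: "(LINT x|\<mu>. q x * g x) = 0"
    using integral_Re[of \<mu> "\<lambda>x. (cnj \<delta> * (f x - h x)) * ?g x"] by (simp add: q_def)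
  have nonneg: "q x * g x \<ge> 0" for x
  proof (cases "x \<in> K")
    case True
    then have "q x > 0" using KU by (auto simp: U_def)
    then show ?thesis using g(3)[of x] by simp
  qed (simp add: g0)
  \<comment> \<open>The square root presents q * g as the square of a continuous function, so that
    definiteness of \<open>sqnorm\<close> applies.\<close>
  define r where "r x = complex_of_real (sqrt (q x * g x))" for x
  have "continuous_on UNIV (\<lambda>x. complex_of_real (q x) * ?g x)"
    by (intro cont continuous_on_of_real q)
  then have "continuous_on UNIV (\<lambda>x. Re (complex_of_real (q x) * ?g x))" by (rule continuous_on_Re)
  then have "continuous_on UNIV (\<lambda>x. q x * g x)" by simp
  then have r: "continuous_on UNIV r"
    unfolding r_def by (intro continuous_on_of_real continuous_on_real_sqrt)
  have "sqnorm r = (LINT x|\<mu>. q x * g x)"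
    unfolding sqnorm_altdef r_def using nonneg by (simp add: real_sqrt_pow2)
  then have "r p = 0" using sqnorm_eq_0[OF r] q0 by simp
  then show False using qp g(4) by (simp add: r_def)
qed

end

lemma represented_on_subset:
  "represented_on A \<mu> D W f \<Longrightarrow> V \<subseteq> W \<Longrightarrow> represented_on A \<mu> D V f"
  unfolding represented_on_def by blast

context haar_group
begin

text \<open>At 1 the character equals the dimension d, so a class of indicator x contributes x^k
  times the power 2 - k of d. For x = 1 or x = -1 this is the power 2 - k of x * d, which produces
  the minus sign in the second sum.\<close>

lemma density_one:
  fixes k :: nat
  assumes k: "k \<ge> 1"
    and sum1: "(\<lambda>\<Lambda>. real (class_dim \<Lambda>) powi (2 - int k)) summable_on irrep_classes1 \<mu>"
    and sum4: "(\<lambda>\<Lambda>. (- real (class_dim \<Lambda>)) powi (2 - int k)) summable_on irrep_classes4 \<mu>"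
  shows "density k 1 = volume ^ (k - 1) * complex_of_real
    ((\<Sum>\<^sub>\<infinity>\<Lambda>\<in>irrep_classes1 \<mu>. real (class_dim \<Lambda>) powi (2 - int k)) +
     (\<Sum>\<^sub>\<infinity>\<Lambda>\<in>irrep_classes4 \<mu>. (- real (class_dim \<Lambda>)) powi (2 - int k)))"
proof -
  let ?V = "measure \<mu> UNIV ^ (k - 1)"
  have summand: "fourier_coeff k \<Lambda> * character \<Lambda> 1 = complex_of_real (?V * (x * real (class_dim \<Lambda>)) powi (2 - int k))"
    if \<Lambda>: "\<Lambda> \<in> irrep_classes" "fs_indicator \<mu> \<Lambda> = of_real x" "x = 1 \<or> x = -1" for \<Lambda> and x :: real
  proof -
    have d: "class_dim \<Lambda> > 0" by (rule class_dim_pos[OF \<Lambda>(1)])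
    obtain k' where k': "k = Suc k'" using k by (cases k) auto
    have "(x * real (class_dim \<Lambda>)) powi (2 - int k) = x * real (class_dim \<Lambda>) / (x * real (class_dim \<Lambda>)) ^ (k - 1)"
      using d k \<Lambda>(3) by (intro power_int_genus) auto
    also have "\<dots> = x ^ k * (real (class_dim \<Lambda>) / real (class_dim \<Lambda>) ^ (k - 1))"
    proof -
      have "x ^ k' * x ^ k' = 1" using \<Lambda>(3) by (auto simp flip: power_mult_distrib)
      then have "x / x ^ k' = x ^ Suc k'" using \<Lambda>(3) by (auto simp: field_simps)
      then show ?thesis by (simp add: k' power_mult_distrib times_divide_times_eq[symmetric] del: times_divide_times_eq)
    qed
    finally show ?thesis by (simp add: fourier_coeff_def character_one[OF \<Lambda>(1)] \<Lambda>(2))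
  qed
  have 1: "((\<lambda>\<Lambda>. fourier_coeff k \<Lambda> * character \<Lambda> 1) has_sum
      complex_of_real (?V * (\<Sum>\<^sub>\<infinity>\<Lambda>\<in>irrep_classes1 \<mu>. real (class_dim \<Lambda>) powi (2 - int k)))) (irrep_classes1 \<mu>)"
  proof (rule has_sum_cong[THEN iffD2])
    show "fourier_coeff k \<Lambda> * character \<Lambda> 1 = complex_of_real (?V * real (class_dim \<Lambda>) powi (2 - int k))"
      if "\<Lambda> \<in> irrep_classes1 \<mu>" for \<Lambda>
      using that summand[of \<Lambda> 1] by (simp add: irrep_classes1_def)
    show "((\<lambda>\<Lambda>. complex_of_real (?V * real (class_dim \<Lambda>) powi (2 - int k))) has_sum
      complex_of_real (?V * (\<Sum>\<^sub>\<infinity>\<Lambda>\<in>irrep_classes1 \<mu>. real (class_dim \<Lambda>) powi (2 - int k)))) (irrep_classes1 \<mu>)"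
      by (intro has_sum_of_real has_sum_cmult_right has_sum_infsum sum1)
  qed
  have 4: "((\<lambda>\<Lambda>. fourier_coeff k \<Lambda> * character \<Lambda> 1) has_sum
      complex_of_real (?V * (\<Sum>\<^sub>\<infinity>\<Lambda>\<in>irrep_classes4 \<mu>. (- real (class_dim \<Lambda>)) powi (2 - int k)))) (irrep_classes4 \<mu>)"
  proof (rule has_sum_cong[THEN iffD2])
    show "fourier_coeff k \<Lambda> * character \<Lambda> 1 = complex_of_real (?V * (- real (class_dim \<Lambda>)) powi (2 - int k))"
      if "\<Lambda> \<in> irrep_classes4 \<mu>" for \<Lambda>
      using that summand[of \<Lambda> "-1"] by (simp add: irrep_classes4_def)
    show "((\<lambda>\<Lambda>. complex_of_real (?V * (- real (class_dim \<Lambda>)) powi (2 - int k))) has_sum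
      complex_of_real (?V * (\<Sum>\<^sub>\<infinity>\<Lambda>\<in>irrep_classes4 \<mu>. (- real (class_dim \<Lambda>)) powi (2 - int k)))) (irrep_classes4 \<mu>)"
      by (intro has_sum_of_real has_sum_cmult_right has_sum_infsum sum4)
  qed
  have "irrep_classes1 \<mu> \<inter> irrep_classes4 \<mu> = {}" by (auto simp: irrep_classes1_def irrep_classes4_def)
  from infsumI[OF has_sum_Un_disjoint[OF 1 4 this]]
  show ?thesis by (simp add: density_def real_classes_def distrib_left)
qed

end

text \<open>Convergence yields a continuous density, whereas \<open>hom_volume\<close> is defined
  through smooth local representatives. Hence the two conclusions: the equation for the volume when
  the distribution is regular at 1, and in every case the same equation for the value at 1 of a
  continuous local representative.\<close>

theorem theorem0p4:
  fixes A :: "('a::{group_mult, t2_space, second_countable_topology}, 'e::real_inner) atlas"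
    and \<mu> :: "'a measure"
    and k :: nat
    and euler :: int
  assumes "compact_lie_group A"
    and "bi_invariant_haar \<mu>"
    and "k \<ge> 1"
    and "euler = crosscap_euler_char k"
    and "(\<lambda>\<Lambda>. \<bar>real (class_dim \<Lambda>) powi euler\<bar>) summable_on irrep_classes1 \<mu>"
    and "(\<lambda>\<Lambda>. \<bar>(- real (class_dim \<Lambda>)) powi euler\<bar>) summable_on irrep_classes4 \<mu>"
  shows "let S = complex_of_real
                   ((\<Sum>\<^sub>\<infinity>\<Lambda>\<in>irrep_classes1 \<mu>. real (class_dim \<Lambda>) powi euler) +
                    (\<Sum>\<^sub>\<infinity>\<Lambda>\<in>irrep_classes4 \<mu>. (- real (class_dim \<Lambda>)) powi euler));
             c = complex_of_real (measure \<mu> UNIV powi (euler - 1))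
         in (regular_at A \<mu> (volume_distribution \<mu> k) 1 \<longrightarrow> S = c * hom_volume A \<mu> k) \<and>
            (\<exists>W f. open W \<and> 1 \<in> W \<and> continuous_on W f \<and>
               represented_on A \<mu> (volume_distribution \<mu> k) W f \<and> S = c * f 1)"
proof -
  interpret compact_lie_group A by fact
  interpret haar_group \<mu> by (rule haar_group_compact_lie_group) fact+
  have euler: "euler = 2 - int k" using assms(4) by (simp add: crosscap_euler_char_def)
  \<comment> \<open>For the classes of indicator -1 two series are recorded: the signed one, which
    appears in the result, and the one with positive dimensions, which is the majorant for uniform
    convergence.\<close>
  have sum1: "(\<lambda>\<Lambda>. real (class_dim \<Lambda>) powi (2 - int k)) summable_on irrep_classes1 \<mu>"
    and sum4: "(\<lambda>\<Lambda>. (- real (class_dim \<Lambda>)) powi (2 - int k)) summable_on irrep_classes4 \<mu>"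
    and sum4': "(\<lambda>\<Lambda>. real (class_dim \<Lambda>) powi (2 - int k)) summable_on irrep_classes4 \<mu>"
    using assms(5) abs_summable_summable[of "\<lambda>\<Lambda>. (- real (class_dim \<Lambda>)) powi euler"] assms(6)
    by (simp_all add: euler power_int_abs)
  have sum: "(\<lambda>\<Lambda>. real (class_dim \<Lambda>) powi (2 - int k)) summable_on real_classes"
    unfolding real_classes_def by (rule summable_on_union[OF sum1 sum4'])
  let ?D = "volume_distribution \<mu> k"
  define S where "S = complex_of_real
    ((\<Sum>\<^sub>\<infinity>\<Lambda>\<in>irrep_classes1 \<mu>. real (class_dim \<Lambda>) powi euler) +
     (\<Sum>\<^sub>\<infinity>\<Lambda>\<in>irrep_classes4 \<mu>. (- real (class_dim \<Lambda>)) powi euler))"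
  define c where "c = complex_of_real (measure \<mu> UNIV powi (euler - 1))"
  have cont: "continuous_on UNIV (density k)" by (rule continuous_density[OF sum assms(3)])
  have S: "S = c * density k 1"
  proof -
    \<comment> \<open>The power of the volume in the result is the inverse of the power that all
      Fourier coefficients share.\<close>
    have "euler - 1 = - int (k - 1)" using assms(3) by (simp add: euler)
    then have "measure \<mu> UNIV powi (euler - 1) * measure \<mu> UNIV ^ (k - 1) = 1"
      using volume_pos by (simp add: power_int_minus)
    then have "c * volume ^ (k - 1) = 1" unfolding c_def by (metis of_real_1 of_real_mult of_real_power)
    moreover have "density k 1 = volume ^ (k - 1) * S"
      unfolding S_def euler by (rule density_one[OF assms(3) sum1 sum4])
    ultimately show ?thesis by (simp flip: mult.assoc)
  qed
  have rep: "represented_on A \<mu> ?D UNIV (density k)"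
    unfolding represented_on_def
  proof (intro allI impI)
    fix g assume "smooth_fun A UNIV g \<and> closure {x. g x \<noteq> 0} \<subseteq> UNIV"
    then have "continuous_on UNIV g" using smooth_fun_continuous_on[of UNIV g] by simp
    then show "?D g = (LINT x|\<mu>. density k x * g x)"
      by (rule volume_distribution_eq_density[OF sum assms(3)])
  qed
  \<comment> \<open>Each smooth representative is compared with the restriction of
    \<open>density k\<close> to its own neighbourhood. This gives both the uniqueness that the
    definite description in \<open>distribution_value\<close> asks for and the value itself.\<close>
  have value_eq: "f 1 = density k 1"
    if "open W" "1 \<in> W" "smooth_fun A W f" "represented_on A \<mu> ?D W f" for W f
    using that by (intro represented_on_value_unique[OF assms(2), of W 1 f ?D "density k"]
        smooth_fun_continuous_on continuous_on_subset[OF cont] represented_on_subset[OF rep]) auto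
  have "S = c * hom_volume A \<mu> k" if reg: "regular_at A \<mu> ?D 1"
  proof -
    have "distribution_value A \<mu> ?D 1 = density k 1"
      unfolding distribution_value_def
    proof (rule the_equality)
      show "\<exists>W f. open W \<and> 1 \<in> W \<and> smooth_fun A W f \<and> represented_on A \<mu> ?D W f \<and> f 1 = density k 1"
        using reg value_eq unfolding regular_at_def by blast
    qed (use value_eq in blast)
    then show ?thesis unfolding hom_volume_def S by simp
  qed
  moreover have "\<exists>W f. open W \<and> 1 \<in> W \<and> continuous_on W f \<and> represented_on A \<mu> ?D W f \<and> S = c * f 1"
    using cont rep S by (intro exI[of _ UNIV] exI[of _ "density k"]) simp
  ultimately show ?thesis unfolding S_def c_def Let_def by blast
qed

end
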